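(* Let $S$ be an excellent regular ring of prime characteristic $p>0$. Then for any collection of radical ideals $\{J_i\}_i$ of $S$, we have $\bigcap_iJ_i^{[p]}=\left(\bigcap_iJ_i\right)^{[p]}$.
   Context: For an ideal $J$ of a ring $S$ of characteristic $p$, $J^{[p]}$ denotes the ideal generated by the $p$-th powers of elements of $J$. Regular rings are Noetherian by convention. *)

theory Defs
  imports "HOL-Algebra.Algebra" "HOL-Library.Extended_Nat"
begin

definition ring_char :: "('a, 'm) ring_scheme \<Rightarrow> nat" where
  "ring_char R =
     (if \<exists>n::nat. 0 < n \<and> [n] \<cdot>\<^bsub>R\<^esub> \<one>\<^bsub>R\<^esub> = \<zero>\<^bsub>R\<^esub>
      then LEAST n::nat. 0 < n \<and> [n] \<cdot>\<^bsub>R\<^esub> \<one>\<^bsub>R\<^esub> = \<zero>\<^bsub>R\<^esub>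
      else 0)"

definition radical :: "('a, 'm) ring_scheme \<Rightarrow> 'a set \<Rightarrow> 'a set" where
  "radical R J = {x \<in> carrier R. \<exists>n::nat. x [^]\<^bsub>R\<^esub> n \<in> J}"

definition radical_ideal :: "'a set \<Rightarrow> ('a, 'm) ring_scheme \<Rightarrow> bool" where
  "radical_ideal J R \<longleftrightarrow> ideal J R \<and> radical R J = J"

definition frobenius_power :: "('a, 'm) ring_scheme \<Rightarrow> nat \<Rightarrow> 'a set \<Rightarrow> 'a set" where
  "frobenius_power R p J = Idl\<^bsub>R\<^esub> ((\<lambda>x. x [^]\<^bsub>R\<^esub> p) ` J)"

definition frac_rel :: "('a, 'm) ring_scheme \<Rightarrow> 'a set \<Rightarrow> (('a \<times> 'a) \<times> ('a \<times> 'a)) set" where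
  "frac_rel R W =
     {((a, s), (b, t)) | a s b t. a \<in> carrier R \<and> b \<in> carrier R \<and> s \<in> W \<and> t \<in> W \<and>
        (\<exists>u\<in>W. u \<otimes>\<^bsub>R\<^esub> (t \<otimes>\<^bsub>R\<^esub> a) = u \<otimes>\<^bsub>R\<^esub> (s \<otimes>\<^bsub>R\<^esub> b))}"

definition fraction :: "('a, 'm) ring_scheme \<Rightarrow> 'a set \<Rightarrow> 'a \<Rightarrow> 'a \<Rightarrow> ('a \<times> 'a) set" where
  "fraction R W a s = frac_rel R W `` {(a, s)}"

definition localization :: "('a, 'm) ring_scheme \<Rightarrow> 'a set \<Rightarrow> ('a \<times> 'a) set ring" where
  "localization R W =
     \<lparr>carrier = (carrier R \<times> W) // frac_rel R W,
      monoid.mult = (\<lambda>A B. \<Union>x\<in>A. \<Union>y\<in>B.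
                fraction R W (fst x \<otimes>\<^bsub>R\<^esub> fst y) (snd x \<otimes>\<^bsub>R\<^esub> snd y)),
      one = fraction R W \<one>\<^bsub>R\<^esub> \<one>\<^bsub>R\<^esub>,
      ring.zero = fraction R W \<zero>\<^bsub>R\<^esub> \<one>\<^bsub>R\<^esub>,
      add = (\<lambda>A B. \<Union>x\<in>A. \<Union>y\<in>B.
               fraction R W ((snd y \<otimes>\<^bsub>R\<^esub> fst x) \<oplus>\<^bsub>R\<^esub> (snd x \<otimes>\<^bsub>R\<^esub> fst y))
                 (snd x \<otimes>\<^bsub>R\<^esub> snd y))\<rparr>"

definition localization_at :: "('a, 'm) ring_scheme \<Rightarrow> 'a set \<Rightarrow> ('a \<times> 'a) set ring" where
  "localization_at R P = localization R (carrier R - P)"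

definition residue_field :: "('a, 'm) ring_scheme \<Rightarrow> 'a set \<Rightarrow> ('a set \<times> 'a set) set ring" where
  "residue_field R P =
     localization (R Quot P) (carrier (R Quot P) - {\<zero>\<^bsub>R Quot P\<^esub>})"

definition residue_map :: "('a, 'm) ring_scheme \<Rightarrow> 'a set \<Rightarrow> 'a \<Rightarrow> ('a set \<times> 'a set) set" where
  "residue_map R P a =
     fraction (R Quot P) (carrier (R Quot P) - {\<zero>\<^bsub>R Quot P\<^esub>}) (P +>\<^bsub>R\<^esub> a) \<one>\<^bsub>R Quot P\<^esub>"

definition prime_chain :: "('a, 'm) ring_scheme \<Rightarrow> (nat \<Rightarrow> 'a set) \<Rightarrow> nat \<Rightarrow> bool" where
  "prime_chain R c n \<longleftrightarrow>
     (\<forall>i\<le>n. primeideal (c i) R) \<and> (\<forall>i<n. c i \<subset> c (Suc i))"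

text \<open>The zero ring gets dimension 0 here; only local rings, which are nonzero, matter below.\<close>

definition krull_dim :: "('a, 'm) ring_scheme \<Rightarrow> enat" where
  "krull_dim R = Sup {enat n | n. \<exists>c. prime_chain R c n}"

definition local_cring :: "('a, 'm) ring_scheme \<Rightarrow> bool" where
  "local_cring R \<longleftrightarrow> cring R \<and> (\<exists>!M. maximalideal M R)"

definition max_ideal :: "('a, 'm) ring_scheme \<Rightarrow> 'a set" where
  "max_ideal R = (THE M. maximalideal M R)"

text \<open>
  Asking for exactly \<open>dim R\<close> distinct generators loses nothing: by Krull's height theorem fewer
  than \<open>dim R\<close> elements never generate the maximal ideal.
\<close>

definition regular_local_ring :: "('a, 'm) ring_scheme \<Rightarrow> bool" where
  "regular_local_ring R \<longleftrightarrow>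
     local_cring R \<and> noetherian_ring R \<and>
     (\<exists>A. A \<subseteq> carrier R \<and> finite A \<and> enat (card A) = krull_dim R \<and> Idl\<^bsub>R\<^esub> A = max_ideal R)"

definition regular_ring :: "('a, 'm) ring_scheme \<Rightarrow> bool" where
  "regular_ring R \<longleftrightarrow>
     cring R \<and> noetherian_ring R \<and>
     (\<forall>P. primeideal P R \<longrightarrow> regular_local_ring (localization_at R P))"

definition finite_type_hom ::
    "('a, 'm) ring_scheme \<Rightarrow> ('b, 'n) ring_scheme \<Rightarrow> ('a \<Rightarrow> 'b) \<Rightarrow> bool" where
  "finite_type_hom R B \<phi> \<longleftrightarrow>
     cring B \<and> \<phi> \<in> ring_hom R B \<and>
     (\<exists>A. A \<subseteq> carrier B \<and> finite A \<and> generate_ring B (\<phi> ` carrier R \<union> A) = carrier B)"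

text \<open>
  The conditions below quantify over all algebras of finite type over a ring on \<^typ>\<open>'a\<close>.
  A bound variable ranges over one type only, so the algebras are taken on
  \<^typ>\<open>(nat multiset \<Rightarrow> 'a) set\<close>: polynomials in finitely many variables are coefficient
  functions on monomials (multisets of variables), hence every algebra of finite type, being
  isomorphic to a quotient of such a polynomial ring, has an isomorphic copy on this type.
\<close>

definition regular_locus :: "('a, 'm) ring_scheme \<Rightarrow> 'a set set" where
  "regular_locus R = {P. primeideal P R \<and> regular_local_ring (localization_at R P)}"

definition zariski_open :: "('a, 'm) ring_scheme \<Rightarrow> 'a set set \<Rightarrow> bool" where
  "zariski_open R U \<longleftrightarrow> (\<exists>E. E \<subseteq> carrier R \<and> U = {P. primeideal P R \<and> \<not> E \<subseteq> P})"

definition J2_ring :: "('a, 'm) ring_scheme \<Rightarrow> bool" where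
  "J2_ring R \<longleftrightarrow>
     (\<forall>(B :: (nat multiset \<Rightarrow> 'a) set ring) \<phi>.
        finite_type_hom R B \<phi> \<longrightarrow> zariski_open B (regular_locus B))"

definition prime_chain_between ::
    "('a, 'm) ring_scheme \<Rightarrow> 'a set \<Rightarrow> 'a set \<Rightarrow> (nat \<Rightarrow> 'a set) \<Rightarrow> nat \<Rightarrow> bool" where
  "prime_chain_between R P Q c n \<longleftrightarrow> prime_chain R c n \<and> c 0 = P \<and> c n = Q"

definition maximal_prime_chain_between ::
    "('a, 'm) ring_scheme \<Rightarrow> 'a set \<Rightarrow> 'a set \<Rightarrow> (nat \<Rightarrow> 'a set) \<Rightarrow> nat \<Rightarrow> bool" where
  "maximal_prime_chain_between R P Q c n \<longleftrightarrow>
     prime_chain_between R P Q c n \<and>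
     (\<forall>i<n. \<nexists>P'. primeideal P' R \<and> c i \<subset> P' \<and> P' \<subset> c (Suc i))"

definition catenary :: "('a, 'm) ring_scheme \<Rightarrow> bool" where
  "catenary R \<longleftrightarrow>
     (\<forall>P Q. primeideal P R \<and> primeideal Q R \<and> P \<subseteq> Q \<longrightarrow>
        (\<exists>N. \<forall>c n. prime_chain_between R P Q c n \<longrightarrow> n \<le> N) \<and>
        (\<forall>c n c' n'. maximal_prime_chain_between R P Q c n \<and>
           maximal_prime_chain_between R P Q c' n' \<longrightarrow> n = n'))"

definition universally_catenary :: "('a, 'm) ring_scheme \<Rightarrow> bool" where
  "universally_catenary R \<longleftrightarrow>
     cring R \<and> noetherian_ring R \<and>
     (\<forall>(B :: (nat multiset \<Rightarrow> 'a) set ring) \<phi>. finite_type_hom R B \<phi> \<longrightarrow> catenary B)"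

definition int_monoid_ring :: "('a, 'm) monoid_scheme \<Rightarrow> ('a \<Rightarrow>\<^sub>0 int) ring" where
  "int_monoid_ring G =
     \<lparr>carrier = {x. Poly_Mapping.keys x \<subseteq> carrier G},
      monoid.mult = (\<lambda>x y. frag_extend (\<lambda>g. frag_extend (\<lambda>h. frag_of (g \<otimes>\<^bsub>G\<^esub> h)) y) x),
      one = frag_of \<one>\<^bsub>G\<^esub>,
      ring.zero = 0,
      add = (+)\<rparr>"

text \<open>
  For ring homomorphisms \<open>\<phi> : R \<rightarrow> A\<close> and \<open>\<psi> : R \<rightarrow> B\<close>, the tensor product of \<open>A\<close> and
  \<open>B\<close> over \<open>R\<close> is the free abelian group on \<open>A \<times> B\<close>, with multiplication
  \<open>(a, b) (a', b') = (a a', b b')\<close>, modulo the usual relations. These span a subgroup that is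
  stable under multiplication by the basis elements, so the ideal they generate adds nothing.
\<close>

definition tensor_relations ::
    "('r, 'l) ring_scheme \<Rightarrow> ('r \<Rightarrow> 'a) \<Rightarrow> ('a, 'm) ring_scheme \<Rightarrow> ('r \<Rightarrow> 'b) \<Rightarrow> ('b, 'n) ring_scheme
      \<Rightarrow> ('a \<times> 'b \<Rightarrow>\<^sub>0 int) set" where
  "tensor_relations R \<phi> A \<psi> B =
     {frag_of (a \<oplus>\<^bsub>A\<^esub> a', b) - frag_of (a, b) - frag_of (a', b) | a a' b.
        a \<in> carrier A \<and> a' \<in> carrier A \<and> b \<in> carrier B} \<union>
     {frag_of (a, b \<oplus>\<^bsub>B\<^esub> b') - frag_of (a, b) - frag_of (a, b') | a b b'.
        a \<in> carrier A \<and> b \<in> carrier B \<and> b' \<in> carrier B} \<union>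
     {frag_of (\<phi> r \<otimes>\<^bsub>A\<^esub> a, b) - frag_of (a, \<psi> r \<otimes>\<^bsub>B\<^esub> b) | r a b.
        r \<in> carrier R \<and> a \<in> carrier A \<and> b \<in> carrier B}"

definition tensor_ideal ::
    "('r, 'l) ring_scheme \<Rightarrow> ('r \<Rightarrow> 'a) \<Rightarrow> ('a, 'm) ring_scheme \<Rightarrow> ('r \<Rightarrow> 'b) \<Rightarrow> ('b, 'n) ring_scheme
      \<Rightarrow> ('a \<times> 'b \<Rightarrow>\<^sub>0 int) set" where
  "tensor_ideal R \<phi> A \<psi> B = Idl\<^bsub>int_monoid_ring (A \<times>\<times> B)\<^esub> (tensor_relations R \<phi> A \<psi> B)"

definition tensor_product ::
    "('r, 'l) ring_scheme \<Rightarrow> ('r \<Rightarrow> 'a) \<Rightarrow> ('a, 'm) ring_scheme \<Rightarrow> ('r \<Rightarrow> 'b) \<Rightarrow> ('b, 'n) ring_scheme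
      \<Rightarrow> ('a \<times> 'b \<Rightarrow>\<^sub>0 int) set ring" where
  "tensor_product R \<phi> A \<psi> B = int_monoid_ring (A \<times>\<times> B) Quot tensor_ideal R \<phi> A \<psi> B"

definition tensor_left ::
    "('r, 'l) ring_scheme \<Rightarrow> ('r \<Rightarrow> 'a) \<Rightarrow> ('a, 'm) ring_scheme \<Rightarrow> ('r \<Rightarrow> 'b) \<Rightarrow> ('b, 'n) ring_scheme
      \<Rightarrow> 'a \<Rightarrow> ('a \<times> 'b \<Rightarrow>\<^sub>0 int) set" where
  "tensor_left R \<phi> A \<psi> B a =
     tensor_ideal R \<phi> A \<psi> B +>\<^bsub>int_monoid_ring (A \<times>\<times> B)\<^esub> frag_of (a, \<one>\<^bsub>B\<^esub>)"

text \<open>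
  Inverse limit of the quotients \<open>R / I\<^sup>n\<close>. For cosets, \<open>f (Suc n) \<subseteq> f n\<close> says that the
  canonical projection sends \<open>f (Suc n)\<close> to \<open>f n\<close>.
\<close>

definition completion :: "('a, 'm) ring_scheme \<Rightarrow> 'a set \<Rightarrow> (nat \<Rightarrow> 'a set) ring" where
  "completion R I =
     (let Q = (\<lambda>n::nat. R Quot (I [^]\<^bsub>ideals_set R\<^esub> n)) in
      \<lparr>carrier = {f. \<forall>n. f n \<in> carrier (Q n) \<and> f (Suc n) \<subseteq> f n},
       monoid.mult = (\<lambda>f g n. f n \<otimes>\<^bsub>Q n\<^esub> g n),
       one = (\<lambda>n. \<one>\<^bsub>Q n\<^esub>),
       ring.zero = (\<lambda>n. \<zero>\<^bsub>Q n\<^esub>),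
       add = (\<lambda>f g n. f n \<oplus>\<^bsub>Q n\<^esub> g n)\<rparr>)"

definition completion_map :: "('a, 'm) ring_scheme \<Rightarrow> 'a set \<Rightarrow> 'a \<Rightarrow> nat \<Rightarrow> 'a set" where
  "completion_map R I a n = (I [^]\<^bsub>ideals_set R\<^esub> n) +>\<^bsub>R\<^esub> a"

definition finite_field_extension ::
    "('k, 'm) ring_scheme \<Rightarrow> ('l, 'n) ring_scheme \<Rightarrow> ('k \<Rightarrow> 'l) \<Rightarrow> bool" where
  "finite_field_extension K L \<phi> \<longleftrightarrow>
     field L \<and> \<phi> \<in> ring_hom K L \<and> ring.finite_dimension L (\<phi> ` carrier K) (carrier L)"

text \<open>
  Finite field extensions are algebras of finite type, so the type used above for those also
  holds an isomorphic copy of every finite extension of \<open>K\<close>.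
\<close>

definition geometrically_regular ::
    "('k, 'm) ring_scheme \<Rightarrow> ('a, 'n) ring_scheme \<Rightarrow> ('k \<Rightarrow> 'a) \<Rightarrow> bool" where
  "geometrically_regular K F \<eta> \<longleftrightarrow>
     (\<forall>(L :: (nat multiset \<Rightarrow> 'k) set ring) \<phi>.
        finite_field_extension K L \<phi> \<longrightarrow> regular_ring (tensor_product K \<eta> F \<phi> L))"

text \<open>
  For a Noetherian local ring \<open>A\<close> with completion \<open>C\<close>, the formal fibre over a prime \<open>q\<close> is the
  tensor product over \<open>A\<close> of the residue field at \<open>q\<close> with \<open>C\<close>. The homomorphism \<open>A \<rightarrow> C\<close> is
  always flat, so geometric regularity of these fibres says that it is regular.
\<close>

definition geometrically_regular_formal_fibres :: "('a, 'm) ring_scheme \<Rightarrow> bool" where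
  "geometrically_regular_formal_fibres A \<longleftrightarrow>
     (let C = completion A (max_ideal A); \<gamma> = completion_map A (max_ideal A) in
      \<forall>q. primeideal q A \<longrightarrow>
        (let K = residue_field A q; \<kappa> = residue_map A q in
         geometrically_regular K (tensor_product A \<kappa> K \<gamma> C) (tensor_left A \<kappa> K \<gamma> C)))"

definition G_ring :: "('a, 'm) ring_scheme \<Rightarrow> bool" where
  "G_ring R \<longleftrightarrow>
     cring R \<and> noetherian_ring R \<and>
     (\<forall>P. primeideal P R \<longrightarrow> geometrically_regular_formal_fibres (localization_at R P))"

definition excellent_ring :: "('a, 'm) ring_scheme \<Rightarrow> bool" where
  "excellent_ring R \<longleftrightarrow>
     cring R \<and> noetherian_ring R \<and> universally_catenary R \<and> G_ring R \<and> J2_ring R"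

end

theory Submission
  imports Defs
begin

text \<open>
  Locally at a prime \<open>Q\<close> of a regular ring, \<open>Q\<close> is generated by a regular sequence \<open>Y\<close>. Hence the
  product of the \<open>y\<^sup>N\<^sup>-\<^sup>1\<close> is not in the ideal of the \<open>y\<^sup>N\<close>, while it generates the socle modulo that
  ideal. Annihilator duality modulo the \<open>y\<^sup>N\<close> turns this into flatness of Frobenius:
  \<open>(I : a)\<^sup>[\<^sup>p\<^sup>] = I\<^sup>[\<^sup>p\<^sup>] : a\<^sup>p\<close>.

  Let \<open>J = \<Inter>\<^sub>i J\<^sub>i\<close> and \<open>x \<in> \<Inter>\<^sub>i J\<^sub>i\<^sup>[\<^sup>p\<^sup>]\<close>. By flatness, \<open>x \<in> J\<^sup>[\<^sup>p\<^sup>]\<close> can be tested at the primes of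
  the form \<open>P = J : b\<close>, and \<open>J\<close> being radical agrees with \<open>P\<close> locally at \<open>P\<close>. If \<open>x\<close> is not in
  \<open>P\<^sup>[\<^sup>p\<^sup>]\<close> locally at \<open>P\<close> and \<open>Y\<close> is a regular sequence for \<open>P\<close>, then some multiple of \<open>x\<close> equals
  \<open>c m\<close> modulo \<open>P\<^sup>[\<^sup>p\<^sup>]\<close>, where \<open>c \<notin> P\<close> and \<open>m\<close> is the product of the \<open>y\<^sup>p\<^sup>-\<^sup>1\<close>. As the \<open>J\<^sub>i\<close> are
  radical with intersection \<open>J\<close>, some prime \<open>Q \<supseteq> P\<close> contains some \<open>J\<^sub>i\<close> but not a prescribed element
  outside \<open>P\<close>; by J-2 that element can be chosen so that \<open>S / P\<close> is regular at \<open>Q\<close>. Then \<open>Y\<close> extends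
  to a regular sequence for \<open>Q\<close>, so \<open>m\<close> is not in \<open>Q\<^sup>[\<^sup>p\<^sup>]\<close> locally at \<open>Q\<close>, although \<open>x\<close> is.
\<close>

section \<open>Ideals of Noetherian rings\<close>

text \<open>Localizations as rings occur only where regularity of local rings is translated.
  Everywhere else an ideal of the local ring at Q is replaced by its contraction
  \<open>sat Q K\<close>, modules by pairs of nested ideals, and length by the number of simple
  steps between them. Krull's height theorem, the primality of ideals generated by part of a regular
  system, and flatness (as a colon formula) are all obtained in these terms. The obstacle is that
  duality at Q only gives membership in Q^[p] up to a denominator outside Q. Removing the
  denominator means that Q^[p] is Q-primary, and this is deduced from flatness at the strictly
  larger primes; so the flatness proof is a Noetherian induction from large primes to small ones.
  The exponent N stays free because a given J need not contain any power of the y: adding the y^N to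
  J makes the quotient at Q Artinian, and N must be large enough that a prescribed element stays
  outside. Flatness alone handles finite intersections only. For an infinite family it serves to
  reduce to one prime P; the contradiction then comes from a single J_i, chosen after all
  denominators are known.\<close>

lemma prime_chain_mono: "prime_chain R c n \<Longrightarrow> m \<le> n \<Longrightarrow> prime_chain R c m"
  unfolding prime_chain_def by auto

lemma prime_chain_subset: "prime_chain R c n \<Longrightarrow> m \<le> n \<Longrightarrow> c m \<subseteq> c n"
proof (induction n)
  case (Suc n)
  have "c n \<subset> c (Suc n)" using Suc.prems unfolding prime_chain_def by auto
  then show ?case using Suc prime_chain_mono[of R c "Suc n" n] by (cases "m = Suc n") auto
qed simp

locale noetherian_cring = cring + noetherian_ring

context noetherian_cring
begin

definition adjoin :: "'a set \<Rightarrow> 'a \<Rightarrow> 'a set" where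
  "adjoin K u = {k \<oplus> r \<otimes> u | k r. k \<in> K \<and> r \<in> carrier R}"

definition colon :: "'a set \<Rightarrow> 'a \<Rightarrow> 'a set" where
  "colon K a = {x \<in> carrier R. a \<otimes> x \<in> K}"

text \<open>The contraction to \<open>R\<close> of the extension of \<open>K\<close> to the local ring at \<open>Q\<close>; it replaces that local ring throughout.\<close>

definition sat :: "'a set \<Rightarrow> 'a set \<Rightarrow> 'a set" where
  "sat Q K = {x \<in> carrier R. \<exists>t \<in> carrier R - Q. t \<otimes> x \<in> K}"

section \<open>Elementary arithmetic of ideals, colons and contractions from local rings\<close>

lemma ideal_intro:
  assumes "K \<subseteq> carrier R" "\<zero> \<in> K"
    and "\<And>a b. a \<in> K \<Longrightarrow> b \<in> K \<Longrightarrow> a \<oplus> b \<in> K"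
    and "\<And>a x. a \<in> K \<Longrightarrow> x \<in> carrier R \<Longrightarrow> x \<otimes> a \<in> K"
  shows "ideal K R"
proof (rule idealI)
  have inv: "\<ominus> a \<in> K" if "a \<in> K" for a
  proof -
    have "(\<ominus> \<one>) \<otimes> a \<in> K" using assms(4)[OF that] by simp
    moreover have "a \<in> carrier R" using that assms(1) by blast
    ultimately show ?thesis by (simp add: l_minus)
  qed
  show "subgroup K (add_monoid R)"
    by (rule add.subgroupI) (use assms inv in \<open>auto simp: a_inv_def[symmetric]\<close>)
  show "\<And>a x. a \<in> K \<Longrightarrow> x \<in> carrier R \<Longrightarrow> a \<otimes> x \<in> K"
    by (metis assms(1,4) m_comm subsetD)
qed (use assms ring_axioms in auto)

lemma ideal_carrier: "ideal K R \<Longrightarrow> x \<in> K \<Longrightarrow> x \<in> carrier R"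
  by (rule ideal.Icarr)

lemma ideal_subset: "ideal K R \<Longrightarrow> K \<subseteq> carrier R"
  using ideal_carrier by blast

lemma ideal_zero: "ideal K R \<Longrightarrow> \<zero> \<in> K"
  by (rule additive_subgroup.zero_closed[OF ideal.axioms(1)])

lemma ideal_add: "ideal K R \<Longrightarrow> a \<in> K \<Longrightarrow> b \<in> K \<Longrightarrow> a \<oplus> b \<in> K"
  by (rule additive_subgroup.a_closed[OF ideal.axioms(1)])

lemma ideal_mult: "ideal K R \<Longrightarrow> a \<in> K \<Longrightarrow> x \<in> carrier R \<Longrightarrow> x \<otimes> a \<in> K"
  by (rule ideal.I_l_closed)

lemma ideal_mult': "ideal K R \<Longrightarrow> a \<in> K \<Longrightarrow> x \<in> carrier R \<Longrightarrow> a \<otimes> x \<in> K"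
  by (rule ideal.I_r_closed)

lemma ideal_diff: "ideal K R \<Longrightarrow> a \<in> K \<Longrightarrow> b \<in> K \<Longrightarrow> a \<ominus> b \<in> K"
  by (metis additive_subgroup.a_closed additive_subgroup.a_inv_closed ideal.axioms(1) minus_eq)

lemma ideal_diff_cancel:
  "ideal K R \<Longrightarrow> a \<ominus> b \<in> K \<Longrightarrow> b \<in> K \<Longrightarrow> a \<in> carrier R \<Longrightarrow> a \<in> K"
proof -
  assume a: "ideal K R" "a \<ominus> b \<in> K" "b \<in> K" "a \<in> carrier R"
  have "b \<in> carrier R" using a ideal_carrier by blast
  then have "a = (a \<ominus> b) \<oplus> b" using a(4) by algebra
  then show ?thesis using ideal_add[OF a(1-3)] by simp
qed

lemma ideal_diff_cancel2:
  "ideal K R \<Longrightarrow> a \<ominus> b \<in> K \<Longrightarrow> a \<in> K \<Longrightarrow> b \<in> carrier R \<Longrightarrow> b \<in> K"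
proof -
  assume a: "ideal K R" "a \<ominus> b \<in> K" "a \<in> K" "b \<in> carrier R"
  have "a \<in> carrier R" using a ideal_carrier by blast
  then have "b = a \<ominus> (a \<ominus> b)" using a(4) by algebra
  then show ?thesis using ideal_diff[OF a(1) a(3) a(2)] by simp
qed

lemma ideal_add_cancel:
  "ideal K R \<Longrightarrow> a \<oplus> b \<in> K \<Longrightarrow> b \<in> K \<Longrightarrow> a \<in> carrier R \<Longrightarrow> a \<in> K"
proof -
  assume a: "ideal K R" "a \<oplus> b \<in> K" "b \<in> K" "a \<in> carrier R"
  have "b \<in> carrier R" using a ideal_carrier by blast
  then have "a = (a \<oplus> b) \<ominus> b" using a(4) by algebra
  then show ?thesis using ideal_diff[OF a(1-3)] by simp
qed

lemma proper_iff: "ideal K R \<Longrightarrow> K \<noteq> carrier R \<longleftrightarrow> \<one> \<notin> K"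
  using ideal.one_imp_carrier one_closed by blast

lemma prime_ideal: "primeideal P R \<Longrightarrow> ideal P R"
  by (rule primeideal.axioms)

lemma prime_one: "primeideal P R \<Longrightarrow> \<one> \<notin> P"
  using primeideal.I_notcarr ideal.one_imp_carrier prime_ideal by metis

lemma prime_mult_iff:
  "primeideal P R \<Longrightarrow> a \<in> carrier R \<Longrightarrow> b \<in> carrier R \<Longrightarrow> a \<otimes> b \<in> P \<longleftrightarrow> a \<in> P \<or> b \<in> P"
  using primeideal.I_prime ideal_mult ideal_mult' prime_ideal by metis

lemma prime_notin_mult:
  "primeideal P R \<Longrightarrow> a \<in> carrier R - P \<Longrightarrow> b \<in> carrier R - P \<Longrightarrow> a \<otimes> b \<in> carrier R - P"
  using prime_mult_iff by auto

lemma prime_pow: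
  assumes "primeideal P R" "a \<in> carrier R" "a [^] (n::nat) \<in> P"
  shows "a \<in> P"
  using assms(3)
proof (induction n)
  case 0 then show ?case using prime_one[OF assms(1)] by simp
next
  case (Suc n) then show ?case using prime_mult_iff[OF assms(1)] assms(2) by auto
qed

lemma ideal_pow: "ideal K R \<Longrightarrow> a \<in> K \<Longrightarrow> n > 0 \<Longrightarrow> a [^] (n::nat) \<in> K"
  by (cases n) (auto simp: ideal_mult ideal_carrier)

lemma ideal_colon: "ideal K R \<Longrightarrow> a \<in> carrier R \<Longrightarrow> ideal (colon K a) R"
  unfolding colon_def by (rule ideal.helper_max_prime[OF _ is_cring])

lemma colonI: "x \<in> carrier R \<Longrightarrow> a \<otimes> x \<in> K \<Longrightarrow> x \<in> colon K a"
  by (simp add: colon_def)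

lemma colonD: "x \<in> colon K a \<Longrightarrow> a \<otimes> x \<in> K" "x \<in> colon K a \<Longrightarrow> x \<in> carrier R"
  by (simp_all add: colon_def)

lemma subset_colon: "ideal K R \<Longrightarrow> a \<in> carrier R \<Longrightarrow> K \<subseteq> colon K a"
  by (auto simp: colon_def ideal_mult ideal_carrier)

lemma adjoinI: "k \<in> K \<Longrightarrow> r \<in> carrier R \<Longrightarrow> k \<oplus> r \<otimes> u \<in> adjoin K u"
  unfolding adjoin_def by blast

lemma adjoinE:
  assumes "x \<in> adjoin K u"
  obtains k r where "k \<in> K" "r \<in> carrier R" "x = k \<oplus> r \<otimes> u"
  using assms unfolding adjoin_def by blast

lemma ideal_adjoin:
  assumes K: "ideal K R" and u: "u \<in> carrier R"
  shows "ideal (adjoin K u) R"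
proof (rule ideal_intro)
  note Kc = ideal_carrier[OF K]
  show "adjoin K u \<subseteq> carrier R" using Kc u by (auto elim!: adjoinE)
  show "\<zero> \<in> adjoin K u" using adjoinI[OF ideal_zero[OF K] zero_closed, of u] u by simp
  fix a b assume "a \<in> adjoin K u" 
  then obtain k r where a: "k \<in> K" "r \<in> carrier R" "a = k \<oplus> r \<otimes> u" by (rule adjoinE)
  { assume "b \<in> adjoin K u" 
    then obtain l s where b: "l \<in> K" "s \<in> carrier R" "b = l \<oplus> s \<otimes> u" by (rule adjoinE)
    have "a \<oplus> b = (k \<oplus> l) \<oplus> (r \<oplus> s) \<otimes> u"
      using a b Kc[OF a(1)] Kc[OF b(1)] u by algebra
    then show "a \<oplus> b \<in> adjoin K u"
      using adjoinI[OF ideal_add[OF K a(1) b(1)] a_closed[OF a(2) b(2)], of u] by simp }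
  { assume b: "b \<in> carrier R" 
    have "b \<otimes> a = b \<otimes> k \<oplus> (b \<otimes> r) \<otimes> u"
      using a b Kc[OF a(1)] u by algebra
    then show "b \<otimes> a \<in> adjoin K u"
      using adjoinI[OF ideal_mult[OF K a(1) b] m_closed[OF b a(2)], of u] by simp }
qed

lemma subset_adjoin: "K \<subseteq> carrier R \<Longrightarrow> u \<in> carrier R \<Longrightarrow> K \<subseteq> adjoin K u"
proof
  fix x assume "K \<subseteq> carrier R" "u \<in> carrier R" "x \<in> K"
  moreover from this have "x \<in> carrier R" by blast
  ultimately show "x \<in> adjoin K u" using adjoinI[of x K \<zero> u] by simp
qed

lemma mem_adjoin: "ideal K R \<Longrightarrow> u \<in> carrier R \<Longrightarrow> u \<in> adjoin K u"
  using adjoinI[OF ideal_zero[of K] one_closed, of u] by auto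

lemma adjoin_least: "ideal L R \<Longrightarrow> K \<subseteq> L \<Longrightarrow> u \<in> L \<Longrightarrow> adjoin K u \<subseteq> L"
  by (auto elim!: adjoinE) (meson ideal_add ideal_mult subset_eq)

lemma adjoin_mono: "K \<subseteq> L \<Longrightarrow> adjoin K u \<subseteq> adjoin L u"
  by (auto elim!: adjoinE intro!: adjoinI)

lemma Idl_insert:
  assumes "u \<in> carrier R" "E \<subseteq> carrier R"
  shows "Idl (insert u E) = adjoin (Idl E) u"
proof
  have i: "ideal (Idl E) R" using genideal_ideal assms by blast
  show "Idl (insert u E) \<subseteq> adjoin (Idl E) u"
    using genideal_self[OF assms(2)] subset_adjoin[OF ideal_subset[OF i] assms(1)]
    by (intro genideal_minimal ideal_adjoin i assms) (auto intro: mem_adjoin i assms)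
  show "adjoin (Idl E) u \<subseteq> Idl (insert u E)"
    using genideal_self[of "insert u E"] assms
    by (intro adjoin_least genideal_ideal subset_Idl_subset) auto
qed

lemma Idl_eq: "ideal K R \<Longrightarrow> Idl K = K"
  by (meson genideal_minimal genideal_self ideal_subset order_refl subset_antisym)

lemma ideal_sat:
  assumes Q: "primeideal Q R" and K: "ideal K R"
  shows "ideal (sat Q K) R"
proof (rule ideal_intro)
  show "sat Q K \<subseteq> carrier R" by (auto simp: sat_def)
  show "\<zero> \<in> sat Q K" using prime_one[OF Q] ideal_zero[OF K] by (auto simp: sat_def intro!: bexI[of _ \<one>])
  fix a b assume "a \<in> sat Q K"
  then obtain t where a: "a \<in> carrier R" "t \<in> carrier R" "t \<notin> Q" "t \<otimes> a \<in> K" by (auto simp: sat_def)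
  { assume "b \<in> sat Q K"
    then obtain s where b: "b \<in> carrier R" "s \<in> carrier R" "s \<notin> Q" "s \<otimes> b \<in> K" by (auto simp: sat_def)
    have "(t \<otimes> s) \<otimes> (a \<oplus> b) = s \<otimes> (t \<otimes> a) \<oplus> t \<otimes> (s \<otimes> b)" using a(1,2) b(1,2) by algebra
    then have "(t \<otimes> s) \<otimes> (a \<oplus> b) \<in> K" using a b by (simp add: ideal_add ideal_mult K)
    moreover have "t \<otimes> s \<notin> Q" using prime_mult_iff[OF Q] a b by blast
    ultimately show "a \<oplus> b \<in> sat Q K" unfolding sat_def using a b by auto }
  { assume b: "b \<in> carrier R"
    have "t \<otimes> (b \<otimes> a) = b \<otimes> (t \<otimes> a)" using a(1,2) b by algebra
    then have "t \<otimes> (b \<otimes> a) \<in> K" using a b by (simp add: ideal_mult K)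
    then show "b \<otimes> a \<in> sat Q K" unfolding sat_def using a b by auto }
qed

lemma satI: "t \<in> carrier R \<Longrightarrow> t \<notin> Q \<Longrightarrow> t \<otimes> x \<in> K \<Longrightarrow> x \<in> carrier R \<Longrightarrow> x \<in> sat Q K"
  by (auto simp: sat_def)

lemma satE:
  assumes "x \<in> sat Q K"
  obtains t where "t \<in> carrier R" "t \<notin> Q" "t \<otimes> x \<in> K" "x \<in> carrier R"
  using assms by (auto simp: sat_def)

lemma sat_adjoinE:
  assumes "x \<in> sat Q (adjoin K u)"
  obtains t k c where "t \<in> carrier R" "t \<notin> Q" "k \<in> K" "c \<in> carrier R" "t \<otimes> x = k \<oplus> c \<otimes> u"
  using assms by (auto elim!: satE adjoinE)

lemma sat_carrier: "sat Q K \<subseteq> carrier R" by (auto simp: sat_def)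

lemma sat_mono: "K \<subseteq> L \<Longrightarrow> sat Q K \<subseteq> sat Q L" by (auto simp: sat_def)

lemma subset_sat: "primeideal Q R \<Longrightarrow> K \<subseteq> carrier R \<Longrightarrow> K \<subseteq> sat Q K"
proof
  fix x assume "primeideal Q R" "K \<subseteq> carrier R" "x \<in> K"
  moreover from this have "x \<in> carrier R" by blast
  ultimately show "x \<in> sat Q K" using prime_one satI[of \<one> Q x K] by simp
qed

lemma sat_sat: "primeideal Q R \<Longrightarrow> sat Q (sat Q K) = sat Q K"
proof
  assume Q: "primeideal Q R"
  show "sat Q (sat Q K) \<subseteq> sat Q K"
  proof
    fix x assume "x \<in> sat Q (sat Q K)"
    then obtain t s where x: "t \<in> carrier R - Q" "s \<in> carrier R - Q" "s \<otimes> (t \<otimes> x) \<in> K" "x \<in> carrier R"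
      by (auto elim!: satE)
    have "(s \<otimes> t) \<otimes> x \<in> K" using x m_assoc[of s t x] by auto
    then show "x \<in> sat Q K" using prime_notin_mult[OF Q x(2,1)] x by (auto intro: satI)
  qed
qed (intro subset_sat sat_carrier)

lemma sat_least: "primeideal Q R \<Longrightarrow> K \<subseteq> sat Q L \<Longrightarrow> sat Q K \<subseteq> sat Q L"
  using sat_mono[of K "sat Q L" Q] sat_sat by simp

lemma sat_cancel:
  "primeideal Q R \<Longrightarrow> t \<in> carrier R \<Longrightarrow> t \<notin> Q \<Longrightarrow> x \<in> carrier R \<Longrightarrow> t \<otimes> x \<in> sat Q K \<Longrightarrow> x \<in> sat Q K"
  using sat_sat[of Q K] satI[of t Q x "sat Q K"] by auto

lemma sat_prime: "primeideal Q R \<Longrightarrow> primeideal P R \<Longrightarrow> P \<subseteq> Q \<Longrightarrow> sat Q P = P"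
proof
  assume a: "primeideal Q R" "primeideal P R" "P \<subseteq> Q"
  show "sat Q P \<subseteq> P" using a(2,3) prime_mult_iff by (auto elim!: satE)
  show "P \<subseteq> sat Q P" using a by (intro subset_sat ideal_subset prime_ideal)
qed

section \<open>The ascending chain condition and associated primes\<close>

lemma exists_maximal:
  assumes "F \<noteq> {}" "\<And>K. K \<in> F \<Longrightarrow> ideal K R"
  shows "\<exists>M\<in>F. \<forall>K\<in>F. M \<subseteq> K \<longrightarrow> K = M"
proof (rule subset_Zorn_nonempty[OF assms(1)])
  fix C assume C: "C \<noteq> {}" "subset.chain F C"
  then have "subset.chain {I. ideal I R} C" using assms(2) by (auto simp: pred_on.chain_def)
  then have "\<Union>C \<in> C" by (rule ideal_chain_is_trivial[OF C(1)])
  then show "\<Union>C \<in> F" using C(2) by (auto simp: pred_on.chain_def)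
qed

lemma noetherian_induct:
  assumes "ideal K R" and step: "\<And>K. ideal K R \<Longrightarrow> (\<And>L. ideal L R \<Longrightarrow> K \<subset> L \<Longrightarrow> Pr L) \<Longrightarrow> Pr K"
  shows "Pr K"
proof (rule ccontr)
  assume "\<not> Pr K"
  let ?F = "{K. ideal K R \<and> \<not> Pr K}"
  have "K \<in> ?F" using assms(1) \<open>\<not> Pr K\<close> by simp
  then have "?F \<noteq> {}" by blast
  then have "\<exists>M\<in>?F. \<forall>K\<in>?F. M \<subseteq> K \<longrightarrow> K = M" by (rule exists_maximal) simp
  then obtain M where M: "M \<in> ?F" "\<forall>K\<in>?F. M \<subseteq> K \<longrightarrow> K = M" by (rule bexE)
  have "Pr M"
  proof (rule step)
    fix L assume "ideal L R" "M \<subset> L"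
    then show "Pr L" using M(2)[THEN bspec, of L] by (cases "Pr L") auto
  qed (use M in simp)
  then show False using M by simp
qed

lemma ideal_sequence_stationary:
  fixes L :: "nat \<Rightarrow> 'a set"
  assumes "\<And>n. ideal (L n) R" "\<And>n. L n \<subseteq> L (Suc n)"
  obtains n where "L (Suc n) = L n"
proof -
  have "\<exists>M\<in>range L. \<forall>K\<in>range L. M \<subseteq> K \<longrightarrow> K = M"
  proof (rule exists_maximal)
    fix K assume "K \<in> range L"
    then obtain n where "K = L n" by blast
    then show "ideal K R" by (simp only: assms(1))
  qed simp
  then obtain n where n: "\<forall>K\<in>range L. L n \<subseteq> K \<longrightarrow> K = L n" by blast
  then have "L (Suc n) = L n" using assms(2)[of n] by simp
  then show ?thesis by (rule that)
qed

text \<open>A maximal element among the proper annihilators, modulo \<open>K\<close>, of multiples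
  of \<open>a\<close> is prime: if y does not kill ra, then the annihilator of yra belongs to the
  same family and contains that of ra, so the two agree.\<close>

lemma exists_associated_prime:
  assumes K: "ideal K R" and a: "a \<in> carrier R" "a \<notin> K"
  obtains r where "r \<in> carrier R" "r \<otimes> a \<notin> K" "primeideal (colon K (r \<otimes> a)) R"
proof -
  let ?F = "{colon K (r \<otimes> a) | r. r \<in> carrier R \<and> r \<otimes> a \<notin> K}"
  have "\<one> \<otimes> a \<notin> K" using a by simp
  then have "?F \<noteq> {}" by blast
  moreover have "\<And>L. L \<in> ?F \<Longrightarrow> ideal L R" using K a ideal_colon by blast
  ultimately have "\<exists>M\<in>?F. \<forall>K\<in>?F. M \<subseteq> K \<longrightarrow> K = M" by (rule exists_maximal)
  then obtain M where M: "M \<in> ?F" "\<And>K. K \<in> ?F \<Longrightarrow> M \<subseteq> K \<Longrightarrow> K = M" by blast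
  then obtain r where r: "r \<in> carrier R" "r \<otimes> a \<notin> K" "M = colon K (r \<otimes> a)" by blast
  have "primeideal M R"
  proof (rule primeidealI)
    show "ideal M R" using r K a by (auto intro: ideal_colon)
    show "carrier R \<noteq> M"
    proof
      assume "carrier R = M"
      then have "\<one> \<in> colon K (r \<otimes> a)" using r by auto
      then show False using colonD r a by fastforce
    qed
    fix x y assume xy: "x \<in> carrier R" "y \<in> carrier R" "x \<otimes> y \<in> M"
    show "x \<in> M \<or> y \<in> M"
    proof (rule disjCI)
      assume y: "y \<notin> M"
      then have "r \<otimes> a \<otimes> y \<notin> K" using r xy by (auto simp: colon_def)
      moreover have e: "r \<otimes> a \<otimes> y = (y \<otimes> r) \<otimes> a" using r(1) a(1) xy by algebra
      ultimately have F: "colon K ((y \<otimes> r) \<otimes> a) \<in> ?F" using r xy by auto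
      have "M \<subseteq> colon K ((y \<otimes> r) \<otimes> a)"
      proof
        fix z assume z: "z \<in> M"
        then have zc: "z \<in> carrier R" "r \<otimes> a \<otimes> z \<in> K" using r colonD by auto
        have "((y \<otimes> r) \<otimes> a) \<otimes> z = y \<otimes> (r \<otimes> a \<otimes> z)" using r(1) a(1) xy zc(1) by algebra
        then show "z \<in> colon K ((y \<otimes> r) \<otimes> a)" using zc xy ideal_mult[OF K] by (auto intro: colonI)
      qed
      then have "colon K ((y \<otimes> r) \<otimes> a) = M" using M(2) F by blast
      moreover have "((y \<otimes> r) \<otimes> a) \<otimes> x = (r \<otimes> a) \<otimes> (x \<otimes> y)" using r(1) a(1) xy(1,2) by algebra
      then have "x \<in> colon K ((y \<otimes> r) \<otimes> a)" using xy r(3) by (auto intro!: colonI dest: colonD)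
      ultimately show "x \<in> M" by blast
    qed
  qed (rule is_cring)
  then show ?thesis using that r by blast
qed

end

section \<open>Dimension theory\<close>

context noetherian_cring
begin

text \<open>Krull's intersection theorem for a principal ideal, modulo \<open>B\<close> and locally
  at \<open>Q\<close>. The colons of \<open>adjoin B w\<close> by powers of x become stationary at
  some n. Writing t w with x^(n+1) and using stationarity to lower the power gives (t - c x) w in
  \<open>B\<close>; since x lies in \<open>Q\<close>, the factor t - c x does not.\<close>

lemma krull_principal:
  assumes Q: "primeideal Q R" and B: "ideal B R" and x: "x \<in> Q" and w: "w \<in> carrier R"
    and all: "\<And>k::nat. w \<in> sat Q (adjoin B (x [^] k))"
  shows "w \<in> sat Q B"
proof -
  have xc: "x \<in> carrier R" using x Q prime_ideal ideal_carrier by blast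
  define L where "L k = colon (adjoin B w) (x [^] (k::nat))" for k
  have iw: "ideal (adjoin B w) R" using B w by (rule ideal_adjoin)
  have "\<exists>n. L (Suc n) = L n"
  proof (rule ideal_sequence_stationary[of L])
    show "ideal (L n) R" for n unfolding L_def using iw xc by (intro ideal_colon) auto
    show "L n \<subseteq> L (Suc n)" for n
    proof
      fix r assume "r \<in> L n"
      then have r: "r \<in> carrier R" "x [^] n \<otimes> r \<in> adjoin B w" unfolding L_def using colonD by auto
      have pc: "x [^] n \<in> carrier R" using xc by simp
      have "(x [^] n \<otimes> x) \<otimes> r = x \<otimes> (x [^] n \<otimes> r)" using pc xc r(1) by algebra
      then have "x [^] Suc n \<otimes> r = x \<otimes> (x [^] n \<otimes> r)" by simp
      then show "r \<in> L (Suc n)" unfolding L_def using r xc by (intro colonI) (auto simp: ideal_mult[OF iw])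
    qed
  qed blast
  then obtain n where n: "L (Suc n) = L n" by blast
  obtain t b r where t: "t \<in> carrier R" "t \<notin> Q" and b: "b \<in> B" "r \<in> carrier R" "t \<otimes> w = b \<oplus> r \<otimes> x [^] Suc n"
    using all by (rule sat_adjoinE)
  have bc: "b \<in> carrier R" using b B ideal_carrier by blast
  have pc: "x [^] n \<in> carrier R" "x [^] Suc n \<in> carrier R" using xc by auto
  have "x [^] Suc n \<otimes> r = (b \<oplus> r \<otimes> x [^] Suc n) \<oplus> (\<ominus> b)" using pc(2) b(2) bc by algebra
  also have "\<dots> = t \<otimes> w \<oplus> (\<ominus> \<one>) \<otimes> b" using b bc by (simp add: l_minus)
  also have "\<dots> = (\<ominus> \<one>) \<otimes> b \<oplus> t \<otimes> w" using t(1) w bc by algebra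
  also have "\<dots> \<in> adjoin B w" using t(1) b(1) ideal_mult[OF B] by (intro adjoinI) auto
  finally have "r \<in> L (Suc n)" unfolding L_def using b by (auto intro: colonI)
  then have "x [^] n \<otimes> r \<in> adjoin B w" using n colonD unfolding L_def by blast
  then obtain b' c where b': "b' \<in> B" "c \<in> carrier R" "x [^] n \<otimes> r = b' \<oplus> c \<otimes> w" by (meson adjoinE)
  have bc': "b' \<in> carrier R" using b' B ideal_carrier by blast
  have "t \<otimes> w = b \<oplus> r \<otimes> (x [^] n \<otimes> x)" using b by simp
  also have "\<dots> = b \<oplus> x \<otimes> (x [^] n \<otimes> r)" using pc xc b(2) bc by algebra
  also have "\<dots> = b \<oplus> x \<otimes> (b' \<oplus> c \<otimes> w)" using b' by simp
  finally have e: "t \<otimes> w = b \<oplus> x \<otimes> (b' \<oplus> c \<otimes> w)" .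
  have "(t \<ominus> c \<otimes> x) \<otimes> w = t \<otimes> w \<ominus> (c \<otimes> x) \<otimes> w" using t(1) b'(2) xc w by algebra
  also have "\<dots> = b \<oplus> x \<otimes> b'" unfolding e using bc xc bc' b'(2) w by algebra
  also have "\<dots> \<in> B" using b b' xc ideal_add[OF B] ideal_mult[OF B] by blast
  finally have fin: "(t \<ominus> c \<otimes> x) \<otimes> w \<in> B" .
  have "t \<ominus> c \<otimes> x \<notin> Q"
    using ideal_diff_cancel[OF prime_ideal[OF Q] _ ideal_mult[OF prime_ideal[OF Q] x b'(2)] t(1)] t(2) by blast
  then show ?thesis using fin t(1) b'(2) xc w by (intro satI[of "t \<ominus> c \<otimes> x"]) auto
qed

text \<open>Substituting the hypothesis into itself k times writes each n, up to a factor outside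
  \<open>Q\<close>, as an element of \<open>B\<close> plus a multiple of x^k. So Krull's
  intersection theorem applies.\<close>

lemma nakayama_principal:
  assumes Q: "primeideal Q R" and B: "ideal B R" and N: "N \<subseteq> carrier R" and x: "x \<in> Q"
    and all: "\<And>n. n \<in> N \<Longrightarrow> \<exists>t b m. t \<in> carrier R \<and> t \<notin> Q \<and> b \<in> B \<and> m \<in> N \<and> t \<otimes> n = b \<oplus> m \<otimes> x"
  shows "N \<subseteq> sat Q B"
proof
  fix n assume nN: "n \<in> N"
  have xc: "x \<in> carrier R" using x Q prime_ideal ideal_carrier by blast
  have nc: "n \<in> carrier R" using nN N by blast
  have "\<exists>t b m. t \<in> carrier R \<and> t \<notin> Q \<and> b \<in> B \<and> m \<in> N \<and> t \<otimes> n = b \<oplus> m \<otimes> x [^] k" for k :: nat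
  proof (induction k)
    case 0
    have "\<one> \<otimes> n = \<zero> \<oplus> n \<otimes> x [^] (0::nat)" using nc by simp
    then show ?case using prime_one[OF Q] ideal_zero[OF B] nN by blast
  next
    case (Suc k)
    then obtain t b m where 1: "t \<in> carrier R" "t \<notin> Q" "b \<in> B" "m \<in> N" "t \<otimes> n = b \<oplus> m \<otimes> x [^] k" by blast
    obtain t' b' m' where 2: "t' \<in> carrier R" "t' \<notin> Q" "b' \<in> B" "m' \<in> N" "t' \<otimes> m = b' \<oplus> m' \<otimes> x"
      using all[OF 1(4)] by blast
    have c: "b \<in> carrier R" "b' \<in> carrier R" "m \<in> carrier R" "m' \<in> carrier R" "x [^] k \<in> carrier R"
      using 1 2 N ideal_carrier[OF B] xc by auto
    have "(t' \<otimes> t) \<otimes> n = t' \<otimes> (b \<oplus> m \<otimes> x [^] k)" using 1 2 nc by (simp add: m_assoc)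
    also have "\<dots> = t' \<otimes> b \<oplus> (t' \<otimes> m) \<otimes> x [^] k" using c 2(1) by algebra
    also have "\<dots> = t' \<otimes> b \<oplus> (b' \<oplus> m' \<otimes> x) \<otimes> x [^] k" using 2 by simp
    also have "\<dots> = (t' \<otimes> b \<oplus> x [^] k \<otimes> b') \<oplus> m' \<otimes> (x [^] k \<otimes> x)" using c 2(1) xc by algebra
    finally have e: "(t' \<otimes> t) \<otimes> n = (t' \<otimes> b \<oplus> x [^] k \<otimes> b') \<oplus> m' \<otimes> x [^] Suc k" by simp
    have "t' \<otimes> b \<oplus> x [^] k \<otimes> b' \<in> B" using 1 2 c ideal_add[OF B] ideal_mult[OF B] by blast
    moreover have "t' \<otimes> t \<in> carrier R \<and> t' \<otimes> t \<notin> Q" using prime_notin_mult[OF Q] 1 2 by auto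
    ultimately show ?case using e 2(4) by blast
  qed
  then have "n \<in> sat Q (adjoin B (x [^] (k::nat)))" for k
    by (metis N adjoinI nc satI subset_iff)
  then show "n \<in> sat Q B" by (rule krull_principal[OF Q B x nc])
qed

text \<open>These are the contractions of ideals of the local ring at \<open>Q\<close>, and they
  correspond to those ideals one to one.\<close>

definition closed_at :: "'a set \<Rightarrow> 'a set \<Rightarrow> bool" where
  "closed_at Q K \<longleftrightarrow> ideal K R \<and> sat Q K = K"

text \<open>Over the local ring at \<open>Q\<close>, the quotient of \<open>L\<close> by \<open>K\<close> has length at most 1.\<close>

definition simple_step :: "'a set \<Rightarrow> 'a set \<Rightarrow> 'a set \<Rightarrow> bool" where
  "simple_step Q K L \<longleftrightarrow> closed_at Q K \<and>
     (\<exists>u\<in>carrier R. (\<forall>q\<in>Q. q \<otimes> u \<in> K) \<and> L = sat Q (adjoin K u))"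

section \<open>Composition series over a local ring\<close>

lemma closed_at_sat: "primeideal Q R \<Longrightarrow> ideal K R \<Longrightarrow> closed_at Q (sat Q K)"
  by (simp add: closed_at_def ideal_sat sat_sat)

lemma closed_at_carrier: "primeideal Q R \<Longrightarrow> closed_at Q (carrier R)"
  unfolding closed_at_def using oneideal subset_sat[of Q "carrier R"] sat_carrier[of Q] by blast

lemma closed_at_least: "closed_at Q L \<Longrightarrow> K \<subseteq> L \<Longrightarrow> sat Q K \<subseteq> L"
  unfolding closed_at_def using sat_mono by blast

lemma simple_step_closed: "primeideal Q R \<Longrightarrow> simple_step Q K L \<Longrightarrow> closed_at Q L"
  unfolding simple_step_def using closed_at_sat ideal_adjoin closed_at_def by blast

lemma simple_step_subset: "primeideal Q R \<Longrightarrow> simple_step Q K L \<Longrightarrow> K \<subseteq> L"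
proof -
  assume Q: "primeideal Q R" and "simple_step Q K L"
  then obtain u where u: "closed_at Q K" "u \<in> carrier R" "L = sat Q (adjoin K u)" unfolding simple_step_def by blast
  have K: "ideal K R" using u closed_at_def by blast
  show "K \<subseteq> L" unfolding u using subset_adjoin[OF ideal_subset[OF K] u(2)]
      subset_sat[OF Q ideal_subset[OF ideal_adjoin[OF K u(2)]]] by blast
qed

text \<open>Adding \<open>L\<close> to every term turns a chain from \<open>K\<close> into one from
  \<open>L\<close>. Each \<open>u\<close> already in \<open>L\<close> saves a step. As long as this
  does not happen, the inclusion between the two chains stays strict, so some step is saved before
  the top.\<close>

lemma simple_steps_mono:
  assumes Q: "primeideal Q R"
  shows "(simple_step Q ^^ n) K (carrier R) \<Longrightarrow> closed_at Q L \<Longrightarrow> K \<subset> L \<Longrightarrow>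
    \<exists>m<n. (simple_step Q ^^ m) L (carrier R)"
proof (induction n arbitrary: K L)
  case 0
  then show ?case using ideal_subset unfolding closed_at_def by fastforce
next
  case (Suc n)
  have L: "ideal L R" "sat Q L = L" using Suc.prems(2) closed_at_def by blast+
  obtain K1 where K1: "simple_step Q K K1" "(simple_step Q ^^ n) K1 (carrier R)"
    using relpowp_Suc_D2[OF Suc.prems(1)] by blast
  obtain u where u: "closed_at Q K" "u \<in> carrier R" "\<And>q. q \<in> Q \<Longrightarrow> q \<otimes> u \<in> K" "K1 = sat Q (adjoin K u)"
    using K1 unfolding simple_step_def by blast
  have K: "ideal K R" "sat Q K = K" using u closed_at_def by blast+
  show ?case
  proof (cases "u \<in> L")
    case True
    then have "K1 \<subseteq> L" unfolding u using Suc.prems L by (intro closed_at_least adjoin_least) auto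
    then consider "K1 = L" | "K1 \<subset> L" by blast
    then show ?thesis using K1(2) Suc.IH[OF K1(2) Suc.prems(2)] less_Suc_eq by cases blast+
  next
    case False
    let ?L1 = "sat Q (adjoin L u)"
    have st: "simple_step Q L ?L1" unfolding simple_step_def using Suc.prems u by blast
    have "K1 \<subseteq> ?L1" unfolding u using Suc.prems by (intro sat_mono adjoin_mono) auto
    moreover have "\<not> L \<subseteq> K1"
    proof
      assume LK: "L \<subseteq> K1"
      obtain l where l: "l \<in> L" "l \<notin> K" using Suc.prems by blast
      then have "l \<in> sat Q (adjoin K u)" using LK u by blast
      then obtain t k c where t: "t \<in> carrier R" "t \<notin> Q" and k: "k \<in> K" "c \<in> carrier R" "t \<otimes> l = k \<oplus> c \<otimes> u"
        by (rule sat_adjoinE)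
      have kc: "k \<in> carrier R" using k K ideal_carrier by blast
      \<comment> \<open>\<open>Q\<close> multiplies u into \<open>K\<close>, so c in
        \<open>Q\<close> would put l into \<open>K\<close>. Hence c is invertible at
        \<open>Q\<close>, and u would be in \<open>L\<close>.\<close>
      have "c \<notin> Q"
      proof
        assume "c \<in> Q"
        then have "t \<otimes> l \<in> K" using k u ideal_add[OF K(1)] by simp
        moreover have "l \<in> carrier R" using l(1) L(1) ideal_carrier by blast
        ultimately show False using satI[of t Q l K] t l K by blast
      qed
      have "c \<otimes> u = (k \<oplus> c \<otimes> u) \<ominus> k" using kc k(2) u(2) by algebra
      also have "\<dots> \<in> L" unfolding k(3)[symmetric] using ideal_diff[OF L(1)] ideal_mult[OF L(1) l(1) t(1)] k(1) Suc.prems by blast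
      finally have "u \<in> L" using satI[of c Q u L] k(2) \<open>c \<notin> Q\<close> u(2) L(2) by blast
      then show False using False by blast
    qed
    moreover have "L \<subseteq> ?L1" using simple_step_subset[OF Q st] .
    ultimately have "K1 \<subset> ?L1" by blast
    then obtain m where "m < n" "(simple_step Q ^^ m) ?L1 (carrier R)"
      using Suc.IH[OF K1(2) simple_step_closed[OF Q st]] by blast
    then show ?thesis using relpowp_Suc_I2[of "simple_step Q", OF st] by blast
  qed
qed

lemma adjoin_sat_subset:
  assumes Q: "primeideal Q R" and K: "ideal K R" and u: "u \<in> carrier R"
  shows "adjoin K u \<subseteq> sat Q (adjoin K u)" "K \<subseteq> sat Q (adjoin K u)" "u \<in> sat Q (adjoin K u)"
proof -
  show 1: "adjoin K u \<subseteq> sat Q (adjoin K u)"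
    by (intro subset_sat Q ideal_subset ideal_adjoin K u)
  show "K \<subseteq> sat Q (adjoin K u)" using 1 subset_adjoin[OF ideal_subset[OF K] u] by blast
  show "u \<in> sat Q (adjoin K u)" using 1 mem_adjoin[OF K u] by blast
qed

lemma sat_adjoin_least:
  "closed_at Q L \<Longrightarrow> K \<subseteq> L \<Longrightarrow> u \<in> L \<Longrightarrow> sat Q (adjoin K u) \<subseteq> L"
  by (intro closed_at_least adjoin_least) (auto simp: closed_at_def)

text \<open>The hypothesis on primes says that the local ring modulo \<open>M\<close> is Artinian.
  Whenever \<open>K\<close> is smaller than \<open>I\<close>, some element of \<open>I\<close>
  outside \<open>K\<close> has prime annihilator modulo \<open>K\<close>; this prime contains
  \<open>M\<close> and lies in \<open>Q\<close> because \<open>K\<close> is closed, so it is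
  \<open>Q\<close> and the element spans a simple step.\<close>

lemma simple_steps_exist:
  assumes Q: "primeideal Q R" and M: "closed_at Q M" and I: "closed_at Q I" and MI: "M \<subseteq> I"
    and only: "\<And>P. primeideal P R \<Longrightarrow> M \<subseteq> P \<Longrightarrow> P \<subseteq> Q \<Longrightarrow> P = Q"
  shows "(simple_step Q)\<^sup>*\<^sup>* M I"
proof -
  have iI: "ideal I R" "ideal M R" using I M closed_at_def by blast+
  have "closed_at Q K \<longrightarrow> M \<subseteq> K \<longrightarrow> K \<subseteq> I \<longrightarrow> (simple_step Q)\<^sup>*\<^sup>* K I" if "ideal K R" for K
    using that
  proof (rule noetherian_induct)
    fix K assume iK: "ideal K R"
      and IH: "\<And>L. ideal L R \<Longrightarrow> K \<subset> L \<Longrightarrow> closed_at Q L \<longrightarrow> M \<subseteq> L \<longrightarrow> L \<subseteq> I \<longrightarrow> (simple_step Q)\<^sup>*\<^sup>* L I"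
    show "closed_at Q K \<longrightarrow> M \<subseteq> K \<longrightarrow> K \<subseteq> I \<longrightarrow> (simple_step Q)\<^sup>*\<^sup>* K I"
    proof (intro impI)
      assume K: "closed_at Q K" "M \<subseteq> K" "K \<subseteq> I"
      show "(simple_step Q)\<^sup>*\<^sup>* K I"
      proof (cases "K = I")
        case False
        then obtain a where a: "a \<in> I" "a \<notin> K" using K by blast
        have ac: "a \<in> carrier R" using a iI ideal_carrier by blast
        obtain r where r: "r \<in> carrier R" "r \<otimes> a \<notin> K" "primeideal (colon K (r \<otimes> a)) R"
          using exists_associated_prime[OF iK ac a(2)] by blast
        let ?P = "colon K (r \<otimes> a)" and ?L = "sat Q (adjoin K (r \<otimes> a))"
        have rac: "r \<otimes> a \<in> carrier R" using r ac by auto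
        have comm: "t \<otimes> (r \<otimes> a) \<in> K" if "t \<in> ?P" for t
          using colonD[OF that] m_comm[OF rac] by simp
        have "?P \<subseteq> Q"
        proof
          fix t assume t: "t \<in> ?P"
          show "t \<in> Q" using satI[OF colonD(2)[OF t] _ comm[OF t] rac, of Q] K(1) r(2) closed_at_def by blast
        qed
        then have "?P = Q" using only r subset_colon[OF iK rac] K by blast
        then have st: "simple_step Q K ?L" unfolding simple_step_def using K rac comm by blast
        have KL: "K \<subset> ?L"
          using simple_step_subset[OF Q st] adjoin_sat_subset(3)[OF Q iK rac] r(2) by blast
        have "?L \<subseteq> I" using K a r by (intro sat_adjoin_least[OF I] ideal_mult[OF iI(1)]) auto
        then have "(simple_step Q)\<^sup>*\<^sup>* ?L I"
          using IH[OF _ KL] simple_step_closed[OF Q st] KL K(2) unfolding closed_at_def by blast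
        then show ?thesis using st by (rule converse_rtranclp_into_rtranclp[rotated])
      qed simp
    qed
  qed
  then show ?thesis using M MI iI by blast
qed

text \<open>By \<open>simple_steps_mono\<close> every strict drop increases the number of steps
  needed to reach the whole ring, while no ideal above \<open>M\<close> needs more steps than
  \<open>M\<close> does.\<close>

lemma no_strict_descent:
  fixes L :: "nat \<Rightarrow> 'a set"
  assumes Q: "primeideal Q R" and M: "closed_at Q M"
    and only: "\<And>P. primeideal P R \<Longrightarrow> M \<subseteq> P \<Longrightarrow> P \<subseteq> Q \<Longrightarrow> P = Q"
    and L: "\<And>k. closed_at Q (L k)" "\<And>k. L (Suc k) \<subseteq> L k" "\<And>k. M \<subseteq> L k"
  shows "\<exists>k. L (Suc k) = L k"
proof (rule ccontr)
  assume "\<nexists>k. L (Suc k) = L k"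
  then have strict: "L (Suc k) \<subset> L k" for k using L by blast
  have "ideal M R" using M closed_at_def by blast
  then have "(simple_step Q)\<^sup>*\<^sup>* M (carrier R)"
    using simple_steps_exist[OF Q M closed_at_carrier[OF Q] _ only] ideal_subset by blast
  then obtain n0 where n0: "(simple_step Q ^^ n0) M (carrier R)" using rtranclp_imp_relpowp by metis
  have bound: "k \<le> n" if "(simple_step Q ^^ n) (L k) (carrier R)" for k n
    using that
  proof (induction k arbitrary: n)
    case (Suc k)
    obtain m where "m < n" "(simple_step Q ^^ m) (L k) (carrier R)"
      using simple_steps_mono[OF Q Suc.prems L(1) strict] by blast
    then show ?case using Suc.IH by fastforce
  qed simp
  let ?k = "Suc n0"
  have "\<exists>m\<le>n0. (simple_step Q ^^ m) (L ?k) (carrier R)"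
  proof (cases "M = L ?k")
    case True then show ?thesis using n0 by auto
  next
    case False
    then have "M \<subset> L ?k" using L by blast
    then show ?thesis using simple_steps_mono[OF Q n0 L(1)] less_imp_le by blast
  qed
  then show False using bound by fastforce
qed

text \<open>Krull's principal ideal theorem in R / \<open>P0\<close>: otherwise \<open>Q\<close> is
  minimal over \<open>P0\<close> and x, so its height over \<open>P0\<close> is at most 1, against
  \<open>P1\<close>.\<close>

lemma krull_intermediate_prime:
  assumes P: "primeideal P0 R" "primeideal P1 R" "primeideal Q R" "P0 \<subset> P1" "P1 \<subset> Q" and x: "x \<in> Q"
  shows "\<exists>P. primeideal P R \<and> P0 \<subset> P \<and> P \<subset> Q \<and> x \<in> P"
proof (rule ccontr)
  assume no: "\<not> ?thesis"
  then have x1: "x \<notin> P1" using P by blast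
  then have x0: "x \<notin> P0" using P by blast
  note iP = P(1,2,3)[THEN prime_ideal]
  have xc: "x \<in> carrier R" using x iP ideal_carrier by blast
  obtain b where b: "b \<in> P1" "b \<notin> P0" using P by blast
  have bc: "b \<in> carrier R" using b iP ideal_carrier by blast
  \<comment> \<open>Powers of a single b, contracted from the local ring at \<open>P1\<close>, take
    the place of the symbolic powers of \<open>P1\<close> in the usual proof. The contraction makes
    x cancellable, as x is outside \<open>P1\<close>.\<close>
  define I where "I k = sat P1 (adjoin P0 (b [^] (k::nat)))" for k
  define L where "L k = sat Q (adjoin (I k) x)" for k
  define M where "M = sat Q (adjoin P0 x)"
  have iI: "ideal (I k) R" for k unfolding I_def using P iP bc by (intro ideal_sat ideal_adjoin) auto
  have P0I: "P0 \<subseteq> I k" for k unfolding I_def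
    using subset_sat[OF P(2)] subset_adjoin[OF ideal_subset[OF iP(1)]] ideal_adjoin[OF iP(1)] bc
    by (meson nat_pow_closed ideal_subset subset_trans)
  have Idec: "I (Suc k) \<subseteq> I k" for k
  proof -
    have "b [^] Suc k \<in> adjoin P0 (b [^] k)"
      using ideal_mult'[OF ideal_adjoin[OF iP(1)] mem_adjoin[OF iP(1)] bc] bc by simp
    then have "adjoin P0 (b [^] Suc k) \<subseteq> adjoin P0 (b [^] k)"
      using bc iP by (intro adjoin_least ideal_adjoin subset_adjoin ideal_subset) auto
    then show ?thesis unfolding I_def by (rule sat_mono)
  qed
  have clM: "closed_at Q M" unfolding M_def using P iP xc by (intro closed_at_sat ideal_adjoin) auto
  have "\<exists>k. L (Suc k) = L k"
  proof (rule no_strict_descent[OF P(3) clM])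
    fix T assume T: "primeideal T R" "M \<subseteq> T" "T \<subseteq> Q"
    have "adjoin P0 x \<subseteq> T" using T(2) unfolding M_def
      using subset_sat[OF P(3) ideal_subset[OF ideal_adjoin[OF iP(1) xc]]] by blast
    then have "P0 \<subseteq> T" "x \<in> T"
      using subset_adjoin[OF ideal_subset[OF iP(1)] xc] mem_adjoin[OF iP(1) xc] by blast+
    then show "T = Q" using no T x0 by blast
  next
    show "closed_at Q (L k)" for k unfolding L_def using P iI xc by (intro closed_at_sat ideal_adjoin) auto
    show "L (Suc k) \<subseteq> L k" for k unfolding L_def by (intro sat_mono adjoin_mono Idec)
    show "M \<subseteq> L k" for k unfolding L_def M_def by (intro sat_mono adjoin_mono P0I)
  qed
  then obtain k where k: "L (Suc k) = L k" by blast
  \<comment> \<open>Stationarity writes an element of I k as a' + c x with a' in I (k+1). Then c x,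
    hence c, lies in I k, and Nakayama removes that term.\<close>
  have "I k \<subseteq> sat Q (I (Suc k))"
  proof (rule nakayama_principal[OF P(3) iI ideal_subset[OF iI] x])
    fix a assume a: "a \<in> I k"
    have "I k \<subseteq> L k" unfolding L_def
      using subset_adjoin[OF ideal_subset[OF iI] xc]
        subset_sat[OF P(3) ideal_subset[OF ideal_adjoin[OF iI xc]]] by blast
    then have "a \<in> sat Q (adjoin (I (Suc k)) x)" using a k unfolding L_def by blast
    then obtain t a' c where t: "t \<in> carrier R" "t \<notin> Q" and a': "a' \<in> I (Suc k)" "c \<in> carrier R" "t \<otimes> a = a' \<oplus> c \<otimes> x"
      by (rule sat_adjoinE)
    have ac: "a' \<in> carrier R" using a' iI ideal_carrier by blast
    have "x \<otimes> c = (a' \<oplus> c \<otimes> x) \<ominus> a'" using ac a'(2) xc by algebra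
    also have "\<dots> \<in> I k" unfolding a'(3)[symmetric]
      using ideal_diff[OF iI] ideal_mult[OF iI a t(1)] a' Idec by blast
    finally have "c \<in> I k" unfolding I_def using sat_cancel[OF P(2) xc x1 a'(2)] by blast
    then show "\<exists>t b m. t \<in> carrier R \<and> t \<notin> Q \<and> b \<in> I (Suc k) \<and> m \<in> I k \<and> t \<otimes> a = b \<oplus> m \<otimes> x"
      using t a' by blast
  qed
  moreover have "b [^] k \<in> I k" unfolding I_def
    using mem_adjoin[OF iP(1)] subset_sat[OF P(2)] ideal_adjoin[OF iP(1)] bc
    by (meson nat_pow_closed ideal_subset subsetD)
  ultimately have "b [^] k \<in> sat Q (I (Suc k))" by blast
  then obtain t where t: "t \<in> carrier R" "t \<notin> Q" "t \<otimes> b [^] k \<in> I (Suc k)" by (rule satE)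
  then obtain s where s: "s \<in> carrier R" "s \<notin> P1" "s \<otimes> (t \<otimes> b [^] k) \<in> adjoin P0 (b [^] Suc k)"
    unfolding I_def by (meson satE)
  then obtain p r where p: "p \<in> P0" "r \<in> carrier R" "s \<otimes> (t \<otimes> b [^] k) = p \<oplus> r \<otimes> b [^] Suc k" by (meson adjoinE)
  have pc: "p \<in> carrier R" "b [^] k \<in> carrier R" using p iP ideal_carrier bc by auto
  have "b [^] k \<otimes> (s \<otimes> t \<ominus> r \<otimes> b) = s \<otimes> (t \<otimes> b [^] k) \<ominus> r \<otimes> (b [^] k \<otimes> b)"
    using pc(2) s(1) t(1) p(2) bc by algebra
  also have "\<dots> = (p \<oplus> r \<otimes> (b [^] k \<otimes> b)) \<ominus> r \<otimes> (b [^] k \<otimes> b)" using p by simp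
  also have "\<dots> = p" using pc p(2) bc by algebra
  finally have "b [^] k \<otimes> (s \<otimes> t \<ominus> r \<otimes> b) \<in> P0" using p by simp
  \<comment> \<open>b^k cancels modulo the prime \<open>P0\<close>, so s t agrees with r b there;
    but b is in \<open>P1\<close> while s and t are not.\<close>
  then have "s \<otimes> t \<ominus> r \<otimes> b \<in> P0"
    using prime_mult_iff[OF P(1)] prime_pow[OF P(1) bc] b s t p bc by (meson m_closed minus_closed nat_pow_closed)
  then have "s \<otimes> t \<in> P1"
    using ideal_diff_cancel[OF iP(2), of "s \<otimes> t" "r \<otimes> b"] ideal_mult[OF iP(2) b(1) p(2)] s t P(4) by auto
  then show False using prime_mult_iff[OF P(2)] s t P(5) by blast
qed

section \<open>Krull's height theorem and regular systems of parameters\<close>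

lemma prime_chain_less: "prime_chain R c n \<Longrightarrow> i < j \<Longrightarrow> j \<le> n \<Longrightarrow> c i \<subset> c j"
proof (induction j)
  case (Suc j)
  then have "c j \<subset> c (Suc j)" unfolding prime_chain_def by auto
  then show ?case using Suc by (cases "i = j") auto
qed simp

lemma prime_chain_prime: "prime_chain R c n \<Longrightarrow> i \<le> n \<Longrightarrow> primeideal (c i) R"
  by (simp add: prime_chain_def)

lemma prime_chain_snoc:
  assumes "prime_chain R c n" "primeideal P R" "c n \<subset> P"
  shows "prime_chain R (c(Suc n := P)) (Suc n)"
  unfolding prime_chain_def
proof (intro conjI allI impI)
  fix i assume "i \<le> Suc n"
  then show "primeideal ((c(Suc n := P)) i) R" using assms by (auto simp: prime_chain_def le_Suc_eq)
next
  fix i assume "i < Suc n"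
  then show "(c(Suc n := P)) i \<subset> (c(Suc n := P)) (Suc i)"
    using assms by (cases "i = n") (auto simp: prime_chain_def)
qed

lemma prime_chain_top:
  assumes "prime_chain R c n" "primeideal Q R" "c n \<subseteq> Q"
  shows "prime_chain R (c(n := Q)) n"
proof (cases n)
  case 0 then show ?thesis using assms by (simp add: prime_chain_def)
next
  case (Suc m)
  then have "prime_chain R c m" "c m \<subset> Q" using assms by (auto simp: prime_chain_def)
  then show ?thesis using prime_chain_snoc assms Suc by simp
qed

text \<open>Starting below the top, the primes of the chain are exchanged one after another for
  primes containing x by \<open>krull_intermediate_prime\<close>. The last exchange would reach c 0,
  which is given up: x costs one link.\<close>

lemma prime_chain_shift:
  "prime_chain R c (Suc d) \<Longrightarrow> x \<in> c (Suc d) \<Longrightarrow>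
    \<exists>c'. prime_chain R c' d \<and> x \<in> c' 0 \<and> c' d = c (Suc d) \<and> c 0 \<subset> c' 0"
proof (induction d arbitrary: c)
  case 0
  then show ?case by (intro exI[of _ "\<lambda>_. c (Suc 0)"]) (auto simp: prime_chain_def)
next
  case (Suc d)
  let ?Q = "c (Suc (Suc d))"
  have "\<exists>P. primeideal P R \<and> c d \<subset> P \<and> P \<subset> ?Q \<and> x \<in> P"
    using Suc.prems(1) by (intro krull_intermediate_prime[of _ "c (Suc d)"] Suc.prems(2)) (auto simp: prime_chain_def)
  then obtain P where P: "primeideal P R" "c d \<subset> P" "P \<subset> ?Q" "x \<in> P" by blast
  have "prime_chain R c d" using Suc.prems by (auto simp: prime_chain_def)
  then have ch: "prime_chain R (c(Suc d := P)) (Suc d)" using P by (intro prime_chain_snoc)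
  have top: "x \<in> (c(Suc d := P)) (Suc d)" using P by simp
  obtain c' where c': "prime_chain R c' d" "x \<in> c' 0" "c' d = P" "c 0 \<subset> c' 0"
    using Suc.IH[OF ch top] by auto
  have "prime_chain R (c'(Suc d := ?Q)) (Suc d)"
    using c' P Suc.prems by (intro prime_chain_snoc) (auto simp: prime_chain_def)
  moreover have "x \<in> (c'(Suc d := ?Q)) 0" "(c'(Suc d := ?Q)) (Suc d) = ?Q" "c 0 \<subset> (c'(Suc d := ?Q)) 0"
    using c' by simp_all
  ultimately show ?case by blast
qed

lemma sat_Idl_least:
  assumes "primeideal Q R" "primeideal P R" "P \<subseteq> Q" "A \<subseteq> P"
  shows "sat Q (Idl A) \<subseteq> P"
  using sat_mono[OF genideal_minimal[OF prime_ideal[OF assms(2)] assms(4)], of Q] sat_prime[OF assms(1-3)] by blast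

text \<open>Krull's height theorem relative to a set \<open>A\<close>. Each y is moved from
  \<open>Y\<close> to \<open>A\<close> by \<open>prime_chain_shift\<close> at the price of one link;
  once \<open>Y\<close> is used up, \<open>A\<close> already generates \<open>Q\<close> locally and
  no link is left.\<close>

lemma prime_chain_height:
  assumes Q: "primeideal Q R"
  shows "finite Y \<Longrightarrow> Y \<subseteq> Q \<Longrightarrow> Q \<subseteq> sat Q (Idl (A \<union> Y)) \<Longrightarrow> prime_chain R c n \<Longrightarrow> A \<subseteq> c 0 \<Longrightarrow> c n \<subseteq> Q \<Longrightarrow>
    n \<le> card Y"
proof (induction Y arbitrary: A c n rule: finite_induct)
  case empty
  show ?case
  proof (rule ccontr)
    assume "\<not> n \<le> card {}"
    then have "c 0 \<subset> c n" using prime_chain_less[OF empty(3), of 0 n] by simp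
    moreover have "sat Q (Idl A) \<subseteq> c 0"
      using calculation empty prime_chain_prime[OF empty(3), of 0] by (intro sat_Idl_least[OF Q]) auto
    ultimately show False using empty by auto
  qed
next
  case (insert y Y)
  show ?case
  proof (cases n)
    case (Suc m)
    have yQ: "y \<in> Q" using insert by blast
    have ch: "prime_chain R (c(n := Q)) (Suc m)" using prime_chain_top[OF insert(6) Q insert(8)] Suc by simp
    have top: "y \<in> (c(n := Q)) (Suc m)" using yQ Suc by simp
    obtain c' where c': "prime_chain R c' m" "y \<in> c' 0" "c' m = Q" "c 0 \<subset> c' 0"
      using prime_chain_shift[OF ch top] Suc by auto
    have "m \<le> card Y" by (rule insert.IH[of "insert y A" c' m]) (use insert.prems c' in auto)
    then show ?thesis using Suc insert by simp
  qed simp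
qed

text \<open>The proof that a regular local ring is a domain, applied to the local ring modulo
  \<open>A\<close>. For some y in \<open>Y\<close> outside c 0 the ideal of \<open>A\<close> and y
  is prime by induction and contains c 0; since c 0 does not contain y, Nakayama shows that c 0 is
  generated by \<open>A\<close> locally.\<close>

lemma sat_Idl_prime:
  assumes Q: "primeideal Q R"
  shows "card Y = d \<Longrightarrow> finite Y \<Longrightarrow> Y \<subseteq> Q \<Longrightarrow> Q \<subseteq> sat Q (Idl (A \<union> Y)) \<Longrightarrow> prime_chain R c d \<Longrightarrow> A \<subseteq> c 0 \<Longrightarrow> c d = Q \<Longrightarrow>
    primeideal (sat Q (Idl A)) R"
proof (induction d arbitrary: Y A c)
  case 0
  then have "Y = {}" by simp
  then have "Q \<subseteq> sat Q (Idl A)" using 0 by simp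
  moreover have "sat Q (Idl A) \<subseteq> Q" using 0 by (intro sat_Idl_least Q) auto
  ultimately show ?case using Q by simp
next
  case (Suc d)
  have p0: "primeideal (c 0) R" using prime_chain_prime[OF Suc.prems(5)] by blast
  have c0Q: "c 0 \<subset> Q" using prime_chain_less[OF Suc.prems(5), of 0 "Suc d"] Suc.prems by simp
  have Ac: "A \<subseteq> carrier R" using Suc.prems(6) ideal_subset[OF prime_ideal[OF p0]] by blast
  have "\<not> Y \<subseteq> c 0"
  proof
    assume "Y \<subseteq> c 0"
    then have "sat Q (Idl (A \<union> Y)) \<subseteq> c 0" using Suc.prems c0Q p0 by (intro sat_Idl_least Q) auto
    then show False using c0Q Suc.prems by blast
  qed
  then obtain y where y: "y \<in> Y" "y \<notin> c 0" by blast
  have yQ: "y \<in> Q" using y Suc.prems by blast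
  have yc: "y \<in> carrier R" using yQ prime_ideal[OF Q] ideal_carrier by blast
  obtain c' where c': "prime_chain R c' d" "y \<in> c' 0" "c' d = Q" "c 0 \<subset> c' 0"
    using prime_chain_shift[OF Suc.prems(5), of y, unfolded Suc.prems(7), OF yQ] by metis
  let ?p = "sat Q (Idl (insert y A))"
  have cY: "card (Y - {y}) = d" using Suc.prems y by simp
  have eqn: "insert y A \<union> (Y - {y}) = A \<union> Y" using y by blast
  have p: "primeideal ?p R"
    by (rule Suc.IH[of "Y - {y}" "insert y A" c']) (use Suc.prems c' cY eqn in auto)
  have p0': "primeideal (c' 0) R" using prime_chain_prime[OF c'(1)] by blast
  have c'Q: "c' 0 \<subseteq> Q" using prime_chain_subset[OF c'(1), of 0] c' by simp
  have pc': "?p \<subseteq> c' 0" using c' Suc.prems(6) c'Q p0' by (intro sat_Idl_least Q) auto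
  \<comment> \<open>Otherwise this prime could be put below the chain c', giving one link more than
    the d remaining generators allow.\<close>
  have "?p = c' 0"
  proof (rule ccontr)
    assume "?p \<noteq> c' 0"
    then have ne: "?p \<subset> c' 0" using pc' by blast
    let ?c = "\<lambda>i. case i of 0 \<Rightarrow> ?p | Suc j \<Rightarrow> c' j"
    have ch: "prime_chain R ?c (Suc d)" unfolding prime_chain_def
      using p ne c'(1) by (auto simp: prime_chain_def split: nat.splits)
    have yA: "insert y A \<subseteq> carrier R" using Ac yc by blast
    have "insert y A \<subseteq> ?p"
      using genideal_self[OF yA] subset_sat[OF Q ideal_subset[OF genideal_ideal[OF yA]]] by (rule subset_trans)
    then have "insert y A \<subseteq> ?c 0" by simp
    then have "Suc d \<le> card (Y - {y})"
    proof (intro prime_chain_height[OF Q _ _ _ ch])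
      show "Q \<subseteq> sat Q (Idl (insert y A \<union> (Y - {y})))" unfolding eqn by (rule Suc.prems(4))
      show "(case Suc d of 0 \<Rightarrow> ?p | Suc j \<Rightarrow> c' j) \<subseteq> Q" using c'(3) by simp
    qed (use Suc.prems in blast)+
    then show False using cY by simp
  qed
  then have c0p: "c 0 \<subseteq> ?p" using c' by blast
  have iA: "ideal (Idl A) R" using Ac by (rule genideal_ideal)
  have Ac0: "Idl A \<subseteq> c 0" using Suc.prems(6) by (intro genideal_minimal prime_ideal p0)
  \<comment> \<open>An element of c 0 is a + r y with a from \<open>A\<close>; then r y is in c 0,
    hence r is too, as needed for Nakayama.\<close>
  have "c 0 \<subseteq> sat Q (Idl A)"
  proof (rule nakayama_principal[OF Q iA ideal_subset[OF prime_ideal[OF p0]] yQ])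
    fix e assume e: "e \<in> c 0"
    then have "e \<in> sat Q (adjoin (Idl A) y)" using c0p Idl_insert[OF yc Ac] by auto
    then obtain t a r where t: "t \<in> carrier R" "t \<notin> Q" and a: "a \<in> Idl A" "r \<in> carrier R" "t \<otimes> e = a \<oplus> r \<otimes> y"
      by (rule sat_adjoinE)
    have ac: "a \<in> carrier R" using a iA ideal_carrier by blast
    have "r \<otimes> y = (a \<oplus> r \<otimes> y) \<ominus> a" using ac a(2) yc by algebra
    also have "\<dots> \<in> c 0" unfolding a(3)[symmetric]
      using ideal_diff[OF prime_ideal[OF p0]] ideal_mult[OF prime_ideal[OF p0] e t(1)] a(1) Ac0 by blast
    finally have "r \<in> c 0" using prime_mult_iff[OF p0 a(2) yc] y by blast
    then show "\<exists>t b m. t \<in> carrier R \<and> t \<notin> Q \<and> b \<in> Idl A \<and> m \<in> c 0 \<and> t \<otimes> e = b \<oplus> m \<otimes> y"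
      using t a by blast
  qed
  moreover have "sat Q (Idl A) \<subseteq> c 0" using Suc.prems c0Q p0 by (intro sat_Idl_least Q) auto
  ultimately have "sat Q (Idl A) = c 0" by blast
  then show ?case using p0 by simp
qed

text \<open>A regular system of parameters of the local ring at \<open>Q\<close>, with denominators
  cleared. By \<open>prime_chain_height\<close> no chain in \<open>Q\<close> is longer than
  \<open>card Y\<close>, so the last clause makes \<open>card Y\<close> the height of
  \<open>Q\<close>.\<close>

definition regular_system :: "'a set \<Rightarrow> 'a set \<Rightarrow> bool" where
  "regular_system Q Y \<longleftrightarrow> primeideal Q R \<and> finite Y \<and> Y \<subseteq> Q \<and> Q \<subseteq> sat Q (Idl Y) \<and>
     (\<exists>c. prime_chain R c (card Y) \<and> c (card Y) \<subseteq> Q)"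

text \<open>\<open>prime_chain_shift\<close> moves the elements of \<open>Z\<close> into the bottom
  prime one at a time, each costing one link.\<close>

lemma regular_system_chain:
  assumes reg: "regular_system Q Y" and Z: "Z \<subseteq> Y"
  shows "\<exists>c. prime_chain R c (card (Y - Z)) \<and> Z \<subseteq> c 0 \<and> c (card (Y - Z)) = Q"
proof -
  have Q: "primeideal Q R" and Y: "finite Y" "Y \<subseteq> Q" using reg unfolding regular_system_def by blast+
  have "finite Z" using Z Y finite_subset by blast
  then show ?thesis using Z
  proof (induction Z rule: finite_induct)
    case empty
    obtain c where "prime_chain R c (card Y)" "c (card Y) \<subseteq> Q" using reg unfolding regular_system_def by blast
    then have "prime_chain R (c(card Y := Q)) (card Y)" using prime_chain_top[OF _ Q] by blast
    then show ?case by (intro exI[of _ "c(card Y := Q)"]) (simp del: fun_upd_apply, simp)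
  next
    case (insert z Z)
    have "Y - Z = insert z (Y - insert z Z)" using insert.hyps insert.prems by blast
    moreover have "finite (Y - insert z Z)" using Y(1) by (rule finite_Diff)
    ultimately have cd: "card (Y - Z) = Suc (card (Y - insert z Z))"
      by (metis DiffE card_insert_disjoint insertI1)
    obtain c where c: "prime_chain R c (Suc (card (Y - insert z Z)))" "Z \<subseteq> c 0"
      "c (Suc (card (Y - insert z Z))) = Q"
      using insert.IH insert.prems unfolding cd by blast
    have "z \<in> Q" using insert.prems Y by blast
    then obtain c' where c': "prime_chain R c' (card (Y - insert z Z))" "z \<in> c' 0" "c' (card (Y - insert z Z)) = Q" "c 0 \<subset> c' 0"
      using prime_chain_shift[OF c(1), of z, unfolded c(3)] by metis
    then have "insert z Z \<subseteq> c' 0" using c(2) by blast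
    then show ?case using c' by blast
  qed
qed

lemma regular_system_prime:
  assumes reg: "regular_system Q Y" and Z: "Z \<subseteq> Y"
  shows "primeideal (sat Q (Idl Z)) R"
proof -
  have Q: "primeideal Q R" and Y: "finite Y" "Y \<subseteq> Q" "Q \<subseteq> sat Q (Idl Y)" using reg unfolding regular_system_def by blast+
  obtain c where c: "prime_chain R c (card (Y - Z))" "Z \<subseteq> c 0" "c (card (Y - Z)) = Q"
    using regular_system_chain[OF assms] by blast
  have "Z \<union> (Y - Z) = Y" using Z by blast
  then show ?thesis using c Y by (intro sat_Idl_prime[OF Q refl _ _ _ c(1)]) auto
qed

text \<open>Otherwise \<open>Y\<close> without y still generates \<open>Q\<close> locally, and the
  chain above \<open>Z\<close> is longer than the number of remaining generators. With
  \<open>regular_system_prime\<close> this makes \<open>Y\<close> a regular sequence in every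
  order.\<close>

lemma regular_system_notin:
  assumes reg: "regular_system Q Y" and Z: "Z \<subseteq> Y" and y: "y \<in> Y" "y \<notin> Z"
  shows "y \<notin> sat Q (Idl Z)"
proof
  assume yZ: "y \<in> sat Q (Idl Z)"
  have Q: "primeideal Q R" and Y: "finite Y" "Y \<subseteq> Q" "Q \<subseteq> sat Q (Idl Y)" using reg unfolding regular_system_def by blast+
  have Yc: "Y \<subseteq> carrier R" using Y ideal_subset[OF prime_ideal[OF Q]] by blast
  obtain c where c: "prime_chain R c (card (Y - Z))" "Z \<subseteq> c 0" "c (card (Y - Z)) = Q"
    using regular_system_chain[OF reg Z] by blast
  let ?W = "Y - Z - {y}"
  have e: "Z \<union> ?W = Y - {y}" using Z y by blast
  have iW: "ideal (Idl (Y - {y})) R" using Yc by (intro genideal_ideal) auto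
  have "Idl Z \<subseteq> Idl (Y - {y})" using Yc Z y by (intro subset_Idl_subset) (auto intro: genideal_self[THEN subsetD])
  then have "y \<in> sat Q (Idl (Y - {y}))" using yZ sat_mono by blast
  moreover have "Y - {y} \<subseteq> sat Q (Idl (Y - {y}))"
    using Yc genideal_self[of "Y - {y}"] subset_sat[OF Q ideal_subset[OF iW]] by blast
  ultimately have "Y \<subseteq> sat Q (Idl (Y - {y}))" by blast
  then have "Idl Y \<subseteq> sat Q (Idl (Y - {y}))" by (intro genideal_minimal ideal_sat Q iW)
  then have "Q \<subseteq> sat Q (Idl (Z \<union> ?W))" unfolding e using Y(3) sat_least[OF Q] by blast
  then have "card (Y - Z) \<le> card ?W"
    using prime_chain_height[OF Q, of ?W Z c] c Y by auto
  moreover have "card (Y - Z) > card ?W" using y Y by (intro psubset_card_mono) auto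
  ultimately show False by simp
qed

end

section \<open>Powers of regular systems of parameters\<close>

context noetherian_cring
begin

text \<open>Being a nonzerodivisor on the quotient of the local ring at \<open>Q\<close> by
  \<open>K\<close>.\<close>

definition regular_mod :: "'a set \<Rightarrow> 'a set \<Rightarrow> 'a \<Rightarrow> bool" where
  "regular_mod Q K y \<longleftrightarrow> (\<forall>v\<in>carrier R. y \<otimes> v \<in> sat Q K \<longrightarrow> v \<in> sat Q K)"

lemma regular_modD: "regular_mod Q K y \<Longrightarrow> v \<in> carrier R \<Longrightarrow> y \<otimes> v \<in> sat Q K \<Longrightarrow> v \<in> sat Q K"
  unfolding regular_mod_def by blast

lemma regular_mod_pow:
  assumes "regular_mod Q K z" "z \<in> carrier R" "v \<in> carrier R" "z [^] (n::nat) \<otimes> v \<in> sat Q K"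
  shows "v \<in> sat Q K"
  using assms(3,4)
proof (induction n arbitrary: v)
  case (Suc n)
  have pc: "z [^] n \<in> carrier R" using assms by simp
  have "z [^] n \<otimes> (z \<otimes> v) \<in> sat Q K" using Suc.prems pc assms(2) by (simp add: m_assoc)
  then have "z \<otimes> v \<in> sat Q K" using Suc assms by simp
  then show ?case using regular_modD[OF assms(1)] Suc by blast
qed simp

text \<open>Since z is regular modulo \<open>K\<close>, the quotient by (K, z^(n+1)) is an extension
  of the quotient by (K, z^n) by that by (K, z), embedded through multiplication by z^n. An element
  killed by y dies in the former, so it is c z^n, and then c dies in the latter.\<close>

lemma regular_mod_Suc:
  assumes Q: "primeideal Q R" and K: "ideal K R" and y: "y \<in> carrier R" and z: "z \<in> carrier R"
    and yn: "regular_mod Q (adjoin K (z [^] n)) y"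
    and zK: "regular_mod Q K z"
    and y1: "regular_mod Q (adjoin K z) y"
  shows "regular_mod Q (adjoin K (z [^] Suc n)) y"
  unfolding regular_mod_def
proof (intro ballI impI)
  fix v assume v: "v \<in> carrier R" and yv: "y \<otimes> v \<in> sat Q (adjoin K (z [^] Suc n))"
  have pc: "z [^] n \<in> carrier R" "z [^] Suc n \<in> carrier R" using z by auto
  have "z [^] Suc n \<in> adjoin K (z [^] n)"
    using ideal_mult'[OF ideal_adjoin[OF K pc(1)] mem_adjoin[OF K pc(1)] z] by simp
  then have "adjoin K (z [^] Suc n) \<subseteq> adjoin K (z [^] n)"
    using subset_adjoin[OF ideal_subset[OF K] pc(1)] by (intro adjoin_least ideal_adjoin K pc) auto
  then have "y \<otimes> v \<in> sat Q (adjoin K (z [^] n))" using yv sat_mono by blast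
  then have "v \<in> sat Q (adjoin K (z [^] n))" by (rule regular_modD[OF yn v])
  then obtain t k c where t: "t \<in> carrier R" "t \<notin> Q" and k: "k \<in> K" "c \<in> carrier R" "t \<otimes> v = k \<oplus> c \<otimes> z [^] n"
    by (rule sat_adjoinE)
  obtain s l e where s: "s \<in> carrier R" "s \<notin> Q" and l: "l \<in> K" "e \<in> carrier R" "s \<otimes> (y \<otimes> v) = l \<oplus> e \<otimes> z [^] Suc n"
    using yv by (rule sat_adjoinE)
  have kl: "k \<in> carrier R" "l \<in> carrier R" using k l ideal_carrier[OF K] by auto
  \<comment> \<open>The two expressions for s t y v, one through z^n and one through z^(n+1), are
    compared so that z^n can be cancelled.\<close>
  have "z [^] n \<otimes> (s \<otimes> (y \<otimes> c) \<ominus> z \<otimes> (t \<otimes> e)) =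
      (s \<otimes> y) \<otimes> (k \<oplus> c \<otimes> z [^] n) \<ominus> (s \<otimes> y) \<otimes> k \<ominus> (t \<otimes> (l \<oplus> e \<otimes> (z [^] n \<otimes> z)) \<ominus> t \<otimes> l)"
    using pc(1) s(1) y k(2) z t(1) l(2) kl by algebra
  also have "\<dots> = (s \<otimes> y) \<otimes> (t \<otimes> v) \<ominus> (s \<otimes> y) \<otimes> k \<ominus> (t \<otimes> (s \<otimes> (y \<otimes> v)) \<ominus> t \<otimes> l)"
    using k(3) l(3) by simp
  also have "\<dots> = t \<otimes> l \<ominus> (s \<otimes> y) \<otimes> k" using s(1) y t(1) v kl by algebra
  also have "\<dots> \<in> K" using s y t k l by (intro ideal_diff[OF K] ideal_mult[OF K]) auto
  finally have "z [^] n \<otimes> (s \<otimes> (y \<otimes> c) \<ominus> z \<otimes> (t \<otimes> e)) \<in> K" .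
  then have "z [^] n \<otimes> (s \<otimes> (y \<otimes> c) \<ominus> z \<otimes> (t \<otimes> e)) \<in> sat Q K"
    by (rule subsetD[OF subset_sat[OF Q ideal_subset[OF K]]])
  then have "s \<otimes> (y \<otimes> c) \<ominus> z \<otimes> (t \<otimes> e) \<in> sat Q K"
    using s(1) y k(2) z t(1) l(2) by - (rule regular_mod_pow[OF zK z, of _ n]; simp)
  then have "s \<otimes> (y \<otimes> c) \<ominus> z \<otimes> (t \<otimes> e) \<in> sat Q (adjoin K z)"
    using sat_mono[OF subset_adjoin[OF ideal_subset[OF K] z]] by blast
  moreover have "z \<otimes> (t \<otimes> e) \<in> sat Q (adjoin K z)"
    using ideal_mult'[OF ideal_sat[OF Q ideal_adjoin[OF K z]] adjoin_sat_subset(3)[OF Q K z]] t(1) l(2) by simp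
  ultimately have "s \<otimes> (y \<otimes> c) \<in> sat Q (adjoin K z)"
    using ideal_diff_cancel[OF ideal_sat[OF Q ideal_adjoin[OF K z]]] s(1) y k(2) by simp
  then have "y \<otimes> c \<in> sat Q (adjoin K z)" using s(1,2) y k(2) by - (rule sat_cancel[OF Q, of s]; simp)
  then have "c \<in> sat Q (adjoin K z)" by (rule regular_modD[OF y1 k(2)])
  then obtain t' k' d where t': "t' \<in> carrier R" "t' \<notin> Q" and k': "k' \<in> K" "d \<in> carrier R" "t' \<otimes> c = k' \<oplus> d \<otimes> z"
    by (rule sat_adjoinE)
  have kc': "k' \<in> carrier R" using k' ideal_carrier[OF K] by auto
  have "t' \<otimes> (t \<otimes> v) = t' \<otimes> (k \<oplus> c \<otimes> z [^] n)" using k by simp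
  also have "\<dots> = t' \<otimes> k \<oplus> (t' \<otimes> c) \<otimes> z [^] n" using t'(1) kl k(2) pc(1) by algebra
  also have "\<dots> = t' \<otimes> k \<oplus> (k' \<oplus> d \<otimes> z) \<otimes> z [^] n" using k' by simp
  also have "\<dots> = (t' \<otimes> k \<oplus> z [^] n \<otimes> k') \<oplus> d \<otimes> (z [^] n \<otimes> z)" using t'(1) kl kc' k'(2) z pc(1) by algebra
  also have "\<dots> \<in> adjoin K (z [^] Suc n)"
    using t' k k' pc by (simp) (intro adjoinI ideal_add[OF K] ideal_mult[OF K]; simp)
  finally have "t' \<otimes> (t \<otimes> v) \<in> sat Q (adjoin K (z [^] Suc n))" using adjoin_sat_subset(1)[OF Q K pc(2)] by blast
  then have "t \<otimes> v \<in> sat Q (adjoin K (z [^] Suc n))" using t(1) t'(1,2) v by - (rule sat_cancel[OF Q, of t']; simp)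
  then show "v \<in> sat Q (adjoin K (z [^] Suc n))" by (rule sat_cancel[OF Q t(1,2) v])
qed

text \<open>The exponents form a function so that inductions on their sum can lower one at a
  time.\<close>

definition power_ideal :: "('a \<Rightarrow> nat) \<Rightarrow> 'a set \<Rightarrow> 'a set" where
  "power_ideal a Y = Idl ((\<lambda>y. y [^] a y) ` Y)"

lemma ideal_power_ideal: "Y \<subseteq> carrier R \<Longrightarrow> ideal (power_ideal a Y) R"
  unfolding power_ideal_def by (intro genideal_ideal) auto

lemma power_ideal_split:
  assumes "Y \<subseteq> carrier R" "y \<in> Y"
  shows "power_ideal a Y = adjoin (power_ideal a (Y - {y})) (y [^] a y)"
proof -
  have "(\<lambda>y. y [^] a y) ` Y = insert (y [^] a y) ((\<lambda>y. y [^] a y) ` (Y - {y}))" using assms by blast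
  then show ?thesis unfolding power_ideal_def using assms by (simp only:) (intro Idl_insert; auto)
qed

lemma power_ideal_upd: "power_ideal (a(y := n)) (Y - {y}) = power_ideal a (Y - {y})"
  unfolding power_ideal_def by (intro arg_cong[where f = "genideal R"] image_cong) auto

lemma power_ideal_split_upd:
  assumes "Y \<subseteq> carrier R" "y \<in> Y"
  shows "power_ideal (a(y := n)) Y = adjoin (power_ideal a (Y - {y})) (y [^] n)"
  using power_ideal_split[OF assms, of "a(y := n)"] power_ideal_upd by simp

lemma power_ideal_one:
  assumes "Y \<subseteq> carrier R" "\<And>y. y \<in> Y \<Longrightarrow> a y = 1"
  shows "power_ideal a Y = Idl Y"
proof -
  have "(\<lambda>y. y [^] a y) ` Y = Y" using assms by (force simp: subset_iff)
  then show ?thesis unfolding power_ideal_def by simp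
qed

lemma sum_upd_less:
  assumes "finite Y" "y \<in> Y" "n < (a y :: nat)"
  shows "sum (a(y := n)) Y < sum a Y"
  using assms by (intro sum_strict_mono_ex1) auto

text \<open>If all exponents are 1, the ideal is locally prime and does not contain y. Otherwise one
  exponent is lowered and \<open>regular_mod_Suc\<close> restores it.\<close>

lemma regular_system_regular_mod:
  assumes reg: "regular_system Q Y"
  shows "Z \<subseteq> Y \<Longrightarrow> (\<And>z. z \<in> Z \<Longrightarrow> a z \<ge> 1) \<Longrightarrow> y \<in> Y \<Longrightarrow> y \<notin> Z \<Longrightarrow> regular_mod Q (power_ideal a Z) y"
proof (induction "sum a Z" arbitrary: a Z y rule: less_induct)
  case less
  have Q: "primeideal Q R" and Y: "finite Y" "Y \<subseteq> Q" using reg unfolding regular_system_def by blast+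
  have Yc: "Y \<subseteq> carrier R" using Y ideal_subset[OF prime_ideal[OF Q]] by blast
  have Zc: "Z \<subseteq> carrier R" and fZ: "finite Z" using Yc less.prems(1) Y finite_subset by blast+
  have yc: "y \<in> carrier R" using Yc less.prems by blast
  show ?case
  proof (cases "\<forall>z\<in>Z. a z = 1")
    case True
    then have e: "power_ideal a Z = Idl Z" using Zc by (intro power_ideal_one) auto
    show ?thesis unfolding regular_mod_def e
      using prime_mult_iff[OF regular_system_prime[OF reg less.prems(1)] yc] regular_system_notin[OF reg less.prems(1,3,4)]
      by blast
  next
    case False
    then obtain z where z: "z \<in> Z" "a z \<noteq> 1" by blast
    define n where "n = a z - 1"
    have n: "a z = Suc n" "n \<ge> 1" using z less.prems(2)[OF z(1)] unfolding n_def by auto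
    have zc: "z \<in> carrier R" using z Zc by blast
    let ?K = "power_ideal a (Z - {z})"
    have K: "ideal ?K R" using Zc by (intro ideal_power_ideal) auto
    have 1: "regular_mod Q (power_ideal (a(z := n)) Z) y"
      using less.prems n z fZ by (intro less.hyps sum_upd_less) auto
    have 2: "regular_mod Q (power_ideal (a(z := 1)) Z) y"
      using less.prems n z fZ by (intro less.hyps sum_upd_less) auto
    \<comment> \<open>Dropping z altogether also lowers the sum, so the induction covers z itself in
      the role of y.\<close>
    have lt: "sum a (Z - {z}) < sum a Z" using z n fZ by (simp add: sum.remove)
    have 3: "regular_mod Q ?K z"
      using less.prems z by (intro less.hyps lt) auto
    have "regular_mod Q (adjoin ?K (z [^] Suc n)) y"
      using 1 2 3 power_ideal_split_upd[OF Zc z(1)] zc by (intro regular_mod_Suc[OF Q K yc zc]) auto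
    then show ?thesis using power_ideal_split[OF Zc z(1), of a] n by simp
  qed
qed

text \<open>For a regular system this generates the socle of the local ring modulo
  \<open>power_ideal a Y\<close>.\<close>

definition top_monomial :: "('a \<Rightarrow> nat) \<Rightarrow> 'a set \<Rightarrow> 'a" where
  "top_monomial a Y = finprod R (\<lambda>y. y [^] (a y - 1)) Y"

lemma top_monomial_closed: "Y \<subseteq> carrier R \<Longrightarrow> top_monomial a Y \<in> carrier R"
  unfolding top_monomial_def by (intro finprod_closed) auto

lemma top_monomial_one:
  "Y \<subseteq> carrier R \<Longrightarrow> (\<And>y. y \<in> Y \<Longrightarrow> a y = 1) \<Longrightarrow> top_monomial a Y = \<one>"
  unfolding top_monomial_def by (intro finprod_one_eqI) auto

lemma top_monomial_split:
  assumes "Y \<subseteq> carrier R" "finite Y" "y \<in> Y"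
  shows "top_monomial a Y = y [^] (a y - 1) \<otimes> top_monomial a (Y - {y})"
proof -
  have e: "insert y (Y - {y}) = Y" using assms by blast
  have "finprod R (\<lambda>y. y [^] (a y - 1)) (insert y (Y - {y})) = y [^] (a y - 1) \<otimes> finprod R (\<lambda>y. y [^] (a y - 1)) (Y - {y})"
    using assms by (intro finprod_insert) auto
  then show ?thesis unfolding top_monomial_def e .
qed

lemma top_monomial_upd:
  assumes "Y \<subseteq> carrier R"
  shows "top_monomial (a(y := n)) (Y - {y}) = top_monomial a (Y - {y})"
  unfolding top_monomial_def using assms by (intro finprod_cong') auto

lemma top_monomial_split_upd:
  assumes "Y \<subseteq> carrier R" "finite Y" "y \<in> Y"
  shows "top_monomial (a(y := n)) Y = y [^] (n - 1) \<otimes> top_monomial a (Y - {y})"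
  using top_monomial_split[OF assms, of "a(y := n)"] top_monomial_upd[OF assms(1)] by simp

text \<open>Induction on the sum of the exponents: if the monomial were in the ideal, one factor y
  could be cancelled, being regular modulo the other powers, and the same would hold with the
  exponent of y lowered by one. The base case is that 1 is not in \<open>Q\<close>.\<close>

lemma top_monomial_notin:
  assumes reg: "regular_system Q Y"
  shows "(\<And>y. y \<in> Y \<Longrightarrow> a y \<ge> 1) \<Longrightarrow> top_monomial a Y \<notin> sat Q (power_ideal a Y)"
proof (induction "sum a Y" arbitrary: a rule: less_induct)
  case less
  have Q: "primeideal Q R" and Y: "finite Y" "Y \<subseteq> Q" using reg unfolding regular_system_def by blast+
  have Yc: "Y \<subseteq> carrier R" using Y ideal_subset[OF prime_ideal[OF Q]] by blast
  show ?case
  proof (cases "\<forall>y\<in>Y. a y = 1")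
    case True
    then have "top_monomial a Y = \<one>" "power_ideal a Y = Idl Y"
      using Yc by (simp_all add: top_monomial_one power_ideal_one)
    moreover have "sat Q (Idl Y) \<subseteq> Q" using Q Y by (intro sat_Idl_least) auto
    ultimately show ?thesis using prime_one[OF Q] by auto
  next
    case False
    then obtain y where y: "y \<in> Y" "a y \<noteq> 1" by blast
    \<comment> \<open>Exponents here are at least 2; with a y = m + 2 the monomial contains
      y^(m+1).\<close>
    define m where "m = a y - 2"
    have n: "a y = Suc (Suc m)" using y less.prems[OF y(1)] unfolding m_def by auto
    have yc: "y \<in> carrier R" using y Yc by blast
    let ?K = "power_ideal a (Y - {y})" and ?w = "top_monomial a (Y - {y})"
    have K: "ideal ?K R" using Yc by (intro ideal_power_ideal) auto
    have wc: "?w \<in> carrier R" using Yc by (intro top_monomial_closed) auto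
    have pc: "y [^] m \<in> carrier R" "y [^] Suc m \<in> carrier R" using yc by auto
    have IH: "y [^] m \<otimes> ?w \<notin> sat Q (adjoin ?K (y [^] Suc m))"
      using less.hyps[of "a(y := Suc m)"] sum_upd_less[OF Y(1) y(1), of "Suc m" a] less.prems n
        top_monomial_split_upd[OF Yc Y(1) y(1)] power_ideal_split_upd[OF Yc y(1)] by auto
    have regy: "regular_mod Q ?K y"
      using less.prems y by (intro regular_system_regular_mod[OF reg]) auto
    show ?thesis
    proof
      assume "top_monomial a Y \<in> sat Q (power_ideal a Y)"
      then have "y [^] Suc m \<otimes> ?w \<in> sat Q (adjoin ?K (y [^] Suc (Suc m)))"
        using top_monomial_split[OF Yc Y(1) y(1), of a] power_ideal_split[OF Yc y(1), of a] n by simp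
      then obtain t k c where t: "t \<in> carrier R" "t \<notin> Q" and k: "k \<in> ?K" "c \<in> carrier R" "t \<otimes> (y [^] Suc m \<otimes> ?w) = k \<oplus> c \<otimes> y [^] Suc (Suc m)"
        by (rule sat_adjoinE)
      have kc: "k \<in> carrier R" using k ideal_carrier[OF K] by blast
      have e: "t \<otimes> ((y [^] m \<otimes> y) \<otimes> ?w) = k \<oplus> c \<otimes> (y [^] m \<otimes> y \<otimes> y)" using k(3) by simp
      have "y \<otimes> (t \<otimes> (y [^] m \<otimes> ?w) \<ominus> c \<otimes> (y [^] m \<otimes> y)) = t \<otimes> ((y [^] m \<otimes> y) \<otimes> ?w) \<ominus> c \<otimes> (y [^] m \<otimes> y \<otimes> y)"
        using yc t(1) pc(1) wc k(2) by algebra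
      also have "\<dots> = k" unfolding e using kc k(2) pc(1) yc by algebra
      finally have "y \<otimes> (t \<otimes> (y [^] m \<otimes> ?w) \<ominus> c \<otimes> (y [^] m \<otimes> y)) \<in> sat Q ?K"
        using k subset_sat[OF Q ideal_subset[OF K]] by auto
      then have "t \<otimes> (y [^] m \<otimes> ?w) \<ominus> c \<otimes> (y [^] m \<otimes> y) \<in> sat Q ?K"
        using yc t(1) wc pc(1) k(2) by - (rule regular_modD[OF regy]; simp)
      then have 1: "t \<otimes> (y [^] m \<otimes> ?w) \<ominus> c \<otimes> (y [^] m \<otimes> y) \<in> sat Q (adjoin ?K (y [^] Suc m))"
        using sat_mono[OF subset_adjoin[OF ideal_subset[OF K] pc(2)]] by blast
      have iS: "ideal (sat Q (adjoin ?K (y [^] Suc m))) R" by (intro ideal_sat Q ideal_adjoin K pc)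
      have 2: "c \<otimes> (y [^] m \<otimes> y) \<in> sat Q (adjoin ?K (y [^] Suc m))"
        using ideal_mult[OF iS adjoin_sat_subset(3)[OF Q K pc(2)] k(2)] by simp
      have "t \<otimes> (y [^] m \<otimes> ?w) \<in> sat Q (adjoin ?K (y [^] Suc m))"
        using t(1) pc wc by - (rule ideal_diff_cancel[OF iS 1 2]; simp)
      then have "y [^] m \<otimes> ?w \<in> sat Q (adjoin ?K (y [^] Suc m))"
        using t(1,2) pc(1) wc by - (rule sat_cancel[OF Q, of t]; simp)
      then show False using IH by blast
    qed
  qed
qed

text \<open>The socle is essential and spanned by the top monomial. The induction lowers the
  exponent m + 2 of one y, to m + 1 or to 1 according to whether w survives modulo y^(m+1) and the
  other powers.\<close>

lemma multiple_top_monomial: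
  assumes Q: "primeideal Q R" and Y: "finite Y" "Y \<subseteq> Q" "Q \<subseteq> sat Q (Idl Y)"
  shows "(\<And>y. y \<in> Y \<Longrightarrow> a y \<ge> 1) \<Longrightarrow> w \<in> carrier R \<Longrightarrow> w \<notin> sat Q (power_ideal a Y) \<Longrightarrow>
    \<exists>v c. v \<in> carrier R \<and> c \<in> carrier R \<and> c \<notin> Q \<and> v \<otimes> w \<ominus> c \<otimes> top_monomial a Y \<in> sat Q (power_ideal a Y)"
proof (induction "sum a Y" arbitrary: a w rule: less_induct)
  case less
  have Yc: "Y \<subseteq> carrier R" using Y ideal_subset[OF prime_ideal[OF Q]] by blast
  have iM: "ideal (sat Q (power_ideal a Y)) R" by (intro ideal_sat Q ideal_power_ideal Yc)
  show ?case
  proof (cases "\<forall>y\<in>Y. a y = 1")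
    case True
    then have e: "top_monomial a Y = \<one>" "power_ideal a Y = Idl Y"
      using Yc by (simp_all add: top_monomial_one power_ideal_one)
    \<comment> \<open>The ideal is locally \<open>Q\<close> and the monomial is 1, so w is itself
      invertible at \<open>Q\<close>: take v = 1 and c = w.\<close>
    have "w \<notin> Q" using less.prems Y unfolding e by blast
    moreover have "\<one> \<otimes> w \<ominus> w \<otimes> top_monomial a Y \<in> sat Q (power_ideal a Y)"
      unfolding e using less.prems(2) ideal_zero[OF iM] e by (simp add: r_neg minus_eq)
    ultimately show ?thesis using less.prems(2) one_closed by blast
  next
    case False
    then obtain y where y: "y \<in> Y" "a y \<noteq> 1" by blast
    define m where "m = a y - 2"
    have n: "a y = Suc (Suc m)" using y less.prems(1)[OF y(1)] unfolding m_def by auto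
    have yc: "y \<in> carrier R" using y Yc by blast
    let ?K = "power_ideal a (Y - {y})" and ?w = "top_monomial a (Y - {y})"
    have K: "ideal ?K R" using Yc by (intro ideal_power_ideal) auto
    have wc: "?w \<in> carrier R" using Yc by (intro top_monomial_closed) auto
    have pc: "y [^] m \<in> carrier R" "y [^] Suc m \<in> carrier R" "y [^] Suc (Suc m) \<in> carrier R" using yc by auto
    have top: "top_monomial a Y = y [^] Suc m \<otimes> ?w" using top_monomial_split[OF Yc Y(1) y(1), of a] n by simp
    have pid: "power_ideal a Y = adjoin ?K (y [^] Suc (Suc m))" using power_ideal_split[OF Yc y(1), of a] n by simp
    define M where "M = sat Q (power_ideal a Y)"
    have iM: "ideal M R" using iM M_def by simp
    have KM: "?K \<subseteq> M" "y [^] Suc (Suc m) \<in> M" unfolding M_def pid using adjoin_sat_subset[OF Q K pc(3)] by auto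
    \<comment> \<open>Multiplication by r maps the ideal of the other powers and z into M once it
      maps z there; this is used to lift relations to the full exponent.\<close>
    have mul: "r \<otimes> s \<in> M" if rs: "r \<in> carrier R" "s \<in> sat Q (adjoin ?K z)" "z \<in> carrier R" "r \<otimes> z \<in> M" for r s z
    proof -
      have "adjoin ?K z \<subseteq> colon M r"
      proof (intro adjoin_least ideal_colon iM rs)
        show "?K \<subseteq> colon M r" using KM(1) ideal_mult[OF iM _ rs(1)] ideal_carrier[OF K] by (auto intro!: colonI)
        show "z \<in> colon M r" using rs by (intro colonI)
      qed
      moreover obtain t where t: "t \<in> carrier R" "t \<notin> Q" "t \<otimes> s \<in> adjoin ?K z" "s \<in> carrier R" using rs(2) by (rule satE)
      ultimately have "r \<otimes> (t \<otimes> s) \<in> M" using colonD by blast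
      moreover have "r \<otimes> (t \<otimes> s) = t \<otimes> (r \<otimes> s)" using rs(1) t(1,4) by algebra
      ultimately show ?thesis using sat_cancel[OF Q t(1,2), of "r \<otimes> s"] rs t unfolding M_def by auto
    qed
    have wM: "w \<in> carrier R" "w \<notin> M" using less.prems M_def by auto
    show ?thesis
    proof (cases "w \<in> sat Q (adjoin ?K (y [^] Suc m))")
      case False
      \<comment> \<open>Multiplying the relation for exponent m + 1 by y raises both its monomial
        and its ideal to exponent m + 2.\<close>
      have "\<exists>v c. v \<in> carrier R \<and> c \<in> carrier R \<and> c \<notin> Q \<and>
          v \<otimes> w \<ominus> c \<otimes> top_monomial (a(y := Suc m)) Y \<in> sat Q (power_ideal (a(y := Suc m)) Y)"
        using less.prems n y False power_ideal_split_upd[OF Yc y(1)]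
        by (intro less.hyps sum_upd_less Y) auto
      then obtain v c where v: "v \<in> carrier R" "c \<in> carrier R" "c \<notin> Q"
          "v \<otimes> w \<ominus> c \<otimes> (y [^] m \<otimes> ?w) \<in> sat Q (adjoin ?K (y [^] Suc m))"
        using power_ideal_split_upd[OF Yc y(1), of a "Suc m"] top_monomial_split_upd[OF Yc Y(1) y(1), of a "Suc m"] by auto
      have "y \<otimes> y [^] Suc m = y [^] Suc (Suc m)" using m_comm[OF yc pc(2)] by simp
      then have "y \<otimes> (v \<otimes> w \<ominus> c \<otimes> (y [^] m \<otimes> ?w)) \<in> M" using KM(2) by - (rule mul[OF yc v(4) pc(2)]; simp)
      moreover have "y \<otimes> (v \<otimes> w \<ominus> c \<otimes> (y [^] m \<otimes> ?w)) = (y \<otimes> v) \<otimes> w \<ominus> c \<otimes> ((y [^] m \<otimes> y) \<otimes> ?w)"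
        using yc v(1,2) wM(1) pc(1) wc by algebra
      ultimately have "(y \<otimes> v) \<otimes> w \<ominus> c \<otimes> top_monomial a Y \<in> M" unfolding top by simp
      then show ?thesis unfolding M_def[symmetric] using v(1-3) yc by blast
    next
      case True
      then obtain t k r where t: "t \<in> carrier R" "t \<notin> Q" and k: "k \<in> ?K" "r \<in> carrier R" "t \<otimes> w = k \<oplus> r \<otimes> y [^] Suc m"
        by (rule sat_adjoinE)
      have kc: "k \<in> carrier R" using k ideal_carrier[OF K] by blast
      \<comment> \<open>If r were there, y^(m+1) r and hence w would be in M. So the case of
        exponent 1 applies to r, and multiplying by y^(m+1) leads back to w.\<close>
      have "r \<notin> sat Q (adjoin ?K y)"
      proof
        assume "r \<in> sat Q (adjoin ?K y)"
        then have "y [^] Suc m \<otimes> r \<in> M" using KM(2) by - (rule mul[OF pc(2) _ yc]; simp)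
        then have "r \<otimes> y [^] Suc m \<in> M" using m_comm[OF k(2) pc(2)] by simp
        then have "t \<otimes> w \<in> M" unfolding k(3) using k(1) KM(1) ideal_add[OF iM] by blast
        then show False using sat_cancel[OF Q t(1,2) wM(1)] wM unfolding M_def by blast
      qed
      then have "\<exists>v c. v \<in> carrier R \<and> c \<in> carrier R \<and> c \<notin> Q \<and>
          v \<otimes> r \<ominus> c \<otimes> top_monomial (a(y := 1)) Y \<in> sat Q (power_ideal (a(y := 1)) Y)"
        using less.prems(1) n y k power_ideal_split_upd[OF Yc y(1)] yc
        by (intro less.hyps sum_upd_less Y) auto
      then obtain v c where v: "v \<in> carrier R" "c \<in> carrier R" "c \<notin> Q" "v \<otimes> r \<ominus> c \<otimes> ?w \<in> sat Q (adjoin ?K y)"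
        using power_ideal_split_upd[OF Yc y(1), of a 1] top_monomial_split_upd[OF Yc Y(1) y(1), of a 1] yc wc by auto
      have 1: "y [^] Suc m \<otimes> (v \<otimes> r \<ominus> c \<otimes> ?w) \<in> M" using KM(2) by - (rule mul[OF pc(2) v(4) yc]; simp)
      have 2: "(v \<otimes> t) \<otimes> w \<ominus> c \<otimes> (y [^] Suc m \<otimes> ?w) = v \<otimes> k \<oplus> y [^] Suc m \<otimes> (v \<otimes> r \<ominus> c \<otimes> ?w)"
      proof -
        have "(v \<otimes> t) \<otimes> w \<ominus> c \<otimes> (y [^] Suc m \<otimes> ?w) = v \<otimes> (t \<otimes> w) \<ominus> c \<otimes> (y [^] Suc m \<otimes> ?w)"
          using v t wM by (simp add: m_assoc)
        also have "\<dots> = v \<otimes> k \<oplus> y [^] Suc m \<otimes> (v \<otimes> r \<ominus> c \<otimes> ?w)"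
          unfolding k(3) using kc v(1,2) k(2) pc(2) wc by algebra
        finally show ?thesis .
      qed
      have "v \<otimes> k \<in> M" using ideal_mult[OF iM] k(1) KM(1) v(1) by blast
      then have "(v \<otimes> t) \<otimes> w \<ominus> c \<otimes> top_monomial a Y \<in> M" unfolding top 2 by (intro ideal_add[OF iM] 1)
      then show ?thesis unfolding M_def[symmetric] using v(1-3) t(1) by blast
    qed
  qed
qed

end

section \<open>Annihilator duality\<close>

context noetherian_cring
begin

text \<open>The length of the local ring modulo \<open>K\<close>, provided some chain exists. The
  least number is taken because a simple step may be trivial, with u already in
  \<open>K\<close>.\<close>

definition step_length :: "'a set \<Rightarrow> 'a set \<Rightarrow> nat" where
  "step_length Q K = (LEAST n. (simple_step Q ^^ n) K (carrier R))"

lemma step_length_le: "(simple_step Q ^^ n) K (carrier R) \<Longrightarrow> step_length Q K \<le> n"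
  unfolding step_length_def by (rule Least_le)

lemma step_length_attained:
  "(simple_step Q)\<^sup>*\<^sup>* K (carrier R) \<Longrightarrow> (simple_step Q ^^ step_length Q K) K (carrier R)"
  unfolding step_length_def using rtranclp_imp_relpowp LeastI_ex by metis

lemma step_length_step:
  assumes "simple_step Q K L" "(simple_step Q)\<^sup>*\<^sup>* L (carrier R)"
  shows "step_length Q K \<le> Suc (step_length Q L)"
  using assms step_length_attained relpowp_Suc_I2 step_length_le by metis

lemma step_length_strict:
  assumes "primeideal Q R" "(simple_step Q)\<^sup>*\<^sup>* K (carrier R)" "closed_at Q L" "K \<subset> L"
  shows "step_length Q L < step_length Q K"
  using simple_steps_mono[OF assms(1) step_length_attained[OF assms(2)] assms(3,4)] step_length_le by fastforce

definition annihilator :: "'a set \<Rightarrow> 'a set \<Rightarrow> 'a set" where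
  "annihilator M K = {w \<in> carrier R. \<forall>k\<in>K. w \<otimes> k \<in> M}"

lemma ideal_annihilator:
  assumes M: "ideal M R" and K: "K \<subseteq> carrier R"
  shows "ideal (annihilator M K) R"
proof (rule ideal_intro)
  show "annihilator M K \<subseteq> carrier R" unfolding annihilator_def by blast
  show "\<zero> \<in> annihilator M K" unfolding annihilator_def using K ideal_zero[OF M] by (simp add: subset_iff)
  fix a b assume a: "a \<in> annihilator M K"
  then have ac: "a \<in> carrier R" and ak: "\<And>k. k \<in> K \<Longrightarrow> a \<otimes> k \<in> M" unfolding annihilator_def by blast+
  { assume "b \<in> annihilator M K"
    then have bc: "b \<in> carrier R" and bk: "\<And>k. k \<in> K \<Longrightarrow> b \<otimes> k \<in> M" unfolding annihilator_def by blast+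
    have "(a \<oplus> b) \<otimes> k \<in> M" if "k \<in> K" for k
      using l_distr[OF ac bc, of k] ideal_add[OF M ak[OF that] bk[OF that]] that K by auto
    then show "a \<oplus> b \<in> annihilator M K" unfolding annihilator_def using ac bc by blast }
  { assume bc: "b \<in> carrier R"
    have "(b \<otimes> a) \<otimes> k \<in> M" if "k \<in> K" for k
      using m_assoc[OF bc ac, of k] ideal_mult[OF M ak[OF that] bc] that K by auto
    then show "b \<otimes> a \<in> annihilator M K" unfolding annihilator_def using ac bc by blast }
qed

lemma closed_annihilator:
  assumes Q: "primeideal Q R" and M: "closed_at Q M" and K: "K \<subseteq> carrier R"
  shows "closed_at Q (annihilator M K)"
proof -
  have iM: "ideal M R" "sat Q M = M" using M closed_at_def by blast+
  have iA: "ideal (annihilator M K) R" by (rule ideal_annihilator[OF iM(1) K])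
  have "sat Q (annihilator M K) \<subseteq> annihilator M K"
  proof
    fix w assume "w \<in> sat Q (annihilator M K)"
    then obtain t where t: "t \<in> carrier R" "t \<notin> Q" "t \<otimes> w \<in> annihilator M K" "w \<in> carrier R" by (rule satE)
    have "w \<otimes> k \<in> M" if k: "k \<in> K" for k
    proof -
      have kc: "k \<in> carrier R" using k K by blast
      have "(t \<otimes> w) \<otimes> k \<in> M" using t k unfolding annihilator_def by blast
      then have "t \<otimes> (w \<otimes> k) \<in> sat Q M" using m_assoc[OF t(1,4) kc] iM by simp
      then show ?thesis using sat_cancel[OF Q t(1,2) m_closed[OF t(4) kc]] iM by blast
    qed
    then show "w \<in> annihilator M K" unfolding annihilator_def using t by blast
  qed
  then show ?thesis unfolding closed_at_def using iA subset_sat[OF Q ideal_subset[OF iA]] by blast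
qed

text \<open>
  Locally at \<open>Q\<close>, every nonzero element of \<open>R / M\<close> has a unit multiple of \<open>s\<close> among its multiples: the
  quotient is Gorenstein of dimension 0, whence taking annihilators is strictly decreasing.
\<close>

lemma annihilator_simple_step:
  assumes Q: "primeideal Q R" and M: "closed_at Q M"
    and s: "s \<in> carrier R" "s \<notin> M"
    and soc: "\<And>w. w \<in> carrier R \<Longrightarrow> w \<notin> M \<Longrightarrow>
      \<exists>v c. v \<in> carrier R \<and> c \<in> carrier R \<and> c \<notin> Q \<and> v \<otimes> w \<ominus> c \<otimes> s \<in> M"
    and K: "closed_at Q K" and u: "u \<in> carrier R" "\<And>q. q \<in> Q \<Longrightarrow> q \<otimes> u \<in> K" "L = sat Q (adjoin K u)"
    and w: "w \<in> annihilator M K" "w \<notin> annihilator M L"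
  shows "w \<otimes> u \<notin> M" "simple_step Q (annihilator M L) (annihilator M K)"
proof -
  have iM: "ideal M R" "sat Q M = M" using M closed_at_def by blast+
  have iK: "ideal K R" using K closed_at_def by blast
  have Lc: "L \<subseteq> carrier R" unfolding u by (rule sat_carrier)
  have Kc: "K \<subseteq> carrier R" using iK by (rule ideal_subset)
  let ?A = "annihilator M L" and ?B = "annihilator M K"
  have cA: "closed_at Q ?A" and cB: "closed_at Q ?B" using closed_annihilator[OF Q M] Lc Kc by blast+
  have iA: "ideal ?A R" and iB: "ideal ?B R" using cA cB closed_at_def by blast+
  have KL: "K \<subseteq> L" unfolding u using adjoin_sat_subset[OF Q iK u(1)] by blast
  have AB: "?A \<subseteq> ?B" unfolding annihilator_def using KL by blast
  have mem: "x \<in> ?A" if x: "x \<in> ?B" "x \<otimes> u \<in> M" for x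
  proof -
    have xc: "x \<in> carrier R" using x iB ideal_carrier by blast
    have "adjoin K u \<subseteq> colon M x"
    proof (rule adjoin_least[OF ideal_colon[OF iM(1) xc]])
      show "K \<subseteq> colon M x" using x(1) Kc unfolding annihilator_def colon_def by blast
      show "u \<in> colon M x" using x u by (intro colonI)
    qed
    then have "L \<subseteq> sat Q (colon M x)" unfolding u by (rule sat_mono)
    moreover have "sat Q (colon M x) \<subseteq> colon M x"
    proof
      fix z assume "z \<in> sat Q (colon M x)"
      then obtain t where t: "t \<in> carrier R" "t \<notin> Q" "t \<otimes> z \<in> colon M x" "z \<in> carrier R" by (rule satE)
      have "t \<otimes> (x \<otimes> z) = x \<otimes> (t \<otimes> z)" using t(1,4) xc by algebra
      then have "t \<otimes> (x \<otimes> z) \<in> sat Q M" using colonD(1)[OF t(3)] iM by simp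
      then have "x \<otimes> z \<in> M" using sat_cancel[OF Q t(1,2) m_closed[OF xc t(4)]] iM by blast
      then show "z \<in> colon M x" using t by (intro colonI)
    qed
    ultimately show ?thesis unfolding annihilator_def using xc colonD by blast
  qed
  show wu: "w \<otimes> u \<notin> M" using mem w by blast
  have wc: "w \<in> carrier R" using w iB ideal_carrier by blast
  have killed: "q \<otimes> (x \<otimes> u) \<in> M" if "q \<in> Q" "x \<in> ?B" for q x
  proof -
    have c: "q \<in> carrier R" "x \<in> carrier R" using that ideal_carrier[OF prime_ideal[OF Q]] ideal_carrier[OF iB] by auto
    have "q \<otimes> (x \<otimes> u) = x \<otimes> (q \<otimes> u)" using c u(1) by algebra
    then show ?thesis using that u(2) unfolding annihilator_def by auto
  qed
  have 1: "q \<otimes> w \<in> ?A" if q: "q \<in> Q" for q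
  proof (rule mem)
    have qc: "q \<in> carrier R" using q ideal_carrier[OF prime_ideal[OF Q]] by blast
    show "q \<otimes> w \<in> ?B" using ideal_mult[OF iB w(1) qc] .
    show "(q \<otimes> w) \<otimes> u \<in> M" using killed[OF q w(1)] m_assoc[OF qc wc u(1)] by simp
  qed
  have 2: "?B \<subseteq> sat Q (adjoin ?A w)"
  proof
    fix x assume x: "x \<in> ?B"
    have xc: "x \<in> carrier R" using x iB ideal_carrier by blast
    show "x \<in> sat Q (adjoin ?A w)"
    proof (cases "x \<otimes> u \<in> M")
      case True
      then show ?thesis using mem[OF x] adjoin_sat_subset(2)[OF Q iA wc] by blast
    next
      case False
      obtain v c where v: "v \<in> carrier R" "c \<in> carrier R" "c \<notin> Q" "v \<otimes> (w \<otimes> u) \<ominus> c \<otimes> s \<in> M"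
        using soc[OF m_closed[OF wc u(1)] wu] by blast
      obtain v' c' where v': "v' \<in> carrier R" "c' \<in> carrier R" "c' \<notin> Q" "v' \<otimes> (x \<otimes> u) \<ominus> c' \<otimes> s \<in> M"
        using soc[OF m_closed[OF xc u(1)] False] by blast
      \<comment> \<open>\<open>Q\<close> kills x u modulo \<open>M\<close>, but c' s is not in
        \<open>M\<close>. So v' is invertible at \<open>Q\<close>, and a multiple of x minus a
        multiple of w kills u: modulo the smaller annihilator, w generates the larger one.\<close>
      have "v' \<notin> Q"
      proof
        assume "v' \<in> Q"
        then have "v' \<otimes> (x \<otimes> u) \<in> M" using killed x by blast
        then have "c' \<otimes> s \<in> sat Q M" using ideal_diff_cancel2[OF iM(1) v'(4)] v' s iM by simp
        then show False using sat_cancel[OF Q v'(2,3) s(1)] iM s by blast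
      qed
      then have cv: "c \<otimes> v' \<in> carrier R" "c \<otimes> v' \<notin> Q" using prime_mult_iff[OF Q v(2) v'(1)] v v' by auto
      have e: "((c \<otimes> v') \<otimes> x \<ominus> (c' \<otimes> v) \<otimes> w) \<otimes> u
          = c \<otimes> (v' \<otimes> (x \<otimes> u) \<ominus> c' \<otimes> s) \<ominus> c' \<otimes> (v \<otimes> (w \<otimes> u) \<ominus> c \<otimes> s)"
        using v(1,2) v'(1,2) xc wc u(1) s(1) by algebra
      have "(c \<otimes> v') \<otimes> x \<ominus> (c' \<otimes> v) \<otimes> w \<in> ?A"
      proof (rule mem)
        show "(c \<otimes> v') \<otimes> x \<ominus> (c' \<otimes> v) \<otimes> w \<in> ?B"
          using v(1,2) v'(1,2) x w(1) by (intro ideal_diff[OF iB] ideal_mult[OF iB]) simp_all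
        show "((c \<otimes> v') \<otimes> x \<ominus> (c' \<otimes> v) \<otimes> w) \<otimes> u \<in> M"
          unfolding e by (rule ideal_diff[OF iM(1) ideal_mult[OF iM(1) v'(4) v(2)] ideal_mult[OF iM(1) v(4) v'(2)]])
      qed
      then have "((c \<otimes> v') \<otimes> x \<ominus> (c' \<otimes> v) \<otimes> w) \<oplus> (c' \<otimes> v) \<otimes> w \<in> adjoin ?A w"
        using v(1) v'(2) by (intro adjoinI) simp_all
      moreover have "((c \<otimes> v') \<otimes> x \<ominus> (c' \<otimes> v) \<otimes> w) \<oplus> (c' \<otimes> v) \<otimes> w = (c \<otimes> v') \<otimes> x"
        using v(1,2) v'(1,2) xc wc by algebra
      ultimately show ?thesis using satI[OF cv _ xc] by simp
    qed
  qed
  have "?B = sat Q (adjoin ?A w)"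
    using 2 sat_adjoin_least[OF cB AB w(1)] by blast
  then show "simple_step Q ?A ?B" unfolding simple_step_def using cA wc 1 by blast
qed

text \<open>The double annihilator property. The length above an ideal plus the length above its
  annihilator cannot grow along a chain from \<open>M\<close> to the whole ring, and it has the same
  value at both ends. So a proper enlargement of \<open>I\<close> by u must shrink the
  annihilator.\<close>

lemma annihilator_separates:
  assumes Q: "primeideal Q R" and M: "closed_at Q M"
    and only: "\<And>P. primeideal P R \<Longrightarrow> M \<subseteq> P \<Longrightarrow> P \<subseteq> Q \<Longrightarrow> P = Q"
    and s: "s \<in> carrier R" "s \<notin> M"
    and soc: "\<And>w. w \<in> carrier R \<Longrightarrow> w \<notin> M \<Longrightarrow>
      \<exists>v c. v \<in> carrier R \<and> c \<in> carrier R \<and> c \<notin> Q \<and> v \<otimes> w \<ominus> c \<otimes> s \<in> M"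
    and I: "closed_at Q I" "M \<subseteq> I" and u: "u \<in> carrier R" "u \<notin> I" "\<And>q. q \<in> Q \<Longrightarrow> q \<otimes> u \<in> I"
  shows "\<exists>w \<in> annihilator M I. w \<otimes> u \<notin> M"
proof -
  have iM: "ideal M R" "sat Q M = M" using M closed_at_def by blast+
  let ?A = "annihilator M" and ?l = "step_length Q"
  have cC: "closed_at Q (carrier R)" by (rule closed_at_carrier[OF Q])
  have steps: "(simple_step Q)\<^sup>*\<^sup>* K L" if "closed_at Q K" "closed_at Q L" "M \<subseteq> K" "K \<subseteq> L" for K L
    using that only by (intro simple_steps_exist[OF Q]) auto
  have carr: "K \<subseteq> carrier R" if "closed_at Q K" for K using that ideal_subset closed_at_def by blast
  have steps_top: "(simple_step Q)\<^sup>*\<^sup>* K (carrier R)" if "closed_at Q K" "M \<subseteq> K" for K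
    using steps[OF that(1) cC that(2)] carr that by blast
  have cA: "closed_at Q (?A K)" if "closed_at Q K" for K using closed_annihilator[OF Q M] carr that by blast
  have MA: "M \<subseteq> ?A K" if "closed_at Q K" for K
    unfolding annihilator_def using ideal_mult'[OF iM(1)] ideal_carrier[OF iM(1)] carr[OF that] by blast
  \<comment> \<open>A proper step lowers the length above the ideal by at least one and raises the
    length above its annihilator by at most one.\<close>
  have step: "?l (?A L) + ?l L \<le> ?l (?A K) + ?l K" if st: "simple_step Q K L" and MK: "M \<subseteq> K" for K L
  proof (cases "K = L")
    case False
    have cK: "closed_at Q K" using st simple_step_def by blast
    have cL: "closed_at Q L" using st simple_step_closed Q by blast
    have KL: "K \<subset> L" using simple_step_subset[OF Q st] False by blast
    have 1: "?l L < ?l K" using step_length_strict[OF Q steps_top[OF cK MK] cL KL] .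
    have AA: "?A L \<subseteq> ?A K" unfolding annihilator_def using KL by blast
    have "?l (?A L) \<le> Suc (?l (?A K))"
    proof (cases "?A L = ?A K")
      case False
      then obtain w where w: "w \<in> ?A K" "w \<notin> ?A L" using AA by blast
      obtain u where u: "u \<in> carrier R" "\<And>q. q \<in> Q \<Longrightarrow> q \<otimes> u \<in> K" "L = sat Q (adjoin K u)"
        using st unfolding simple_step_def by blast
      have "simple_step Q (?A L) (?A K)" by (rule annihilator_simple_step(2)[OF Q M s soc cK u w])
      then show ?thesis by (rule step_length_step[OF _ steps_top[OF cA[OF cK] MA[OF cK]]])
    qed simp
    then show ?thesis using 1 by simp
  qed simp
  have mono: "?l (?A L) + ?l L \<le> ?l (?A K) + ?l K \<and> M \<subseteq> L" if "(simple_step Q)\<^sup>*\<^sup>* K L" "M \<subseteq> K" for K L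
    using that
  proof (induction rule: rtranclp_induct)
    case (step y z)
    then show ?case using simple_step_subset[OF Q step(2)] \<open>\<And>L K. simple_step Q K L \<Longrightarrow> M \<subseteq> K \<Longrightarrow> _ K L\<close> by fastforce
  qed simp
  let ?I' = "sat Q (adjoin I u)"
  have st: "simple_step Q I ?I'" unfolding simple_step_def using I u by blast
  have cI': "closed_at Q ?I'" using st simple_step_closed Q by blast
  have II': "I \<subseteq> ?I'" using simple_step_subset[OF Q st] .
  have iI: "ideal I R" using I closed_at_def by blast
  have uI': "u \<in> ?I'" using adjoin_sat_subset(3)[OF Q iI u(1)] .
  have AC: "?A (carrier R) = M"
  proof
    show "?A (carrier R) \<subseteq> M"
    proof
      fix w assume "w \<in> ?A (carrier R)"
      then have "w \<in> carrier R" "w \<otimes> \<one> \<in> M" unfolding annihilator_def by blast+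
      then show "w \<in> M" by simp
    qed
  qed (use MA[OF cC] in blast)
  have AM: "?A M = carrier R" unfolding annihilator_def using ideal_mult[OF iM(1)] by blast
  \<comment> \<open>At \<open>M\<close> and at the whole ring the two summands are merely exchanged,
    so equality of the annihilators of \<open>I\<close> and ?I' would contradict the strict drop in
    length between them.\<close>
  have le1: "?l (?A I) + ?l I \<le> ?l (?A M) + ?l M" using mono[OF steps[OF M I(1) order_refl I(2)]] by blast
  have le2: "?l (?A (carrier R)) + ?l (carrier R) \<le> ?l (?A ?I') + ?l ?I'"
    using mono[OF steps_top[OF cI']] I II' by blast
  have lt: "?l ?I' < ?l I" using step_length_strict[OF Q steps_top[OF I] cI'] II' uI' u by blast
  have "?A ?I' \<noteq> ?A I"
  proof
    assume e: "?A ?I' = ?A I"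
    show False using le1 le2 lt unfolding e AC AM by linarith
  qed
  moreover have "?A ?I' \<subseteq> ?A I" unfolding annihilator_def using II' by blast
  ultimately obtain w where w: "w \<in> ?A I" "w \<notin> ?A ?I'" by blast
  have "w \<otimes> u \<notin> M" by (rule annihilator_simple_step(1)[OF Q M s soc I(1) u(1,3) refl w])
  then show ?thesis using w by blast
qed

end

section \<open>Flatness of Frobenius\<close>

context noetherian_cring
begin

section \<open>Additivity of the p-th power map\<close>

lemma binomial_expansion:
  assumes a: "a \<in> carrier R" and b: "b \<in> carrier R"
  shows "(a \<oplus> b) [^] n = (\<Oplus>k\<in>{..n}. [(n choose k)] \<cdot> (a [^] k \<otimes> b [^] (n - k)))"
proof (induction n)
  case 0
  then show ?case using a b by simp
next
  case (Suc n)
  let ?f = "\<lambda>m k. [(n choose k)] \<cdot> (a [^] k \<otimes> b [^] (m - k))"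
  let ?g = "\<lambda>k. [(n choose Suc k)] \<cdot> (a [^] Suc k \<otimes> b [^] (n - k))"
  have c: "?f m \<in> A \<rightarrow> carrier R" for m A using a b by auto
  have 1: "(\<Oplus>k\<in>{..n}. ?f n k) \<otimes> a = (\<Oplus>k\<in>{..n}. [(n choose k)] \<cdot> (a [^] Suc k \<otimes> b [^] (n - k)))"
  proof -
    have "(\<Oplus>k\<in>{..n}. ?f n k) \<otimes> a = (\<Oplus>k\<in>{..n}. ?f n k \<otimes> a)"
      using c a by (intro finsum_ldistr) auto
    also have "\<dots> = (\<Oplus>k\<in>{..n}. [(n choose k)] \<cdot> (a [^] Suc k \<otimes> b [^] (n - k)))"
      using a b by (intro finsum_cong') (auto simp: add_pow_ldistr add_pow_rdistr m_ac)
    finally show ?thesis .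
  qed
  have 2: "(\<Oplus>k\<in>{..n}. ?f n k) \<otimes> b = (\<Oplus>k\<in>{..n}. ?f (Suc n) k)"
  proof -
    have "(\<Oplus>k\<in>{..n}. ?f n k) \<otimes> b = (\<Oplus>k\<in>{..n}. ?f n k \<otimes> b)"
      using c b by (intro finsum_ldistr) auto
    also have "\<dots> = (\<Oplus>k\<in>{..n}. ?f (Suc n) k)"
      using a b by (intro finsum_cong') (auto simp: add_pow_ldistr m_assoc Suc_diff_le)
    finally show ?thesis .
  qed
  \<comment> \<open>Shifts the index for Pascal's rule. The sum is first extended to n + 1, where
    the binomial coefficient is 0, and then its first summand is split off.\<close>
  have 3: "(\<Oplus>k\<in>{..n}. ?f (Suc n) k) = (\<Oplus>k\<in>{..n}. ?g k) \<oplus> ?f (Suc n) 0"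
  proof -
    have "(\<Oplus>k\<in>{..Suc n}. ?f (Suc n) k) = (\<Oplus>k\<in>{..n}. ?f (Suc n) (Suc k)) \<oplus> ?f (Suc n) 0"
      using c by (intro finsum_Suc2) auto
    moreover have "(\<Oplus>k\<in>{..Suc n}. ?f (Suc n) k) = ?f (Suc n) (Suc n) \<oplus> (\<Oplus>k\<in>{..n}. ?f (Suc n) k)"
      using c by (intro finsum_Suc) auto
    moreover have "?f (Suc n) (Suc n) = \<zero>" using a b by (simp add: binomial_eq_0)
    ultimately show ?thesis using finsum_closed[OF c, of "Suc n" "{..n}"] by simp
  qed
  let ?h = "\<lambda>k. [(Suc n choose k)] \<cdot> (a [^] k \<otimes> b [^] (Suc n - k))"
  have 4: "(\<Oplus>k\<in>{..Suc n}. ?h k) = (\<Oplus>k\<in>{..n}. ?h (Suc k)) \<oplus> ?h 0"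
    using a b by (intro finsum_Suc2) auto
  have "(\<Oplus>k\<in>{..n}. ?h (Suc k)) = (\<Oplus>k\<in>{..n}. [(n choose k)] \<cdot> (a [^] Suc k \<otimes> b [^] (n - k)) \<oplus> ?g k)"
    using a b by (intro finsum_cong') (auto simp: add.nat_pow_mult[symmetric])
  also have "\<dots> = (\<Oplus>k\<in>{..n}. [(n choose k)] \<cdot> (a [^] Suc k \<otimes> b [^] (n - k))) \<oplus> (\<Oplus>k\<in>{..n}. ?g k)"
    using a b by (intro finsum_addf) auto
  finally have 5: "(\<Oplus>k\<in>{..n}. ?h (Suc k)) = \<dots>" .
  have cl: "(\<Oplus>k\<in>{..n}. [(n choose k)] \<cdot> (a [^] Suc k \<otimes> b [^] (n - k))) \<in> carrier R" "(\<Oplus>k\<in>{..n}. ?g k) \<in> carrier R"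
    using a b by (auto intro!: finsum_closed)
  have "(a \<oplus> b) [^] Suc n = (\<Oplus>k\<in>{..n}. ?f n k) \<otimes> (a \<oplus> b)" using Suc by simp
  also have "\<dots> = (\<Oplus>k\<in>{..n}. ?f n k) \<otimes> a \<oplus> (\<Oplus>k\<in>{..n}. ?f n k) \<otimes> b"
    using a b finsum_closed[OF c] by (intro r_distr) auto
  also have "\<dots> = (\<Oplus>k\<in>{..Suc n}. ?h k)"
    unfolding 4 5 1 2 3 using cl a b by (simp add: a_assoc)
  finally show ?case .
qed

end

locale noetherian_char_p = noetherian_cring +
  fixes p :: nat
  assumes prime_p: "Factorial_Ring.prime p" and char_p: "[p] \<cdot> \<one> = \<zero>"
begin

lemma p_pos: "p > 0"
  using prime_p by (rule prime_gt_0_nat)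

lemma multiple_p_zero:
  assumes "x \<in> carrier R" "p dvd m"
  shows "[m] \<cdot> x = \<zero>"
proof -
  have e: "[p] \<cdot> x = \<zero>"
    using add_pow_ldistr[of \<one> x p] char_p assms(1) by simp
  obtain j where "m = p * j" using assms(2) by blast
  then have "[m] \<cdot> x = [j] \<cdot> ([p] \<cdot> x)" using add.nat_pow_pow[OF assms(1), of j p] by simp
  then show ?thesis using e by simp
qed

lemma frobenius_add:
  assumes a: "a \<in> carrier R" and b: "b \<in> carrier R"
  shows "(a \<oplus> b) [^] p = a [^] p \<oplus> b [^] p"
proof -
  obtain m where m: "p = Suc m" using p_pos gr0_conv_Suc by blast
  let ?f = "\<lambda>k. [(p choose k)] \<cdot> (a [^] k \<otimes> b [^] (p - k))"
  have c: "?f \<in> A \<rightarrow> carrier R" for A using a b by auto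
  have "?f (Suc k) = \<zero>" if "Suc k \<le> m" for k
    using that m by (intro multiple_p_zero dvd_choose_prime prime_p) (use a b in auto)
  then have z: "(\<Oplus>k\<in>{..m}. ?f k) = ?f 0"
  proof (cases m)
    case (Suc l)
    have "(\<Oplus>k\<in>{..Suc l}. ?f k) = (\<Oplus>k\<in>{..l}. ?f (Suc k)) \<oplus> ?f 0"
      using c by (intro finsum_Suc2) auto
    also have "(\<Oplus>k\<in>{..l}. ?f (Suc k)) = \<zero>"
      using \<open>\<And>k. Suc k \<le> m \<Longrightarrow> _ k = \<zero>\<close> Suc by (intro add.finprod_one_eqI) auto
    finally show ?thesis using Suc a b by simp
  qed (use a b in simp)
  have "(a \<oplus> b) [^] p = (\<Oplus>k\<in>{..Suc m}. ?f k)" using binomial_expansion[OF a b, of p] m by simp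
  also have "\<dots> = ?f (Suc m) \<oplus> (\<Oplus>k\<in>{..m}. ?f k)" using c by (intro finsum_Suc) auto
  finally show ?thesis unfolding z using m a b by simp
qed

text \<open>Since taking p-th powers is additive, a claim about the p-th powers of all elements of
  an ideal can be checked on generators.\<close>

lemma ideal_frobenius_preimage:
  assumes L: "ideal L R"
  shows "ideal {x \<in> carrier R. x [^] p \<in> L} R"
  by (rule ideal_intro)
    (use L p_pos in \<open>auto simp: frobenius_add ideal_add nat_pow_distrib ideal_mult nat_pow_zero ideal_zero\<close>)

section \<open>Frobenius powers of ideals and their local behaviour\<close>

abbreviation frob :: "'a set \<Rightarrow> 'a set" where
  "frob J \<equiv> frobenius_power R p J"

lemma ideal_frob: "J \<subseteq> carrier R \<Longrightarrow> ideal (frob J) R"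
  unfolding frobenius_power_def by (intro genideal_ideal) auto

lemma pow_mem_frob: "J \<subseteq> carrier R \<Longrightarrow> x \<in> J \<Longrightarrow> x [^] p \<in> frob J"
  unfolding frobenius_power_def using genideal_self[of "(\<lambda>x. x [^] p) ` J"] by auto

lemma frob_least: "ideal L R \<Longrightarrow> (\<And>x. x \<in> J \<Longrightarrow> x [^] p \<in> L) \<Longrightarrow> frob J \<subseteq> L"
  unfolding frobenius_power_def by (rule genideal_minimal) auto

lemma frob_mono: "J \<subseteq> K \<Longrightarrow> K \<subseteq> carrier R \<Longrightarrow> frob J \<subseteq> frob K"
  by (rule frob_least) (auto intro: ideal_frob pow_mem_frob)

lemma frob_carrier: "frob (carrier R) = carrier R"
proof -
  have "\<one> \<in> frob (carrier R)" using pow_mem_frob[of "carrier R" \<one>] by simp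
  then show ?thesis using ideal.one_imp_carrier ideal_frob by blast
qed

lemma frob_adjoin:
  assumes K: "ideal K R" and u: "u \<in> carrier R"
  shows "frob (adjoin K u) \<subseteq> adjoin (frob K) (u [^] p)"
proof (rule frob_least)
  note Kc = ideal_subset[OF K]
  show "ideal (adjoin (frob K) (u [^] p)) R" by (intro ideal_adjoin ideal_frob Kc) (use u in simp)
  fix x assume "x \<in> adjoin K u"
  then obtain k r where k: "k \<in> K" "r \<in> carrier R" "x = k \<oplus> r \<otimes> u" by (rule adjoinE)
  have "k \<in> carrier R" using k Kc by blast
  then have "x [^] p = k [^] p \<oplus> r [^] p \<otimes> u [^] p" using k u by (simp add: frobenius_add nat_pow_distrib)
  then show "x [^] p \<in> adjoin (frob K) (u [^] p)" using k pow_mem_frob[OF Kc k(1)] by (auto intro: adjoinI)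
qed

lemma frob_Idl:
  assumes "E \<subseteq> carrier R"
  shows "frob (Idl E) \<subseteq> Idl ((\<lambda>x. x [^] p) ` E)"
proof (rule frob_least)
  have c: "(\<lambda>x. x [^] p) ` E \<subseteq> carrier R" using assms by auto
  note i = genideal_ideal[OF c]
  then show "ideal (Idl ((\<lambda>x. x [^] p) ` E)) R" .
  have "E \<subseteq> {x \<in> carrier R. x [^] p \<in> Idl ((\<lambda>x. x [^] p) ` E)}"
    using genideal_self[OF c] assms by blast
  then have "Idl E \<subseteq> {x \<in> carrier R. x [^] p \<in> Idl ((\<lambda>x. x [^] p) ` E)}"
    by (rule genideal_minimal[OF ideal_frobenius_preimage[OF i]])
  then show "\<And>x. x \<in> Idl E \<Longrightarrow> x [^] p \<in> Idl ((\<lambda>x. x [^] p) ` E)" by blast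
qed

lemma frob_sat:
  assumes Q: "primeideal Q R" and K: "ideal K R"
  shows "frob (sat Q K) \<subseteq> sat Q (frob K)"
proof (rule frob_least)
  note Kc = ideal_subset[OF K]
  show "ideal (sat Q (frob K)) R" by (intro ideal_sat Q ideal_frob Kc)
  fix x assume "x \<in> sat Q K"
  then obtain t where t: "t \<in> carrier R" "t \<notin> Q" "t \<otimes> x \<in> K" "x \<in> carrier R" by (rule satE)
  have "t [^] p \<notin> Q" using prime_pow[OF Q t(1)] t(2) by blast
  moreover have "t [^] p \<otimes> x [^] p \<in> frob K" using pow_mem_frob[OF Kc t(3)] t by (simp add: nat_pow_distrib)
  ultimately show "x [^] p \<in> sat Q (frob K)" using t by (intro satI[of "t [^] p"]) auto
qed

lemma frob_mult:
  assumes K: "K \<subseteq> carrier R" and L: "ideal L R" and w: "w \<in> carrier R"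
    and wk: "\<And>k. k \<in> K \<Longrightarrow> (w \<otimes> k) [^] p \<in> L" and x: "x \<in> frob K"
  shows "w [^] p \<otimes> x \<in> L"
proof -
  have "frob K \<subseteq> colon L (w [^] p)"
  proof (rule frob_least)
    show "ideal (colon L (w [^] p)) R" using L w by (intro ideal_colon) auto
    show "k [^] p \<in> colon L (w [^] p)" if "k \<in> K" for k
      using wk[OF that] that K w nat_pow_distrib[of w k p] by (intro colonI) auto
  qed
  then show ?thesis using x colonD by blast
qed

lemma frob_power_ideal:
  assumes "Y \<subseteq> carrier R"
  shows "frob (power_ideal a Y) \<subseteq> power_ideal (\<lambda>y. a y * p) Y"
proof -
  have "(\<lambda>x. x [^] p) ` (\<lambda>y. y [^] a y) ` Y = (\<lambda>y. y [^] (a y * p)) ` Y"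
    using assms by (force simp: nat_pow_pow subset_iff image_image)
  moreover have "(\<lambda>y. y [^] a y) ` Y \<subseteq> carrier R" using assms by auto
  ultimately show ?thesis using frob_Idl unfolding power_ideal_def by metis
qed

lemma frob_regular_system:
  assumes Q: "primeideal Q R" "Q \<subseteq> sat Q (Idl Y)" and Y: "Y \<subseteq> carrier R"
  shows "frob Q \<subseteq> sat Q (power_ideal (\<lambda>_. p) Y)"
proof -
  have iY: "ideal (Idl Y) R" using Y by (rule genideal_ideal)
  have "frob Q \<subseteq> frob (sat Q (Idl Y))" by (rule frob_mono[OF Q(2) sat_carrier])
  also have "\<dots> \<subseteq> sat Q (frob (Idl Y))" by (rule frob_sat[OF Q(1) iY])
  also have "\<dots> \<subseteq> sat Q (power_ideal (\<lambda>_. p) Y)"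
    using sat_mono[OF frob_Idl[OF Y]] unfolding power_ideal_def .
  finally show ?thesis .
qed

text \<open>Exponents add up as (N - 1) p + (p - 1) = N p - 1. Thus the p-th power of the socle
  generator for N, times the one for p, is the socle generator for N p.\<close>

lemma top_monomial_frob:
  fixes N :: nat
  assumes "finite Y" "Y \<subseteq> carrier R" "N \<ge> 1"
  shows "(top_monomial (\<lambda>_. N) Y) [^] p \<otimes> top_monomial (\<lambda>_. p) Y = top_monomial (\<lambda>_. N * p) Y"
  using assms(1,2)
proof (induction Y rule: finite_induct)
  case empty
  then show ?case by (simp add: top_monomial_def)
next
  case (insert y Y)
  have c: "y \<in> carrier R" "Y \<subseteq> carrier R" using insert by auto
  have split: "top_monomial (\<lambda>_. n) (insert y Y) = y [^] (n - 1) \<otimes> top_monomial (\<lambda>_. n) Y" for n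
    using top_monomial_split[of "insert y Y" y "\<lambda>_. n"] insert.hyps insert.prems by simp
  have "(N - 1) * p + (p - 1) = N * p - 1"
    using assms(3) p_pos by (cases N) auto
  then have "y [^] ((N - 1) * p) \<otimes> y [^] (p - 1) = y [^] (N * p - 1)"
    using nat_pow_mult[OF c(1)] by simp
  then have e: "(y [^] (N - 1)) [^] p \<otimes> y [^] (p - 1) = y [^] (N * p - 1)"
    using nat_pow_pow[OF c(1)] by simp
  let ?s = "top_monomial (\<lambda>_. N) Y" and ?t = "top_monomial (\<lambda>_. p) Y"
  have st: "?s \<in> carrier R" "?t \<in> carrier R" using c by (auto intro: top_monomial_closed)
  have "(y [^] (N - 1) \<otimes> ?s) [^] p \<otimes> (y [^] (p - 1) \<otimes> ?t)
      = ((y [^] (N - 1)) [^] p \<otimes> y [^] (p - 1)) \<otimes> (?s [^] p \<otimes> ?t)"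
    using c st by (simp add: nat_pow_distrib m_ac)
  then show ?case unfolding split e using insert.IH[OF c(2)] by simp
qed

text \<open>Krull's intersection theorem for one z at a time: u stays outside \<open>B\<close> plus
  a suitable power of z, and then the same is done with the next element.\<close>

lemma power_ideal_avoid:
  assumes Q: "primeideal Q R" and u: "u \<in> carrier R"
  shows "finite Z \<Longrightarrow> Z \<subseteq> Q \<Longrightarrow> ideal B R \<Longrightarrow> u \<notin> sat Q B \<Longrightarrow>
    \<exists>N\<ge>1. u \<notin> sat Q (Idl (B \<union> (\<lambda>z. z [^] (N::nat)) ` Z))"
proof (induction Z arbitrary: B rule: finite_induct)
  case empty
  then show ?case using Idl_eq[OF empty(2)] by (intro exI[of _ 1]) simp
next
  case (insert z Z)
  have Qc: "Q \<subseteq> carrier R" using ideal_subset[OF prime_ideal[OF Q]] .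
  have zc: "z \<in> carrier R" "z \<in> Q" and Zc: "Z \<subseteq> carrier R" using insert.prems Qc by auto
  obtain k :: nat where k: "u \<notin> sat Q (adjoin B (z [^] k))"
    using krull_principal[OF Q insert.prems(2) zc(2) u] insert.prems by blast
  let ?B = "adjoin B (z [^] k)"
  have pk: "z [^] k \<in> carrier R" using zc by simp
  have iB: "ideal ?B R" by (rule ideal_adjoin[OF insert.prems(2) pk])
  obtain N :: nat where N: "N \<ge> 1" "u \<notin> sat Q (Idl (?B \<union> (\<lambda>z. z [^] N) ` Z))"
    using insert.IH[OF _ iB k] insert.prems(1) by blast
  let ?G = "Idl (?B \<union> (\<lambda>z. z [^] N) ` Z)"
  have Gc: "?B \<union> (\<lambda>z. z [^] N) ` Z \<subseteq> carrier R" using ideal_subset[OF iB] Zc by auto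
  have iG: "ideal ?G R" using Gc by (rule genideal_ideal)
  \<comment> \<open>Raising exponents only shrinks the ideal, so the larger of the two exponents
    serves all generators.\<close>
  have big: "x [^] max N k \<in> ?G" if "x \<in> carrier R" "x [^] j \<in> ?G" "j \<le> max N k" for x and j :: nat
  proof -
    have "x [^] max N k = x [^] j \<otimes> x [^] (max N k - j)" using that nat_pow_mult by simp
    then show ?thesis using ideal_mult'[OF iG that(2)] that(1) by simp
  qed
  have "B \<union> (\<lambda>z. z [^] max N k) ` insert z Z \<subseteq> ?G"
  proof -
    have g: "?B \<union> (\<lambda>z. z [^] N) ` Z \<subseteq> ?G" using Gc by (rule genideal_self)
    have "B \<subseteq> ?G" using subset_adjoin[OF ideal_subset[OF insert.prems(2)] pk] g by blast
    moreover have "z [^] max N k \<in> ?G"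
      using g mem_adjoin[OF insert.prems(2) pk] by (intro big[OF zc(1), of k]) auto
    moreover have "x [^] max N k \<in> ?G" if "x \<in> Z" for x
      using g that Zc by (intro big[of x N]) auto
    ultimately show ?thesis by blast
  qed
  then have "Idl (B \<union> (\<lambda>z. z [^] max N k) ` insert z Z) \<subseteq> ?G" by (rule genideal_minimal[OF iG])
  then have "u \<notin> sat Q (Idl (B \<union> (\<lambda>z. z [^] max N k) ` insert z Z))" using N sat_mono by blast
  then show ?case using N by (intro exI[of _ "max N k"]) auto
qed

text \<open>Duality modulo the y^N yields w killing J such that w u has a multiple c s, with c
  outside \<open>Q\<close> and s the socle generator. Taking p-th powers turns u^p x in J^[p] into
  s^p x in the ideal of the y^(Np). If x were outside Q^[p] locally, a multiple of x would be c' t,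
  with t the socle generator for exponent p, and s^p t, which is the socle generator for N p, would
  vanish.\<close>

lemma frobenius_colon_local:
  assumes reg: "regular_system Q Y" and J: "ideal J R" and u: "u \<in> carrier R" "colon J u = Q"
    and x: "x \<in> carrier R" "u [^] p \<otimes> x \<in> frob J"
  shows "x \<in> sat Q (frob Q)"
proof (rule ccontr)
  assume nx: "x \<notin> sat Q (frob Q)"
  have Q: "primeideal Q R" and Y: "finite Y" "Y \<subseteq> Q" "Q \<subseteq> sat Q (Idl Y)" using reg unfolding regular_system_def by blast+
  have Qc: "Q \<subseteq> carrier R" using ideal_subset[OF prime_ideal[OF Q]] .
  have Yc: "Y \<subseteq> carrier R" using Y Qc by blast
  have qu: "q \<otimes> u \<in> J" if "q \<in> Q" for q
    using that u Qc colonD(1)[of q J u] m_comm[of q u] by auto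
  have uJ: "u \<notin> sat Q J"
  proof
    assume "u \<in> sat Q J"
    then obtain t where t: "t \<in> carrier R" "t \<notin> Q" "t \<otimes> u \<in> J" by (rule satE)
    then have "t \<in> colon J u" using m_comm[OF t(1) u(1)] by (intro colonI) auto
    then show False using t u by blast
  qed
  obtain N :: nat where N: "N \<ge> 1" "u \<notin> sat Q (Idl (J \<union> (\<lambda>z. z [^] N) ` Y))"
    using power_ideal_avoid[OF Q u(1) Y(1,2) J uJ] by blast
  define B where "B = Idl (J \<union> (\<lambda>z. z [^] N) ` Y)"
  define I where "I = sat Q B"
  define M where "M = sat Q (power_ideal (\<lambda>_. N) Y)"
  define s where "s = top_monomial (\<lambda>_. N) Y"
  define t where "t = top_monomial (\<lambda>_. p) Y"
  define MM where "MM = sat Q (power_ideal (\<lambda>_. N * p) Y)"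
  have Bc: "J \<union> (\<lambda>z. z [^] N) ` Y \<subseteq> carrier R" using ideal_subset[OF J] Yc by auto
  have iB: "ideal B R" unfolding B_def using Bc by (rule genideal_ideal)
  have cI: "closed_at Q I" unfolding I_def by (rule closed_at_sat[OF Q iB])
  have iP: "ideal (power_ideal n Y) R" for n by (rule ideal_power_ideal[OF Yc])
  have cM: "closed_at Q M" unfolding M_def by (rule closed_at_sat[OF Q iP])
  have iMM: "ideal MM R" unfolding MM_def by (rule ideal_sat[OF Q iP])
  have JB: "J \<subseteq> B" unfolding B_def using genideal_self[OF Bc] by blast
  have BI: "B \<subseteq> I" unfolding I_def by (rule subset_sat[OF Q ideal_subset[OF iB]])
  have MI: "M \<subseteq> I" unfolding M_def I_def B_def power_ideal_def
    by (intro sat_mono subset_Idl_subset Bc) (use genideal_self[OF Bc] in blast)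
  have sc: "s \<in> carrier R" "t \<in> carrier R" unfolding s_def t_def using Yc by (auto intro: top_monomial_closed)
  have sM: "s \<notin> M" unfolding s_def M_def using N by (intro top_monomial_notin[OF reg])
  have soc: "\<exists>v c. v \<in> carrier R \<and> c \<in> carrier R \<and> c \<notin> Q \<and> v \<otimes> w \<ominus> c \<otimes> s \<in> M"
    if "w \<in> carrier R" "w \<notin> M" for w
    unfolding s_def M_def using N that unfolding M_def by (intro multiple_top_monomial[OF Q Y])
  have only: "P = Q" if P: "primeideal P R" "M \<subseteq> P" "P \<subseteq> Q" for P
  proof -
    have "power_ideal (\<lambda>_. N) Y \<subseteq> P" using P(2) subset_sat[OF Q ideal_subset[OF iP]] unfolding M_def by blast
    then have "y [^] N \<in> P" if "y \<in> Y" for y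
      using genideal_self[of "(\<lambda>y. y [^] N) ` Y"] Yc that unfolding power_ideal_def by blast
    then have "Y \<subseteq> P" using prime_pow[OF P(1)] Yc by blast
    then have "sat Q (Idl Y) \<subseteq> P" by (rule sat_Idl_least[OF Q P(1,3)])
    then show ?thesis using Y P by blast
  qed
  have "q \<otimes> u \<in> I" if "q \<in> Q" for q using qu[OF that] JB BI by blast
  moreover have uI: "u \<notin> I" unfolding I_def B_def using N by blast
  ultimately obtain w where w: "w \<in> annihilator M I" "w \<otimes> u \<notin> M"
    using annihilator_separates[OF Q cM only sc(1) sM soc cI MI u(1)] by blast
  have wc: "w \<in> carrier R" using w unfolding annihilator_def by blast
  have frobM: "frob M \<subseteq> MM"
  proof -
    have "frob M \<subseteq> sat Q (frob (power_ideal (\<lambda>_. N) Y))" unfolding M_def by (rule frob_sat[OF Q iP])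
    also have "\<dots> \<subseteq> MM" unfolding MM_def by (rule sat_mono[OF frob_power_ideal[OF Yc]])
    finally show ?thesis .
  qed
  have Mc: "M \<subseteq> carrier R" unfolding M_def by (rule sat_carrier)
  \<comment> \<open>w multiplies J into M, so w^p multiplies J^[p] into M^[p], which lies in
    MM.\<close>
  have wux: "(w \<otimes> u) [^] p \<otimes> x \<in> MM"
  proof -
    have JI: "J \<subseteq> I" using JB BI by blast
    have "w [^] p \<otimes> (u [^] p \<otimes> x) \<in> MM"
    proof (rule frob_mult[OF ideal_subset[OF J] iMM wc _ x(2)])
      fix k assume "k \<in> J"
      then have "w \<otimes> k \<in> M" using w(1) JI unfolding annihilator_def by blast
      then show "(w \<otimes> k) [^] p \<in> MM" using pow_mem_frob[OF Mc] frobM by blast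
    qed
    then show ?thesis using wc u(1) x(1) by (simp add: nat_pow_distrib m_assoc)
  qed
  obtain v c where v: "v \<in> carrier R" "c \<in> carrier R" "c \<notin> Q" "v \<otimes> (w \<otimes> u) \<ominus> c \<otimes> s \<in> M"
    using soc[OF m_closed[OF wc u(1)] w(2)] by blast
  define m where "m = v \<otimes> (w \<otimes> u) \<ominus> c \<otimes> s"
  have mM: "m \<in> M" and mc: "m \<in> carrier R" using v wc u(1) sc unfolding m_def by auto
  have sx: "s [^] p \<otimes> x \<in> MM"
  proof -
    have "v \<otimes> (w \<otimes> u) = m \<oplus> c \<otimes> s" unfolding m_def using v(1,2) wc u(1) sc(1) by algebra
    then have "(v \<otimes> (w \<otimes> u)) [^] p = (m \<oplus> c \<otimes> s) [^] p" by simp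
    then have "v [^] p \<otimes> (w \<otimes> u) [^] p = m [^] p \<oplus> c [^] p \<otimes> s [^] p"
      using v wc u(1) sc mc by (simp add: frobenius_add nat_pow_distrib m_assoc)
    then have "v [^] p \<otimes> (w \<otimes> u) [^] p \<otimes> x = (m [^] p \<oplus> c [^] p \<otimes> s [^] p) \<otimes> x" by simp
    then have e: "v [^] p \<otimes> ((w \<otimes> u) [^] p \<otimes> x) = c [^] p \<otimes> (s [^] p \<otimes> x) \<oplus> m [^] p \<otimes> x"
      using v wc u(1) sc mc x(1) by (simp add: m_assoc l_distr a_comm)
    have "c [^] p \<otimes> (s [^] p \<otimes> x) \<oplus> m [^] p \<otimes> x \<in> MM"
      unfolding e[symmetric] using ideal_mult[OF iMM wux] v by simp
    moreover have "m [^] p \<otimes> x \<in> MM" using pow_mem_frob[OF Mc mM] frobM ideal_mult'[OF iMM _ x(1)] by blast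
    ultimately have "c [^] p \<otimes> (s [^] p \<otimes> x) \<in> MM"
      using ideal_add_cancel[OF iMM] v sc x by simp
    moreover have "c [^] p \<notin> Q" using prime_pow[OF Q v(2)] v(3) by blast
    ultimately show ?thesis using sat_cancel[OF Q, of "c [^] p" "s [^] p \<otimes> x"] v sc x unfolding MM_def by simp
  qed
  have "x \<notin> sat Q (power_ideal (\<lambda>_. p) Y)"
  proof -
    have "power_ideal (\<lambda>_. p) Y \<subseteq> frob Q" unfolding power_ideal_def
      by (rule genideal_minimal[OF ideal_frob[OF Qc]]) (use Y pow_mem_frob[OF Qc] in blast)
    then show ?thesis using nx sat_mono by blast
  qed
  then obtain v' c' where v': "v' \<in> carrier R" "c' \<in> carrier R" "c' \<notin> Q"
      "v' \<otimes> x \<ominus> c' \<otimes> t \<in> sat Q (power_ideal (\<lambda>_. p) Y)"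
    using multiple_top_monomial[OF Q Y, of "\<lambda>_. p" x] p_pos x(1) unfolding t_def by auto
  \<comment> \<open>s y is a multiple of y^N, so s^p y^p is in MM. Hence only the class of x modulo
    the y^p matters after multiplication by s^p.\<close>
  have kill: "s [^] p \<otimes> z \<in> MM" if zz: "z \<in> sat Q (power_ideal (\<lambda>_. p) Y)" for z
  proof -
    obtain r where r: "r \<in> carrier R" "r \<notin> Q" "r \<otimes> z \<in> power_ideal (\<lambda>_. p) Y" "z \<in> carrier R" using zz by (rule satE)
    have "power_ideal (\<lambda>_. p) Y \<subseteq> colon MM (s [^] p)" unfolding power_ideal_def
    proof (rule genideal_minimal[OF ideal_colon[OF iMM]])
      show "s [^] p \<in> carrier R" using sc by simp
      have "y [^] p \<in> colon MM (s [^] p)" if y: "y \<in> Y" for y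
      proof -
        have yc: "y \<in> carrier R" using y Yc by blast
        define w0 where "w0 = top_monomial (\<lambda>_. N) (Y - {y})"
        have wc: "w0 \<in> carrier R" unfolding w0_def using Yc by (intro top_monomial_closed) auto
        have pc: "y [^] (N - 1) \<in> carrier R" using yc by simp
        have "s \<otimes> y = (y [^] (N - 1) \<otimes> w0) \<otimes> y" unfolding s_def w0_def using top_monomial_split[OF Yc Y(1) y, of "\<lambda>_. N"] by simp
        also have "\<dots> = w0 \<otimes> (y [^] (N - 1) \<otimes> y)" using pc wc yc by algebra
        also have "y [^] (N - 1) \<otimes> y = y [^] N" using N nat_pow_Suc[of y "N - 1"] by simp
        finally have "s \<otimes> y = w0 \<otimes> y [^] N" .
        moreover have "y [^] N \<in> power_ideal (\<lambda>_. N) Y" unfolding power_ideal_def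
          using genideal_self[of "(\<lambda>y. y [^] N) ` Y"] Yc y by blast
        ultimately have "s \<otimes> y \<in> M"
          using ideal_mult[OF iP _ wc] subset_sat[OF Q ideal_subset[OF iP]] unfolding M_def by auto
        then have "(s \<otimes> y) [^] p \<in> MM" using pow_mem_frob[OF Mc] frobM by blast
        then show ?thesis using sc yc by (intro colonI) (auto simp: nat_pow_distrib)
      qed
      then show "(\<lambda>y. y [^] p) ` Y \<subseteq> colon MM (s [^] p)" by blast
    qed
    then have "s [^] p \<otimes> (r \<otimes> z) \<in> MM" using r colonD by blast
    moreover have "s [^] p \<in> carrier R" using sc by simp
    then have "s [^] p \<otimes> (r \<otimes> z) = r \<otimes> (s [^] p \<otimes> z)" using r(1,4) by algebra
    ultimately show ?thesis using sat_cancel[OF Q r(1,2), of "s [^] p \<otimes> z"] r sc unfolding MM_def by simp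
  qed
  have spc: "s [^] p \<in> carrier R" using sc by simp
  have "s [^] p \<otimes> (v' \<otimes> x \<ominus> c' \<otimes> t) = v' \<otimes> (s [^] p \<otimes> x) \<ominus> c' \<otimes> (s [^] p \<otimes> t)"
    using spc sc v'(1,2) x(1) by algebra
  then have "v' \<otimes> (s [^] p \<otimes> x) \<ominus> c' \<otimes> (s [^] p \<otimes> t) \<in> MM" using kill[OF v'(4)] by simp
  then have "c' \<otimes> (s [^] p \<otimes> t) \<in> MM"
    using ideal_diff_cancel2[OF iMM _ ideal_mult[OF iMM sx v'(1)]] v' spc sc by simp
  then have "s [^] p \<otimes> t \<in> MM" using sat_cancel[OF Q v'(2,3)] spc sc unfolding MM_def by simp
  then have "top_monomial (\<lambda>_. N * p) Y \<in> sat Q (power_ideal (\<lambda>_. N * p) Y)"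
    unfolding s_def t_def MM_def using top_monomial_frob[OF Y(1) Yc N(1)] by simp
  moreover have "N * p \<ge> 1" using N p_pos by simp
  ultimately show False using top_monomial_notin[OF reg, of "\<lambda>_. N * p"] by blast
qed

text \<open>Flatness tested on R / Q without speaking of modules: if u spans a copy of R / Q in R /
  J, then u^p spans a copy of R / Q^[p] in R / J^[p]. The reverse inclusion of annihilators is
  \<open>frob_colon_mult\<close>.\<close>

definition frobenius_flat_at :: "'a set \<Rightarrow> bool" where
  "frobenius_flat_at Q \<longleftrightarrow> (\<forall>J u x. ideal J R \<longrightarrow> u \<in> carrier R \<longrightarrow> colon J u = Q \<longrightarrow> x \<in> carrier R \<longrightarrow>
     u [^] p \<otimes> x \<in> frob J \<longrightarrow> x \<in> frob Q)"

lemma frob_colon_mult: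
  assumes K: "ideal K R" and u: "u \<in> carrier R" and r: "r \<in> frob (colon K u)"
  shows "r \<otimes> u [^] p \<in> frob K"
proof -
  note Kc = ideal_subset[OF K]
  have cc: "colon K u \<subseteq> carrier R" using colonD by blast
  have "u [^] p \<otimes> r \<in> frob K"
    by (rule frob_mult[OF cc ideal_frob[OF Kc] u _ r]) (intro pow_mem_frob[OF Kc] colonD)
  moreover have "r \<in> carrier R" using r ideal_carrier[OF ideal_frob[OF cc]] by blast
  ultimately show ?thesis using m_comm[of r "u [^] p"] u by simp
qed

text \<open>Write x = w + r u^p with w in K^[p]. In the auxiliary ideal I + a K the annihilator of a
  u is that of u modulo \<open>K\<close>, so flatness at this prime applies to r and gives r u^p in
  K^[p].\<close>

lemma frob_colon_descend:
  assumes I: "ideal I R" and a: "a \<in> carrier R" and K: "ideal K R" "colon I a \<subseteq> K"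
    and u: "u \<in> carrier R" "frobenius_flat_at (colon K u)"
    and x: "a [^] p \<otimes> x \<in> frob I" "x \<in> frob (adjoin K u)"
  shows "x \<in> frob K"
proof -
  note Kc = ideal_subset[OF K(1)]
  have "x \<in> adjoin (frob K) (u [^] p)" using frob_adjoin[OF K(1) u(1)] x(2) by blast
  then obtain w r where w: "w \<in> frob K" "r \<in> carrier R" "x = w \<oplus> r \<otimes> u [^] p" by (rule adjoinE)
  have wc: "w \<in> carrier R" using w ideal_carrier[OF ideal_frob[OF Kc]] by blast
  define J where "J = {i \<oplus> a \<otimes> k | i k. i \<in> I \<and> k \<in> K}"
  have iJ: "ideal J R" unfolding J_def
  proof (rule ideal_intro)
    let ?S = "{i \<oplus> a \<otimes> k | i k. i \<in> I \<and> k \<in> K}"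
    show "?S \<subseteq> carrier R" using ideal_subset[OF I] Kc a by auto
    have "\<zero> = \<zero> \<oplus> a \<otimes> \<zero>" using a by simp
    then show "\<zero> \<in> ?S" using ideal_zero[OF I] ideal_zero[OF K(1)] by blast
    fix b c assume "b \<in> ?S"
    then obtain i k where b: "i \<in> I" "k \<in> K" "b = i \<oplus> a \<otimes> k" by blast
    have bc: "i \<in> carrier R" "k \<in> carrier R" using b ideal_carrier[OF I] Kc by auto
    { assume "c \<in> ?S"
      then obtain i' k' where c: "i' \<in> I" "k' \<in> K" "c = i' \<oplus> a \<otimes> k'" by blast
      have cc: "i' \<in> carrier R" "k' \<in> carrier R" using c ideal_carrier[OF I] Kc by auto
      have "b \<oplus> c = (i \<oplus> i') \<oplus> a \<otimes> (k \<oplus> k')" unfolding b(3) c(3) using bc cc a by algebra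
      then show "b \<oplus> c \<in> ?S" using ideal_add[OF I b(1) c(1)] ideal_add[OF K(1) b(2) c(2)] by blast }
    { assume c: "c \<in> carrier R"
      have "c \<otimes> b = (c \<otimes> i) \<oplus> a \<otimes> (c \<otimes> k)" unfolding b(3) using bc c a by algebra
      then show "c \<otimes> b \<in> ?S" using ideal_mult[OF I b(1) c] ideal_mult[OF K(1) b(2) c] by blast }
  qed
  have gJ: "I \<subseteq> J" "\<And>k. k \<in> K \<Longrightarrow> a \<otimes> k \<in> J"
  proof -
    have "i = i \<oplus> a \<otimes> \<zero>" if "i \<in> I" for i using a ideal_carrier[OF I that] by simp
    then show "I \<subseteq> J" unfolding J_def using ideal_zero[OF K(1)] by blast
    have "a \<otimes> k = \<zero> \<oplus> a \<otimes> k" if "k \<in> K" for k using a Kc that by auto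
    then show "a \<otimes> k \<in> J" if "k \<in> K" for k unfolding J_def using ideal_zero[OF I] that by blast
  qed
  have auc: "a \<otimes> u \<in> carrier R" using a u by simp
  \<comment> \<open>This is where \<open>colon I a\<close> below \<open>K\<close> enters: a factor a
    may be cancelled up to elements of \<open>K\<close>.\<close>
  have "colon J (a \<otimes> u) = colon K u"
  proof
    show "colon K u \<subseteq> colon J (a \<otimes> u)"
    proof
      fix c assume "c \<in> colon K u"
      then have c: "c \<in> carrier R" "u \<otimes> c \<in> K" using colonD by auto
      then have "(a \<otimes> u) \<otimes> c \<in> J" using gJ(2)[OF c(2)] a u by (simp add: m_assoc)
      then show "c \<in> colon J (a \<otimes> u)" using c by (intro colonI)
    qed
    show "colon J (a \<otimes> u) \<subseteq> colon K u"
    proof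
      fix c assume "c \<in> colon J (a \<otimes> u)"
      then have c: "c \<in> carrier R" "(a \<otimes> u) \<otimes> c \<in> J" using colonD by auto
      then obtain i k where k: "i \<in> I" "k \<in> K" "(a \<otimes> u) \<otimes> c = i \<oplus> a \<otimes> k" unfolding J_def by blast
      have kc: "i \<in> carrier R" "k \<in> carrier R" using k ideal_carrier[OF I] Kc by auto
      have "a \<otimes> (u \<otimes> c \<ominus> k) = (a \<otimes> u) \<otimes> c \<ominus> a \<otimes> k" using a u(1) c(1) kc by algebra
      also have "\<dots> = i" unfolding k(3) using kc a by algebra
      finally have "u \<otimes> c \<ominus> k \<in> colon I a" using k kc u c by (intro colonI) auto
      then have "u \<otimes> c \<in> K" using ideal_diff_cancel[OF K(1) _ k(2)] K(2) u c by auto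
      then show "c \<in> colon K u" using c by (intro colonI)
    qed
  qed
  moreover note u(2)
  moreover have "(a \<otimes> u) [^] p \<otimes> r \<in> frob J"
  proof -
    note Jcc = ideal_subset[OF iJ]
    have apw: "a [^] p \<otimes> w \<in> frob J"
      by (rule frob_mult[OF Kc ideal_frob[OF Jcc] a _ w(1)]) (intro pow_mem_frob[OF Jcc] gJ)
    have apc: "a [^] p \<in> carrier R" "u [^] p \<in> carrier R" using a u by auto
    have "a [^] p \<otimes> x = (a [^] p \<otimes> u [^] p) \<otimes> r \<oplus> a [^] p \<otimes> w" unfolding w(3) using apc wc w(2) by algebra
    moreover have "a [^] p \<otimes> x \<in> frob J" using x(1) frob_mono[OF gJ(1) Jcc] by blast
    ultimately have "(a [^] p \<otimes> u [^] p) \<otimes> r \<in> frob J"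
      using ideal_add_cancel[OF ideal_frob[OF Jcc] _ apw] apc w by simp
    then show ?thesis using a u by (simp add: nat_pow_distrib)
  qed
  ultimately have "r \<in> frob (colon K u)" using iJ auc w(2) unfolding frobenius_flat_at_def by blast
  then have "r \<otimes> u [^] p \<in> frob K" by (rule frob_colon_mult[OF K(1) u(1)])
  then show ?thesis unfolding w(3) using ideal_add[OF ideal_frob[OF Kc] w(1)] by blast
qed

text \<open>The membership descends from the whole ring to \<open>colon I a\<close> along ideals
  \<open>K\<close> that are enlarged by elements with prime annihilator; this replaces a filtration
  of R / (I : a) with factors R / Q.\<close>

lemma frob_colon_of_primes:
  assumes I: "ideal I R" and a: "a \<in> carrier R"
    and flat: "\<And>Q. primeideal Q R \<Longrightarrow> I \<subseteq> Q \<Longrightarrow> frobenius_flat_at Q"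
    and x: "x \<in> carrier R" "a [^] p \<otimes> x \<in> frob I"
  shows "x \<in> frob (colon I a)"
proof -
  have "colon I a \<subseteq> K \<longrightarrow> x \<in> frob K" if "ideal K R" for K
    using that
  proof (rule noetherian_induct, intro impI)
    fix K assume K: "ideal K R" "colon I a \<subseteq> K"
      and IH: "\<And>L. ideal L R \<Longrightarrow> K \<subset> L \<Longrightarrow> colon I a \<subseteq> L \<longrightarrow> x \<in> frob L"
    show "x \<in> frob K"
    proof (cases "K = carrier R")
      case True
      then show ?thesis using frob_carrier x(1) by simp
    next
      case False
      then have "\<one> \<notin> K" using proper_iff[OF K(1)] by blast
      \<comment> \<open>An associated prime of R / K itself, found from the element 1. It contains
        \<open>I\<close>, so flatness is only required over \<open>I\<close>.\<close>
      then obtain r where r: "r \<in> carrier R" "r \<otimes> \<one> \<notin> K" "primeideal (colon K (r \<otimes> \<one>)) R"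
        using exists_associated_prime[OF K(1) one_closed] by blast
      then have u: "r \<in> carrier R" "r \<notin> K" "primeideal (colon K r) R" by auto
      have "I \<subseteq> colon K r" using subset_colon[OF I a] K(2) subset_colon[OF K(1) u(1)] by blast
      moreover have "K \<subset> adjoin K r"
        using subset_adjoin[OF ideal_subset[OF K(1)] u(1)] mem_adjoin[OF K(1) u(1)] u(2) by blast
      then have "x \<in> frob (adjoin K r)" using IH[OF ideal_adjoin[OF K(1) u(1)]] K(2) by blast
      ultimately show ?thesis using frob_colon_descend[OF I a K u(1)] flat[OF u(3)] x(2) by blast
    qed
  qed
  then show ?thesis using ideal_colon[OF I a] by blast
qed

end

locale regular_char_p = noetherian_char_p +
  assumes regular: "primeideal Q R \<Longrightarrow> \<exists>Y. regular_system Q Y"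
begin

text \<open>This says that T^[p] is T-primary. Every prime over T + (t^(k+1)) is strictly larger
  than \<open>T\<close>, so flatness there and t^p z in T^[p] put z into T^[p] + (t^k) for all k.
  Krull's intersection theorem at the annihilator of z then contradicts the choice of that
  prime.\<close>

lemma frob_prime_cancel:
  assumes T: "primeideal T R"
    and flat: "\<And>L. primeideal L R \<Longrightarrow> T \<subset> L \<Longrightarrow> frobenius_flat_at L"
    and t: "t \<in> carrier R" "t \<notin> T" and w: "w \<in> carrier R" "t \<otimes> w \<in> frob T"
  shows "w \<in> frob T"
proof (rule ccontr)
  note iT = prime_ideal[OF T]
  note Tc = ideal_subset[OF iT]
  note iF = ideal_frob[OF Tc]
  assume "w \<notin> frob T"
  then obtain r where r: "r \<in> carrier R" "r \<otimes> w \<notin> frob T" "primeideal (colon (frob T) (r \<otimes> w)) R"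
    using exists_associated_prime[OF iF w(1)] by blast
  let ?z = "r \<otimes> w" and ?N = "colon (frob T) (r \<otimes> w)"
  have zc: "?z \<in> carrier R" using r w by simp
  have tz: "t \<otimes> ?z \<in> frob T"
  proof -
    have "t \<otimes> ?z = r \<otimes> (t \<otimes> w)" using t(1) r(1) w(1) by algebra
    then show ?thesis using ideal_mult[OF iF w(2) r(1)] by simp
  qed
  have tN: "t \<in> ?N" using tz t zc m_comm[OF zc t(1)] by (intro colonI) auto
  have "?z \<in> sat ?N (adjoin (frob T) (t [^] (k::nat)))" for k
  proof -
    have pc: "t [^] k \<in> carrier R" "t [^] Suc k \<in> carrier R" using t by auto
    let ?I = "adjoin T (t [^] Suc k)"
    have iI: "ideal ?I R" by (rule ideal_adjoin[OF iT pc(2)])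
    have TI: "T \<subseteq> ?I" by (rule subset_adjoin[OF Tc pc(2)])
    have "t [^] Suc k \<notin> T" using prime_pow[OF T t(1)] t(2) by blast
    then have I_strict: "T \<subset> ?I" using TI mem_adjoin[OF iT pc(2)] by blast
    have flat': "frobenius_flat_at L" if "primeideal L R" "?I \<subseteq> L" for L
      using flat[OF that(1)] that(2) I_strict by blast
    obtain m where m: "p = Suc m" using p_pos gr0_conv_Suc by blast
    have "t [^] m \<otimes> (t \<otimes> ?z) \<in> frob T" using ideal_mult[OF iF tz] t by simp
    then have "t [^] p \<otimes> ?z \<in> frob T" unfolding m using t(1) zc by (simp add: m_assoc)
    then have "t [^] p \<otimes> ?z \<in> frob ?I" using frob_mono[OF TI ideal_subset[OF iI]] by blast
    then have "?z \<in> frob (colon ?I t)" using frob_colon_of_primes[OF iI t(1) flat' zc] by blast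
    \<comment> \<open>Since t is outside the prime \<open>T\<close>, it cancels modulo
      \<open>T\<close> and lowers t^(k+1) to t^k.\<close>
    moreover have "colon ?I t \<subseteq> adjoin T (t [^] k)"
    proof
      fix y assume "y \<in> colon ?I t"
      then have y: "y \<in> carrier R" "t \<otimes> y \<in> ?I" using colonD by auto
      then obtain q s where q: "q \<in> T" "s \<in> carrier R" "t \<otimes> y = q \<oplus> s \<otimes> t [^] Suc k" by (meson adjoinE)
      have qc: "q \<in> carrier R" using q Tc by blast
      have "t \<otimes> (y \<ominus> s \<otimes> t [^] k) = t \<otimes> y \<ominus> s \<otimes> (t [^] k \<otimes> t)" using t(1) y(1) q(2) pc(1) by algebra
      also have "\<dots> = (q \<oplus> s \<otimes> (t [^] k \<otimes> t)) \<ominus> s \<otimes> (t [^] k \<otimes> t)" using q(3) by simp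
      also have "\<dots> = q" using qc q(2) pc(1) t(1) by algebra
      finally have "t \<otimes> (y \<ominus> s \<otimes> t [^] k) \<in> T" using q by simp
      then have "y \<ominus> s \<otimes> t [^] k \<in> T" using prime_mult_iff[OF T t(1)] t(2) y q pc by simp
      then have "(y \<ominus> s \<otimes> t [^] k) \<oplus> s \<otimes> t [^] k \<in> adjoin T (t [^] k)" using q(2) by (intro adjoinI)
      moreover have "(y \<ominus> s \<otimes> t [^] k) \<oplus> s \<otimes> t [^] k = y" using y(1) q(2) pc(1) by algebra
      ultimately show "y \<in> adjoin T (t [^] k)" by simp
    qed
    moreover have iTk: "ideal (adjoin T (t [^] k)) R" by (rule ideal_adjoin[OF iT pc(1)])
    ultimately have "?z \<in> frob (adjoin T (t [^] k))" using frob_mono ideal_subset by blast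
    then have "?z \<in> adjoin (frob T) ((t [^] k) [^] p)" using frob_adjoin[OF iT pc(1)] by blast
    moreover have "adjoin (frob T) ((t [^] k) [^] p) \<subseteq> adjoin (frob T) (t [^] k)"
      using ideal_pow[OF ideal_adjoin[OF iF pc(1)] mem_adjoin[OF iF pc(1)] p_pos]
        subset_adjoin[OF ideal_subset[OF iF] pc(1)]
      by (intro adjoin_least ideal_adjoin[OF iF pc(1)])
    ultimately show ?thesis using adjoin_sat_subset(1)[OF r(3) iF pc(1)] by blast
  qed
  then have "?z \<in> sat ?N (frob T)" by (rule krull_principal[OF r(3) iF tN zc])
  then obtain a where a: "a \<in> carrier R" "a \<notin> ?N" "a \<otimes> ?z \<in> frob T" by (rule satE)
  then show False using m_comm[OF zc a(1)] by (auto intro: colonI)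
qed

text \<open>The local statement leaves a denominator outside \<open>T\<close>; flatness at the
  larger primes, known by induction, removes it.\<close>

lemma frobenius_flat:
  assumes "primeideal Q R"
  shows "frobenius_flat_at Q"
proof -
  have "primeideal T R \<longrightarrow> frobenius_flat_at T" if "ideal T R" for T
    using that
  proof (rule noetherian_induct, intro impI)
    fix T assume T: "primeideal T R"
      and IH: "\<And>L. ideal L R \<Longrightarrow> T \<subset> L \<Longrightarrow> primeideal L R \<longrightarrow> frobenius_flat_at L"
    have flat: "frobenius_flat_at L" if "primeideal L R" "T \<subset> L" for L
      using IH[OF prime_ideal[OF that(1)] that(2)] that(1) by blast
    show "frobenius_flat_at T" unfolding frobenius_flat_at_def
    proof (intro allI impI)
      fix J u x
      assume a: "ideal J R" "u \<in> carrier R" "colon J u = T" "x \<in> carrier R" "u [^] p \<otimes> x \<in> frob J"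
      obtain Y where "regular_system T Y" using regular[OF T] by blast
      then have "x \<in> sat T (frob T)" using a by (rule frobenius_colon_local)
      then obtain t where t: "t \<in> carrier R" "t \<notin> T" "t \<otimes> x \<in> frob T" by (rule satE)
      show "x \<in> frob T" by (rule frob_prime_cancel[OF T flat t(1,2) a(4) t(3)])
    qed
  qed
  then show ?thesis using assms prime_ideal by blast
qed

lemma frob_colon:
  "ideal I R \<Longrightarrow> a \<in> carrier R \<Longrightarrow> x \<in> carrier R \<Longrightarrow> a [^] p \<otimes> x \<in> frob I \<Longrightarrow> x \<in> frob (colon I a)"
  using frob_colon_of_primes frobenius_flat by blast

text \<open>As in the descent for colons, x = w + r u^p, and now u^p r is in (B + K)^[p]. Flatness
  moves r into ((B + K) : u)^[p], and this colon lies in K : u by the modular law, as u and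
  \<open>K\<close> are in \<open>A\<close>.\<close>

lemma frob_Int_descend:
  assumes A: "ideal A R" and B: "ideal B R" and K: "ideal K R" "A \<inter> B \<subseteq> K" "K \<subseteq> A"
    and u: "u \<in> A" and x: "x \<in> frob B" "x \<in> frob (adjoin K u)"
  shows "x \<in> frob K"
proof -
  note Kc = ideal_subset[OF K(1)]
  have uc: "u \<in> carrier R" using u ideal_carrier[OF A] by blast
  have "x \<in> adjoin (frob K) (u [^] p)" using frob_adjoin[OF K(1) uc] x(2) by blast
  then obtain w r where w: "w \<in> frob K" "r \<in> carrier R" "x = w \<oplus> r \<otimes> u [^] p" by (rule adjoinE)
  have wc: "w \<in> carrier R" using w ideal_carrier[OF ideal_frob[OF Kc]] by blast
  let ?L = "B <+>\<^bsub>R\<^esub> K"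
  have iL: "ideal ?L R" by (rule add_ideals[OF B K(1)])
  note Lc = ideal_subset[OF iL]
  have "B \<union> K \<subseteq> ?L"
    using union_genideal[OF B K(1)] genideal_self[of "B \<union> K"] ideal_subset[OF B] Kc by auto
  then have "x \<in> frob ?L" "w \<in> frob ?L" using x w frob_mono[OF _ Lc] by blast+
  then have "x \<ominus> w \<in> frob ?L" by (rule ideal_diff[OF ideal_frob[OF Lc]])
  moreover have "u [^] p \<in> carrier R" using uc by simp
  then have "x \<ominus> w = u [^] p \<otimes> r" unfolding w(3) using wc w(2) by algebra
  ultimately have "r \<in> frob (colon ?L u)" using frob_colon[OF iL uc w(2)] by simp
  moreover have "colon ?L u \<subseteq> colon K u"
  proof
    fix c assume "c \<in> colon ?L u"
    then have c: "c \<in> carrier R" "u \<otimes> c \<in> ?L" using colonD by auto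
    then obtain b k where b: "b \<in> B" "k \<in> K" "u \<otimes> c = b \<oplus> k" unfolding set_add_def' by blast
    have bc: "b \<in> carrier R" "k \<in> carrier R" using b ideal_carrier[OF B] Kc by auto
    have "b \<in> A"
    proof (rule ideal_add_cancel[OF A _ _ bc(1)])
      show "b \<oplus> k \<in> A" unfolding b(3)[symmetric] using ideal_mult'[OF A u c(1)] .
      show "k \<in> A" using b K by blast
    qed
    then have "u \<otimes> c \<in> K" unfolding b(3) using b K ideal_add[OF K(1)] by blast
    then show "c \<in> colon K u" using c by (intro colonI)
  qed
  ultimately have "r \<in> frob (colon K u)" using frob_mono[of "colon ?L u" "colon K u"] colonD by blast
  then have "r \<otimes> u [^] p \<in> frob K" by (rule frob_colon_mult[OF K(1) uc])
  then show ?thesis unfolding w(3) using ideal_add[OF ideal_frob[OF Kc] w(1)] by blast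
qed

lemma frob_Int:
  assumes A: "ideal A R" and B: "ideal B R" and x: "x \<in> frob A" "x \<in> frob B"
  shows "x \<in> frob (A \<inter> B)"
proof -
  have "A \<inter> B \<subseteq> K \<longrightarrow> K \<subseteq> A \<longrightarrow> x \<in> frob K" if "ideal K R" for K
    using that
  proof (rule noetherian_induct, intro impI)
    fix K assume K: "ideal K R" "A \<inter> B \<subseteq> K" "K \<subseteq> A"
      and IH: "\<And>L. ideal L R \<Longrightarrow> K \<subset> L \<Longrightarrow> A \<inter> B \<subseteq> L \<longrightarrow> L \<subseteq> A \<longrightarrow> x \<in> frob L"
    show "x \<in> frob K"
    proof (cases "K = A")
      case False
      then obtain u where u: "u \<in> A" "u \<notin> K" using K by blast
      have uc: "u \<in> carrier R" using u ideal_carrier[OF A] by blast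
      have "K \<subset> adjoin K u"
        using subset_adjoin[OF ideal_subset[OF K(1)] uc] mem_adjoin[OF K(1) uc] u(2) by blast
      then have "x \<in> frob (adjoin K u)"
        using IH[OF ideal_adjoin[OF K(1) uc]] K(2) adjoin_least[OF A K(3) u(1)] by blast
      then show ?thesis by (rule frob_Int_descend[OF A B K u(1) x(2)])
    qed (use x in simp)
  qed
  then show ?thesis using i_intersect[OF A B] by blast
qed

text \<open>The colon of J by a finite set is a finite intersection of colons by elements, and
  Frobenius powers are compatible with both operations.\<close>

lemma frob_colon_finite:
  assumes J: "ideal J R" and x: "x \<in> carrier R"
  shows "finite F \<Longrightarrow> F \<subseteq> carrier R \<Longrightarrow> (\<And>k. k \<in> F \<Longrightarrow> k [^] p \<otimes> x \<in> frob J) \<Longrightarrow>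
    ideal {z \<in> carrier R. \<forall>k\<in>F. k \<otimes> z \<in> J} R \<and> x \<in> frob {z \<in> carrier R. \<forall>k\<in>F. k \<otimes> z \<in> J}"
proof (induction F rule: finite_induct)
  case empty
  then show ?case using frob_carrier oneideal x by simp
next
  case (insert k F)
  have kc: "k \<in> carrier R" using insert.prems by blast
  have e: "{z \<in> carrier R. \<forall>l\<in>insert k F. l \<otimes> z \<in> J} = colon J k \<inter> {z \<in> carrier R. \<forall>l\<in>F. l \<otimes> z \<in> J}"
    unfolding colon_def by blast
  have IH: "ideal {z \<in> carrier R. \<forall>k\<in>F. k \<otimes> z \<in> J} R" "x \<in> frob {z \<in> carrier R. \<forall>k\<in>F. k \<otimes> z \<in> J}"
    using insert.IH insert.prems by blast+
  have "x \<in> frob (colon J k)" using insert.prems by (intro frob_colon[OF J kc x]) blast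
  then show ?case unfolding e using i_intersect[OF ideal_colon[OF J kc] IH(1)] frob_Int[OF ideal_colon[OF J kc] IH(1) _ IH(2)]
    by blast
qed

end

section \<open>Intersections of radical ideals\<close>

context noetherian_cring
begin

text \<open>\<open>L\<close> is finitely generated; the product of denominators for its generators
  works for all of \<open>L\<close>.\<close>

lemma uniform_denominator:
  assumes P: "primeideal P R" and K: "ideal K R" and L: "ideal L R" "L \<subseteq> sat P K"
  shows "\<exists>g\<in>carrier R - P. \<forall>x\<in>L. g \<otimes> x \<in> K"
proof -
  obtain A where A: "A \<subseteq> carrier R" "finite A" "L = Idl A" using finetely_gen[OF L(1)] by blast
  have AL: "A \<subseteq> sat P K" using genideal_self[OF A(1)] A(3) L(2) by blast
  have "\<exists>g\<in>carrier R - P. \<forall>x\<in>A. g \<otimes> x \<in> K" using A(2,1) AL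
  proof (induction A rule: finite_induct)
    case empty
    then show ?case using prime_one[OF P] by blast
  next
    case (insert a A)
    obtain g where g: "g \<in> carrier R" "g \<notin> P" "\<And>x. x \<in> A \<Longrightarrow> g \<otimes> x \<in> K" using insert.IH insert.prems by blast
    have "a \<in> sat P K" using insert.prems by blast
    then obtain t where t: "t \<in> carrier R" "t \<notin> P" "t \<otimes> a \<in> K" "a \<in> carrier R" by (rule satE)
    have "(g \<otimes> t) \<otimes> x \<in> K" if x: "x \<in> insert a A" for x
    proof (cases "x = a")
      case True
      then show ?thesis using ideal_mult[OF K t(3) g(1)] m_assoc[OF g(1) t(1,4)] by simp
    next
      case False
      then have xA: "x \<in> A" using x by blast
      have xc: "x \<in> carrier R" using xA insert.prems by blast
      have "(g \<otimes> t) \<otimes> x = t \<otimes> (g \<otimes> x)" using g(1) t(1) xc by algebra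
      then show ?thesis using ideal_mult[OF K g(3)[OF xA] t(1)] by simp
    qed
    moreover have "g \<otimes> t \<in> carrier R - P" using prime_notin_mult[OF P] g t by blast
    ultimately show ?case by blast
  qed
  then obtain g where g: "g \<in> carrier R - P" "\<forall>x\<in>A. g \<otimes> x \<in> K" by blast
  have "Idl A \<subseteq> colon K g"
    using g A(1) by (intro genideal_minimal ideal_colon K) (auto intro: colonI)
  then show ?thesis using g A(3) colonD(1) by blast
qed

text \<open>c m and d 0 may coincide, so d 0 is dropped and the lengths simply add.\<close>

lemma prime_chain_append:
  assumes c: "prime_chain R c m" and d: "prime_chain R d n" and le: "c m \<subseteq> d 0"
  shows "prime_chain R (\<lambda>i. if i \<le> m then c i else d (i - m)) (m + n)"
  unfolding prime_chain_def
proof (intro conjI allI impI)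
  fix i assume "i \<le> m + n"
  then show "primeideal (if i \<le> m then c i else d (i - m)) R"
    using c d by (auto simp: prime_chain_def)
next
  fix i assume i: "i < m + n"
  show "(if i \<le> m then c i else d (i - m)) \<subset> (if Suc i \<le> m then c (Suc i) else d (Suc i - m))"
  proof -
    consider "Suc i \<le> m" | "i = m" | "m < i" by linarith
    then show ?thesis
    proof cases
      case 1
      then show ?thesis using c by (simp add: prime_chain_def)
    next
      case 2
      then have "d 0 \<subset> d (Suc 0)" using d i by (simp add: prime_chain_def)
      then show ?thesis using 2 le by auto
    next
      case 3
      then have "d (i - m) \<subset> d (Suc (i - m))" using d i by (simp add: prime_chain_def)
      then show ?thesis using 3 by (simp add: Suc_diff_le)
    qed
  qed
qed

text \<open>Regularity of \<open>R / P\<close> at \<open>Q\<close>, expressed by elements and primes of \<open>R\<close>.\<close>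

definition regular_over :: "'a set \<Rightarrow> 'a set \<Rightarrow> bool" where
  "regular_over P Q \<longleftrightarrow> (\<exists>Z d. finite Z \<and> Z \<subseteq> Q \<and> Q \<subseteq> sat Q (Idl (P \<union> Z)) \<and>
     prime_chain R d (card Z) \<and> P \<subseteq> d 0 \<and> d (card Z) \<subseteq> Q)"

text \<open>As g is outside \<open>Q\<close>, \<open>Y\<close> still generates \<open>P\<close>
  locally at \<open>Q\<close>, and \<open>Z\<close> supplies the rest. The chain up to
  \<open>P\<close> followed by that from \<open>P\<close> to \<open>Q\<close> has the required
  length.\<close>

lemma regular_system_extend:
  assumes Y: "regular_system P Y" and Q: "primeideal Q R" and PQ: "P \<subseteq> Q"
    and g: "g \<in> carrier R" "g \<notin> Q" "\<And>x. x \<in> P \<Longrightarrow> g \<otimes> x \<in> Idl Y"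
    and Z: "finite Z" "Z \<subseteq> Q" "Q \<subseteq> sat Q (Idl (P \<union> Z))"
    and d: "prime_chain R d (card Z)" "P \<subseteq> d 0" "d (card Z) \<subseteq> Q"
  shows "regular_system Q (Y \<union> Z)"
proof -
  have P: "primeideal P R" and fY: "finite Y" and YP: "Y \<subseteq> P" using Y unfolding regular_system_def by blast+
  have Qc: "Q \<subseteq> carrier R" using ideal_subset[OF prime_ideal[OF Q]] .
  have YZ: "Y \<union> Z \<subseteq> carrier R" using YP PQ Z Qc by blast
  note iYZ = genideal_ideal[OF YZ]
  have "P \<subseteq> sat Q (Idl (Y \<union> Z))"
  proof
    fix x assume x: "x \<in> P"
    have "Y \<subseteq> Idl (Y \<union> Z)" using genideal_self[OF YZ] by blast
    then have "Idl Y \<subseteq> Idl (Y \<union> Z)" by (rule genideal_minimal[OF iYZ])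
    then show "x \<in> sat Q (Idl (Y \<union> Z))" using g x PQ Qc by (intro satI[of g]) blast+
  qed
  moreover have "Z \<subseteq> sat Q (Idl (Y \<union> Z))"
    using genideal_self[OF YZ] subset_sat[OF Q ideal_subset[OF iYZ]] by blast
  ultimately have "Idl (P \<union> Z) \<subseteq> sat Q (Idl (Y \<union> Z))" by (intro genideal_minimal ideal_sat[OF Q iYZ]) blast
  then have gen: "Q \<subseteq> sat Q (Idl (Y \<union> Z))" using Z(3) sat_least[OF Q] by blast
  obtain c where c: "prime_chain R c (card Y)" "c (card Y) = P"
    using regular_system_chain[OF Y, of "{}"] by auto
  let ?e = "\<lambda>i. if i \<le> card Y then c i else d (i - card Y)"
  have e: "prime_chain R ?e (card Y + card Z)" using c d by (intro prime_chain_append) auto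
  have top: "?e (card Y + card Z) \<subseteq> Q" using c d PQ by (cases "card Z = 0") auto
  \<comment> \<open>The height bound for the joined chain forces \<open>Y\<close> and
    \<open>Z\<close> to be disjoint.\<close>
  have "card Y + card Z \<le> card (Y \<union> Z)"
    by (rule prime_chain_height[OF Q, of "Y \<union> Z" "{}" ?e]) (use fY Z YP PQ gen e top in auto)
  then have cd: "card (Y \<union> Z) = card Y + card Z" using card_Un_le[of Y Z] by simp
  have "\<exists>e. prime_chain R e (card (Y \<union> Z)) \<and> e (card (Y \<union> Z)) \<subseteq> Q"
    unfolding cd by (rule exI[of _ ?e]) (rule conjI[OF e top])
  moreover have "finite (Y \<union> Z)" "Y \<union> Z \<subseteq> Q" using fY Z YP PQ by auto
  ultimately show ?thesis unfolding regular_system_def using Q gen by blast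
qed

end

context regular_char_p
begin

text \<open>With K = JJ^[p] : x, flatness places x in (JJ : K)^[p], so it suffices that JJ : K is
  contained in JJ. If not, an associated prime \<open>P\<close> of JJ contains K, and there x fails
  to be in P^[p] locally; the rest refutes this.\<close>

lemma frob_Inter:
  assumes gen: "\<And>P. primeideal P R \<Longrightarrow> \<exists>g\<in>carrier R - P. \<forall>Q. primeideal Q R \<longrightarrow> P \<subseteq> Q \<longrightarrow> g \<notin> Q \<longrightarrow>
      regular_over P Q"
    and J: "\<And>i. i \<in> I \<Longrightarrow> ideal (J i) R"
    and rad: "\<And>i x (n::nat). i \<in> I \<Longrightarrow> x \<in> carrier R \<Longrightarrow> x [^] n \<in> J i \<Longrightarrow> x \<in> J i"
    and x: "x \<in> carrier R" "\<And>i. i \<in> I \<Longrightarrow> x \<in> frob (J i)"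
  shows "x \<in> frob (carrier R \<inter> (\<Inter>i\<in>I. J i))"
proof -
  define JJ where "JJ = carrier R \<inter> (\<Inter>i\<in>I. J i)"
  have mem: "z \<in> JJ \<longleftrightarrow> z \<in> carrier R \<and> (\<forall>i\<in>I. z \<in> J i)" for z unfolding JJ_def by blast
  have sq: "z \<in> J i" if "i \<in> I" "z \<in> carrier R" "z \<otimes> z \<in> J i" for i z
    using rad[OF that(1,2), of 2] that(2,3) by (simp add: numeral_2_eq_2)
  have iJJ: "ideal JJ R"
    by (rule ideal_intro) (auto simp: mem ideal_zero[OF J] ideal_add[OF J] ideal_mult[OF J])
  note JJc = ideal_subset[OF iJJ]
  note iF = ideal_frob[OF JJc]
  let ?K = "colon (frob JJ) x"
  have iK: "ideal ?K R" by (rule ideal_colon[OF iF x(1)])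
  obtain F where F: "F \<subseteq> carrier R" "finite F" "?K = Idl F" using finetely_gen[OF iK] by blast
  let ?H = "{z \<in> carrier R. \<forall>k\<in>F. k \<otimes> z \<in> JJ}"
  have kp: "k [^] p \<otimes> x \<in> frob JJ" if "k \<in> F" for k
  proof -
    have "k \<in> ?K" unfolding F(3) using genideal_self[OF F(1)] that by blast
    then have "k [^] p \<in> ?K" using ideal_pow[OF iK _ p_pos] by blast
    then have "x \<otimes> k [^] p \<in> frob JJ" by (rule colonD)
    then show ?thesis using m_comm[OF x(1), of "k [^] p"] F(1) that by auto
  qed
  \<comment> \<open>?H is JJ : K written with the finitely many generators of K, the form in which
    flatness applies.\<close>
  have xH: "x \<in> frob ?H" using frob_colon_finite[OF iJJ x(1) F(2,1) kp] by blast
  have "?H \<subseteq> JJ"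
  proof (rule ccontr)
    assume "\<not> ?H \<subseteq> JJ"
    then obtain z where z: "z \<in> carrier R" "\<And>k. k \<in> F \<Longrightarrow> k \<otimes> z \<in> JJ" "z \<notin> JJ" by blast
    obtain r where r: "r \<in> carrier R" "r \<otimes> z \<notin> JJ" "primeideal (colon JJ (r \<otimes> z)) R"
      using exists_associated_prime[OF iJJ z(1,3)] by blast
    define b where "b = r \<otimes> z"
    define P where "P = colon JJ b"
    have bc: "b \<in> carrier R" and bJ: "b \<notin> JJ" and P: "primeideal P R" unfolding b_def P_def using r z by auto
    note Pc = ideal_subset[OF prime_ideal[OF P]]
    \<comment> \<open>JJ is radical, so \<open>P\<close> is the annihilator of an element outside
      \<open>P\<close>.\<close>
    have bP: "b \<notin> P"
    proof
      assume "b \<in> P"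
      then have "b \<otimes> b \<in> JJ" unfolding P_def by (rule colonD)
      then show False using bJ bc sq mem by blast
    qed
    have KP: "?K \<subseteq> P" unfolding F(3) P_def
    proof (rule genideal_minimal[OF ideal_colon[OF iJJ bc]])
      show "F \<subseteq> colon JJ b"
      proof
        fix k assume k: "k \<in> F"
        have kc: "k \<in> carrier R" using k F by blast
        have "b \<otimes> k = r \<otimes> (k \<otimes> z)" unfolding b_def using r(1) z(1) kc by algebra
        then show "k \<in> colon JJ b" using ideal_mult[OF iJJ z(2)[OF k] r(1)] kc by (intro colonI) simp_all
      qed
    qed
    \<comment> \<open>b multiplies \<open>P\<close> into JJ, hence b^p multiplies P^[p] into JJ^[p].
      A denominator t would thus put b^p t into K and so into \<open>P\<close>.\<close>
    have "x \<notin> sat P (frob P)"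
    proof
      assume "x \<in> sat P (frob P)"
      then obtain t where t: "t \<in> carrier R" "t \<notin> P" "t \<otimes> x \<in> frob P" by (rule satE)
      have "b [^] p \<otimes> (t \<otimes> x) \<in> frob JJ"
      proof (rule frob_mult[OF Pc iF bc _ t(3)])
        fix k assume "k \<in> P"
        then have "b \<otimes> k \<in> JJ" unfolding P_def by (rule colonD)
        then show "(b \<otimes> k) [^] p \<in> frob JJ" by (rule pow_mem_frob[OF JJc])
      qed
      moreover have bp: "b [^] p \<in> carrier R" using bc by simp
      then have "b [^] p \<otimes> (t \<otimes> x) = x \<otimes> (b [^] p \<otimes> t)" using t(1) x(1) by algebra
      ultimately have "b [^] p \<otimes> t \<in> ?K" using bp t by (intro colonI) simp_all
      then have "b [^] p \<otimes> t \<in> P" using KP by blast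
      then show False using prime_mult_iff[OF P bp t(1)] prime_pow[OF P bc] bP t(2) by blast
    qed
    obtain Y where Y: "regular_system P Y" using regular[OF P] by blast
    have Y': "finite Y" "Y \<subseteq> P" "P \<subseteq> sat P (Idl Y)" using Y unfolding regular_system_def by blast+
    have Yc: "Y \<subseteq> carrier R" using Y' Pc by blast
    define m where "m = top_monomial (\<lambda>_. p) Y"
    have mc: "m \<in> carrier R" unfolding m_def by (rule top_monomial_closed[OF Yc])
    have pP: "power_ideal (\<lambda>_. p) Y \<subseteq> frob P" unfolding power_ideal_def
      by (rule genideal_minimal[OF ideal_frob[OF Pc]]) (use Y' pow_mem_frob[OF Pc] in blast)
    have "x \<notin> sat P (power_ideal (\<lambda>_. p) Y)" using \<open>x \<notin> sat P (frob P)\<close> sat_mono[OF pP] by blast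
    then obtain v c where v: "v \<in> carrier R" "c \<in> carrier R" "c \<notin> P"
        "v \<otimes> x \<ominus> c \<otimes> m \<in> sat P (power_ideal (\<lambda>_. p) Y)"
      using multiple_top_monomial[OF P Y', of "\<lambda>_. p" x] p_pos x(1) unfolding m_def by auto
    obtain t where t: "t \<in> carrier R" "t \<notin> P" "t \<otimes> (v \<otimes> x \<ominus> c \<otimes> m) \<in> power_ideal (\<lambda>_. p) Y"
      using v(4) by (rule satE)
    obtain g where g: "g \<in> carrier R" "g \<notin> P" "\<And>x. x \<in> P \<Longrightarrow> g \<otimes> x \<in> Idl Y"
      using uniform_denominator[OF P genideal_ideal[OF Yc] prime_ideal[OF P] Y'(3)] by blast
    obtain g' where g': "g' \<in> carrier R" "g' \<notin> P"
      "\<And>Q. primeideal Q R \<Longrightarrow> P \<subseteq> Q \<Longrightarrow> g' \<notin> Q \<Longrightarrow> regular_over P Q" using gen[OF P] by blast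
    \<comment> \<open>The element that \<open>Q\<close> must avoid: t and c keep m detectable at
      \<open>Q\<close>, g lets \<open>Y\<close> generate \<open>P\<close> there, and g' makes R / P
      regular there.\<close>
    define e where "e = (t \<otimes> c) \<otimes> (g \<otimes> g')"
    have ec: "e \<in> carrier R" unfolding e_def using t v g g' by simp
    have eP: "e \<notin> P" unfolding e_def using prime_mult_iff[OF P] t v g g' by simp
    have bec: "b \<otimes> e \<in> carrier R" using bc ec by simp
    \<comment> \<open>As e is outside P = JJ : b, some J i misses b e; an associated prime of this J
      i serves as \<open>Q\<close>.\<close>
    have "b \<otimes> e \<notin> JJ" using eP ec unfolding P_def by (auto intro: colonI)
    then obtain i where i: "i \<in> I" "b \<otimes> e \<notin> J i" using mem bec by blast
    note Ji = J[OF i(1)]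
    obtain s where s: "s \<in> carrier R" "s \<otimes> (b \<otimes> e) \<notin> J i" "primeideal (colon (J i) (s \<otimes> (b \<otimes> e))) R"
      using exists_associated_prime[OF Ji bec i(2)] by blast
    define u where "u = s \<otimes> (b \<otimes> e)"
    define Q where "Q = colon (J i) u"
    have uc: "u \<in> carrier R" and uJ: "u \<notin> J i" and Q: "primeideal Q R" unfolding u_def Q_def using s bec by auto
    note Qc = ideal_subset[OF prime_ideal[OF Q]]
    have JQ: "J i \<subseteq> Q" unfolding Q_def by (rule subset_colon[OF Ji uc])
    \<comment> \<open>Otherwise u^2, a multiple of u b e, would be in the radical ideal J i, and so
      would u.\<close>
    have beQ: "b \<otimes> e \<notin> Q"
    proof
      assume "b \<otimes> e \<in> Q"
      then have "u \<otimes> (b \<otimes> e) \<in> J i" unfolding Q_def by (rule colonD)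
      then have "s \<otimes> (u \<otimes> (b \<otimes> e)) \<in> J i" by (rule ideal_mult[OF Ji _ s(1)])
      moreover have "s \<otimes> (u \<otimes> (b \<otimes> e)) = u \<otimes> u" unfolding u_def using s(1) bc ec by algebra
      ultimately show False using sq[OF i(1) uc] uJ by simp
    qed
    have bQ: "b \<notin> Q" and eQ: "e \<notin> Q" using beQ prime_mult_iff[OF Q bc ec] by auto
    have tc: "t \<otimes> c \<in> carrier R" "t \<otimes> c \<notin> Q" and gQ: "g \<notin> Q" "g' \<notin> Q"
      using eQ prime_mult_iff[OF Q] t(1) v(2) g(1) g'(1) unfolding e_def by simp_all
    \<comment> \<open>b multiplies \<open>P\<close> into JJ, which lies in J i and hence in
      \<open>Q\<close>, while b is outside \<open>Q\<close>.\<close>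
    have PQ: "P \<subseteq> Q"
    proof
      fix q assume q: "q \<in> P"
      then have "b \<otimes> q \<in> JJ" unfolding P_def by (rule colonD)
      then have "b \<otimes> q \<in> Q" using mem i JQ by blast
      then show "q \<in> Q" using prime_mult_iff[OF Q bc] bQ q Pc by blast
    qed
    obtain Z d where Z: "finite Z" "Z \<subseteq> Q" "Q \<subseteq> sat Q (Idl (P \<union> Z))"
      and d: "prime_chain R d (card Z)" "P \<subseteq> d 0" "d (card Z) \<subseteq> Q"
      using g'(3)[OF Q PQ gQ(2)] unfolding regular_over_def by blast
    have reg: "regular_system Q (Y \<union> Z)" by (rule regular_system_extend[OF Y Q PQ g(1) gQ(1) g(3) Z d])
    have YZ: "Y \<union> Z \<subseteq> carrier R" "finite (Y \<union> Z)" using Yc Z Qc Y' by auto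
    let ?M = "sat Q (power_ideal (\<lambda>_. p) (Y \<union> Z))"
    have iM: "ideal ?M R" by (rule ideal_sat[OF Q ideal_power_ideal[OF YZ(1)]])
    have QM: "frob Q \<subseteq> ?M" using reg unfolding regular_system_def by (intro frob_regular_system[OF Q _ YZ(1)]) blast
    have "x \<in> frob Q" using x(2)[OF i(1)] frob_mono[OF JQ Qc] by blast
    then have xM: "x \<in> ?M" using QM by blast
    have "t \<otimes> (v \<otimes> x \<ominus> c \<otimes> m) \<in> ?M" using t(3) pP frob_mono[OF PQ Qc] QM by blast
    moreover have "t \<otimes> (v \<otimes> x \<ominus> c \<otimes> m) = (t \<otimes> v) \<otimes> x \<ominus> (t \<otimes> c) \<otimes> m"
      using t(1) v(1,2) x(1) mc by algebra
    ultimately have "(t \<otimes> c) \<otimes> m \<in> ?M"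
      using ideal_diff_cancel2[OF iM _ ideal_mult[OF iM xM, of "t \<otimes> v"]] t v tc mc by simp
    then have mM: "m \<in> ?M" by (rule sat_cancel[OF Q tc mc])
    \<comment> \<open>The product formula needs disjoint factors; it makes the top monomial of
      \<open>Y\<close> and \<open>Z\<close> together a multiple of m.\<close>
    have fin: "finite (Z - Y)" "Y \<inter> (Z - Y) = {}" using Z by auto
    have "top_monomial (\<lambda>_. p) (Y \<union> (Z - Y)) = m \<otimes> top_monomial (\<lambda>_. p) (Z - Y)"
      unfolding m_def top_monomial_def using fin Y'(1) YZ(1) by (intro finprod_Un_disjoint) auto
    then have "top_monomial (\<lambda>_. p) (Y \<union> Z) \<in> ?M"
      using ideal_mult'[OF iM mM top_monomial_closed[of "Z - Y" "\<lambda>_. p"]] YZ(1) by auto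
    then show False using top_monomial_notin[OF reg, of "\<lambda>_. p"] p_pos by simp
  qed
  then have "frob ?H \<subseteq> frob JJ" using frob_mono[OF _ JJc] by blast
  then show ?thesis using xH unfolding JJ_def by blast
qed

end

section \<open>Localizations\<close>

locale localization_cring = cring +
  fixes W :: "'a set"
  assumes W_carrier: "W \<subseteq> carrier R" and one_W: "\<one> \<in> W"
    and mult_W: "\<And>s t. s \<in> W \<Longrightarrow> t \<in> W \<Longrightarrow> s \<otimes> t \<in> W"
begin

abbreviation frac where "frac \<equiv> fraction R W"
abbreviation Loc where "Loc \<equiv> localization R W"

lemma W_closed: "s \<in> W \<Longrightarrow> s \<in> carrier R"
  using W_carrier by blast

lemma frac_rel_iff: "((a, s), (b, t)) \<in> frac_rel R W \<longleftrightarrow>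
  a \<in> carrier R \<and> b \<in> carrier R \<and> s \<in> W \<and> t \<in> W \<and> (\<exists>u\<in>W. u \<otimes> (t \<otimes> a) = u \<otimes> (s \<otimes> b))"
  unfolding frac_rel_def by blast

lemma equiv_frac_rel: "equiv (carrier R \<times> W) (frac_rel R W)"
proof (rule equivI)
  show "frac_rel R W \<subseteq> (carrier R \<times> W) \<times> (carrier R \<times> W)" unfolding frac_rel_def by blast
  show "refl_on (carrier R \<times> W) (frac_rel R W)"
    using one_W by (intro refl_onI) (auto simp: frac_rel_iff)
  show "sym (frac_rel R W)"
  proof (rule symI)
    fix x y assume "(x, y) \<in> frac_rel R W"
    then show "(y, x) \<in> frac_rel R W" by (cases x; cases y) (auto simp: frac_rel_iff intro: sym)
  qed
  show "trans (frac_rel R W)"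
  proof (rule transI)
    fix x y z assume xy: "(x, y) \<in> frac_rel R W" and yz: "(y, z) \<in> frac_rel R W"
    obtain a s b t c r where e: "x = (a, s)" "y = (b, t)" "z = (c, r)" by (cases x; cases y; cases z) auto
    have 1: "a \<in> carrier R" "b \<in> carrier R" "c \<in> carrier R" "s \<in> W" "t \<in> W" "r \<in> W"
      using xy yz unfolding e by (auto simp: frac_rel_iff)
    obtain u where u: "u \<in> W" "u \<otimes> (t \<otimes> a) = u \<otimes> (s \<otimes> b)" using xy unfolding e by (auto simp: frac_rel_iff)
    obtain v where v: "v \<in> W" "v \<otimes> (r \<otimes> b) = v \<otimes> (t \<otimes> c)" using yz unfolding e by (auto simp: frac_rel_iff)
    have k: "s \<in> carrier R" "t \<in> carrier R" "r \<in> carrier R" "u \<in> carrier R" "v \<in> carrier R"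
      using 1 u v W_closed by auto
    \<comment> \<open>The witness for transitivity includes the middle denominator t besides u and
      v.\<close>
    have "(u \<otimes> v \<otimes> t) \<otimes> (r \<otimes> a) = (v \<otimes> r) \<otimes> (u \<otimes> (t \<otimes> a))" using k 1(1) by algebra
    also have "\<dots> = (v \<otimes> r) \<otimes> (u \<otimes> (s \<otimes> b))" using u by simp
    also have "\<dots> = (u \<otimes> s) \<otimes> (v \<otimes> (r \<otimes> b))" using k 1(2) by algebra
    also have "\<dots> = (u \<otimes> s) \<otimes> (v \<otimes> (t \<otimes> c))" using v by simp
    also have "\<dots> = (u \<otimes> v \<otimes> t) \<otimes> (s \<otimes> c)" using k 1(3) by algebra
    finally show "(x, z) \<in> frac_rel R W" unfolding e frac_rel_iff using 1 u v mult_W by blast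
  qed
qed

lemma frac_eq_iff:
  "a \<in> carrier R \<Longrightarrow> b \<in> carrier R \<Longrightarrow> s \<in> W \<Longrightarrow> t \<in> W \<Longrightarrow>
    frac a s = frac b t \<longleftrightarrow> (\<exists>u\<in>W. u \<otimes> (t \<otimes> a) = u \<otimes> (s \<otimes> b))"
  unfolding fraction_def using eq_equiv_class_iff[OF equiv_frac_rel, of "(a, s)" "(b, t)"]
  by (simp add: frac_rel_iff)

lemma frac_eqI:
  "a \<in> carrier R \<Longrightarrow> b \<in> carrier R \<Longrightarrow> s \<in> W \<Longrightarrow> t \<in> W \<Longrightarrow> t \<otimes> a = s \<otimes> b \<Longrightarrow> frac a s = frac b t"
  using frac_eq_iff one_W by auto

lemma Loc_carrier: "carrier Loc = {frac a s | a s. a \<in> carrier R \<and> s \<in> W}"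
  unfolding localization_def fraction_def quotient_def by auto

lemma frac_closed: "a \<in> carrier R \<Longrightarrow> s \<in> W \<Longrightarrow> frac a s \<in> carrier Loc"
  unfolding Loc_carrier by blast

lemma frac_cases:
  assumes "x \<in> carrier Loc"
  obtains a s where "a \<in> carrier R" "s \<in> W" "x = frac a s"
  using assms unfolding Loc_carrier by blast

lemma Loc_one: "\<one>\<^bsub>Loc\<^esub> = frac \<one> \<one>" and Loc_zero: "\<zero>\<^bsub>Loc\<^esub> = frac \<zero> \<one>"
  unfolding localization_def by simp_all

lemma frac_mult:
  assumes "a \<in> carrier R" "b \<in> carrier R" "s \<in> W" "t \<in> W"
  shows "frac a s \<otimes>\<^bsub>Loc\<^esub> frac b t = frac (a \<otimes> b) (s \<otimes> t)"
proof -
  have "congruent2 (frac_rel R W) (frac_rel R W) (\<lambda>x y. frac (fst x \<otimes> fst y) (snd x \<otimes> snd y))"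
  proof (rule congruent2_commuteI[OF equiv_frac_rel])
    fix y z assume "y \<in> carrier R \<times> W" "z \<in> carrier R \<times> W"
    then show "frac (fst y \<otimes> fst z) (snd y \<otimes> snd z) = frac (fst z \<otimes> fst y) (snd z \<otimes> snd y)"
      using m_comm W_closed by (auto simp: mem_Times_iff)
  next
    fix y z w assume w: "w \<in> carrier R \<times> W" and yz: "(y, z) \<in> frac_rel R W"
    obtain a s b t c r where e: "y = (a, s)" "z = (b, t)" "w = (c, r)" by (cases y; cases z; cases w) auto
    have 1: "a \<in> carrier R" "b \<in> carrier R" "c \<in> carrier R" "s \<in> W" "t \<in> W" "r \<in> W"
      using w yz unfolding e by (auto simp: frac_rel_iff)
    obtain u where u: "u \<in> W" "u \<otimes> (t \<otimes> a) = u \<otimes> (s \<otimes> b)" using yz unfolding e by (auto simp: frac_rel_iff)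
    have k: "s \<in> carrier R" "t \<in> carrier R" "r \<in> carrier R" "u \<in> carrier R" using 1 u W_closed by auto
    have "u \<otimes> ((r \<otimes> t) \<otimes> (c \<otimes> a)) = (r \<otimes> c) \<otimes> (u \<otimes> (t \<otimes> a))" using k 1(1-3) by algebra
    also have "\<dots> = (r \<otimes> c) \<otimes> (u \<otimes> (s \<otimes> b))" using u by simp
    also have "\<dots> = u \<otimes> ((r \<otimes> s) \<otimes> (c \<otimes> b))" using k 1(1-3) by algebra
    finally show "frac (fst w \<otimes> fst y) (snd w \<otimes> snd y) = frac (fst w \<otimes> fst z) (snd w \<otimes> snd z)"
      unfolding e using 1 u mult_W by (simp add: frac_eq_iff) blast
  qed
  from UN_equiv_class2[OF equiv_frac_rel equiv_frac_rel this, of "(a, s)" "(b, t)"] show ?thesis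
    using assms unfolding localization_def fraction_def[of R W a s] fraction_def[of R W b t] by simp
qed

lemma frac_add:
  assumes "a \<in> carrier R" "b \<in> carrier R" "s \<in> W" "t \<in> W"
  shows "frac a s \<oplus>\<^bsub>Loc\<^esub> frac b t = frac (t \<otimes> a \<oplus> s \<otimes> b) (s \<otimes> t)"
proof -
  have "congruent2 (frac_rel R W) (frac_rel R W)
      (\<lambda>x y. frac (snd y \<otimes> fst x \<oplus> snd x \<otimes> fst y) (snd x \<otimes> snd y))"
  proof (rule congruent2_commuteI[OF equiv_frac_rel])
    fix y z assume "y \<in> carrier R \<times> W" "z \<in> carrier R \<times> W"
    then show "frac (snd z \<otimes> fst y \<oplus> snd y \<otimes> fst z) (snd y \<otimes> snd z) = frac (snd y \<otimes> fst z \<oplus> snd z \<otimes> fst y) (snd z \<otimes> snd y)"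
      using m_comm a_comm W_closed by (auto simp: mem_Times_iff)
  next
    fix y z w assume w: "w \<in> carrier R \<times> W" and yz: "(y, z) \<in> frac_rel R W"
    obtain a s b t c r where e: "y = (a, s)" "z = (b, t)" "w = (c, r)" by (cases y; cases z; cases w) auto
    have 1: "a \<in> carrier R" "b \<in> carrier R" "c \<in> carrier R" "s \<in> W" "t \<in> W" "r \<in> W"
      using w yz unfolding e by (auto simp: frac_rel_iff)
    obtain u where u: "u \<in> W" "u \<otimes> (t \<otimes> a) = u \<otimes> (s \<otimes> b)" using yz unfolding e by (auto simp: frac_rel_iff)
    have k: "s \<in> carrier R" "t \<in> carrier R" "r \<in> carrier R" "u \<in> carrier R" using 1 u W_closed by auto
    have "u \<otimes> ((r \<otimes> t) \<otimes> (s \<otimes> c \<oplus> r \<otimes> a)) = u \<otimes> ((r \<otimes> t) \<otimes> (s \<otimes> c)) \<oplus> (r \<otimes> r) \<otimes> (u \<otimes> (t \<otimes> a))" using k 1(1-3) by algebra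
    also have "\<dots> = u \<otimes> ((r \<otimes> t) \<otimes> (s \<otimes> c)) \<oplus> (r \<otimes> r) \<otimes> (u \<otimes> (s \<otimes> b))" using u by simp
    also have "\<dots> = u \<otimes> ((r \<otimes> s) \<otimes> (t \<otimes> c \<oplus> r \<otimes> b))" using k 1(1-3) by algebra
    finally show "frac (snd y \<otimes> fst w \<oplus> snd w \<otimes> fst y) (snd w \<otimes> snd y) = frac (snd z \<otimes> fst w \<oplus> snd w \<otimes> fst z) (snd w \<otimes> snd z)"
      unfolding e using 1 u k mult_W by (simp add: frac_eq_iff) blast
  qed
  from UN_equiv_class2[OF equiv_frac_rel equiv_frac_rel this, of "(a, s)" "(b, t)"] show ?thesis
    using assms unfolding localization_def fraction_def[of R W a s] fraction_def[of R W b t] by simp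
qed

lemma cring_Loc: "cring Loc"
proof (rule cringI)
  note cl = frac_closed frac_mult frac_add mult_W W_closed
  show "abelian_group Loc"
  proof (rule abelian_groupI)
    fix x y assume "x \<in> carrier Loc" "y \<in> carrier Loc"
    then obtain a s b t where x: "a \<in> carrier R" "s \<in> W" "x = frac a s" and y: "b \<in> carrier R" "t \<in> W" "y = frac b t"
      by (elim frac_cases)
    show "x \<oplus>\<^bsub>Loc\<^esub> y \<in> carrier Loc" using x y by (simp add: cl)
    show "x \<oplus>\<^bsub>Loc\<^esub> y = y \<oplus>\<^bsub>Loc\<^esub> x" using x y m_comm[of s t] a_comm by (simp add: cl)
    fix z assume "z \<in> carrier Loc"
    then obtain c r where z: "c \<in> carrier R" "r \<in> W" "z = frac c r" by (elim frac_cases)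
    have k: "s \<in> carrier R" "t \<in> carrier R" "r \<in> carrier R" using x y z W_closed by auto
    have "r \<otimes> (t \<otimes> a \<oplus> s \<otimes> b) \<oplus> (s \<otimes> t) \<otimes> c = (t \<otimes> r) \<otimes> a \<oplus> s \<otimes> (r \<otimes> b \<oplus> t \<otimes> c)"
      using k x(1) y(1) z(1) by algebra
    moreover have "(s \<otimes> t) \<otimes> r = s \<otimes> (t \<otimes> r)" using k by algebra
    ultimately show "(x \<oplus>\<^bsub>Loc\<^esub> y) \<oplus>\<^bsub>Loc\<^esub> z = x \<oplus>\<^bsub>Loc\<^esub> (y \<oplus>\<^bsub>Loc\<^esub> z)" using x y z by (simp add: cl)
  next
    show "\<zero>\<^bsub>Loc\<^esub> \<in> carrier Loc" using one_W by (simp add: Loc_zero cl)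
    fix x assume "x \<in> carrier Loc"
    then obtain a s where x: "a \<in> carrier R" "s \<in> W" "x = frac a s" by (elim frac_cases)
    then show "\<zero>\<^bsub>Loc\<^esub> \<oplus>\<^bsub>Loc\<^esub> x = x" using one_W by (simp add: Loc_zero cl)
    have k: "s \<in> carrier R" using x W_closed by auto
    have "s \<otimes> (\<ominus> a) \<oplus> s \<otimes> a = \<zero>" using k x(1) by algebra
    then have "frac (\<ominus> a) s \<oplus>\<^bsub>Loc\<^esub> x = \<zero>\<^bsub>Loc\<^esub>"
      using x one_W k by (simp add: Loc_zero cl) (intro frac_eqI; simp add: cl)
    then show "\<exists>y\<in>carrier Loc. y \<oplus>\<^bsub>Loc\<^esub> x = \<zero>\<^bsub>Loc\<^esub>" using frac_closed[of "\<ominus> a" s] x by auto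
  qed
  show "comm_monoid Loc"
  proof (rule comm_monoidI)
    fix x y assume "x \<in> carrier Loc" "y \<in> carrier Loc"
    then obtain a s b t where x: "a \<in> carrier R" "s \<in> W" "x = frac a s" and y: "b \<in> carrier R" "t \<in> W" "y = frac b t"
      by (elim frac_cases)
    show "x \<otimes>\<^bsub>Loc\<^esub> y \<in> carrier Loc" using x y by (simp add: cl)
    show "x \<otimes>\<^bsub>Loc\<^esub> y = y \<otimes>\<^bsub>Loc\<^esub> x" using x y m_comm by (simp add: cl)
    fix z assume "z \<in> carrier Loc"
    then obtain c r where z: "c \<in> carrier R" "r \<in> W" "z = frac c r" by (elim frac_cases)
    show "(x \<otimes>\<^bsub>Loc\<^esub> y) \<otimes>\<^bsub>Loc\<^esub> z = x \<otimes>\<^bsub>Loc\<^esub> (y \<otimes>\<^bsub>Loc\<^esub> z)" using x y z by (simp add: cl m_assoc)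
  next
    show "\<one>\<^bsub>Loc\<^esub> \<in> carrier Loc" using one_W by (simp add: Loc_one cl)
    fix x assume "x \<in> carrier Loc"
    then obtain a s where x: "a \<in> carrier R" "s \<in> W" "x = frac a s" by (elim frac_cases)
    then show "\<one>\<^bsub>Loc\<^esub> \<otimes>\<^bsub>Loc\<^esub> x = x" using one_W by (simp add: Loc_one cl)
  qed
  fix x y z assume "x \<in> carrier Loc" "y \<in> carrier Loc" "z \<in> carrier Loc"
  then obtain a s b t c r where x: "a \<in> carrier R" "s \<in> W" "x = frac a s" and y: "b \<in> carrier R" "t \<in> W" "y = frac b t"
    and z: "c \<in> carrier R" "r \<in> W" "z = frac c r"
    by (elim frac_cases)
  have k: "s \<in> carrier R" "t \<in> carrier R" "r \<in> carrier R" using x y z W_closed by auto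
  have "((s \<otimes> r) \<otimes> (t \<otimes> r)) \<otimes> ((t \<otimes> a \<oplus> s \<otimes> b) \<otimes> c) = ((s \<otimes> t) \<otimes> r) \<otimes> ((t \<otimes> r) \<otimes> (a \<otimes> c) \<oplus> (s \<otimes> r) \<otimes> (b \<otimes> c))"
    using k x(1) y(1) z(1) by algebra
  then show "(x \<oplus>\<^bsub>Loc\<^esub> y) \<otimes>\<^bsub>Loc\<^esub> z = x \<otimes>\<^bsub>Loc\<^esub> z \<oplus>\<^bsub>Loc\<^esub> y \<otimes>\<^bsub>Loc\<^esub> z"
    using x y z by (simp add: cl) (intro frac_eqI; simp add: cl)
qed

lemma frac_ring_hom: "(\<lambda>a. frac a \<one>) \<in> ring_hom R Loc"
  by (rule ring_hom_memI) (use one_W in \<open>simp_all add: frac_closed frac_mult frac_add Loc_one\<close>)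

lemma frac_split: "a \<in> carrier R \<Longrightarrow> s \<in> W \<Longrightarrow> frac a s = frac \<one> s \<otimes>\<^bsub>Loc\<^esub> frac a \<one>"
  using one_W by (simp add: frac_mult W_closed)

lemma frac_clear: "a \<in> carrier R \<Longrightarrow> s \<in> W \<Longrightarrow> frac s \<one> \<otimes>\<^bsub>Loc\<^esub> frac a s = frac a \<one>"
  using one_W W_closed[of s] by (simp add: frac_mult) (intro frac_eqI; simp)

text \<open>The fraction 1/s is a unit, so ideals of the localization are determined by their
  numerators.\<close>

lemma ideal_frac_iff:
  assumes K: "ideal K Loc" and a: "a \<in> carrier R" "s \<in> W"
  shows "frac a s \<in> K \<longleftrightarrow> frac a \<one> \<in> K"
proof
  assume "frac a s \<in> K"
  then have "frac s \<one> \<otimes>\<^bsub>Loc\<^esub> frac a s \<in> K"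
    using a one_W by (intro ideal.I_l_closed[OF K] frac_closed W_closed)
  then show "frac a \<one> \<in> K" using a frac_clear by simp
next
  assume "frac a \<one> \<in> K"
  then have "frac \<one> s \<otimes>\<^bsub>Loc\<^esub> frac a \<one> \<in> K"
    using a by (intro ideal.I_l_closed[OF K] frac_closed one_closed)
  then show "frac a s \<in> K" unfolding frac_split[OF a] .
qed

text \<open>The explicit form of the extended ideal. A member may have other representations, so
  membership only provides some numerator in \<open>K\<close>.\<close>

lemma ideal_extension:
  assumes K: "ideal K R"
  shows "ideal {frac a s | a s. a \<in> K \<and> s \<in> W} Loc" (is "ideal ?E Loc")
proof -
  interpret L: cring Loc by (rule cring_Loc)
  have Kc: "a \<in> carrier R" if "a \<in> K" for a using that ideal.Icarr[OF K] by blast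
  have mult: "b \<otimes> a \<in> K" if "a \<in> K" "b \<in> carrier R" for a b using that ideal.I_l_closed[OF K] by blast
  have add: "a \<oplus> b \<in> K" if "a \<in> K" "b \<in> K" for a b
    using that additive_subgroup.a_closed[OF ideal.axioms(1)[OF K]] by blast
  have sub: "?E \<subseteq> carrier Loc" using Kc frac_closed by blast
  have lmult: "x \<otimes>\<^bsub>Loc\<^esub> y \<in> ?E" if xL: "x \<in> carrier Loc" and yE: "y \<in> ?E" for x y
  proof -
    obtain a s where x: "a \<in> carrier R" "s \<in> W" "x = frac a s" using xL by (rule frac_cases)
    obtain b t where y: "b \<in> K" "t \<in> W" "y = frac b t" using yE by blast
    have "x \<otimes>\<^bsub>Loc\<^esub> y = frac (a \<otimes> b) (s \<otimes> t)" using x y Kc frac_mult by simp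
    then show ?thesis using mult[OF y(1) x(1)] mult_W[OF x(2) y(2)] by blast
  qed
  have addc: "x \<oplus>\<^bsub>Loc\<^esub> y \<in> ?E" if xE: "x \<in> ?E" and yE: "y \<in> ?E" for x y
  proof -
    obtain a s where x: "a \<in> K" "s \<in> W" "x = frac a s" using xE by blast
    obtain b t where y: "b \<in> K" "t \<in> W" "y = frac b t" using yE by blast
    have "x \<oplus>\<^bsub>Loc\<^esub> y = frac (t \<otimes> a \<oplus> s \<otimes> b) (s \<otimes> t)" using x y Kc frac_add by simp
    then show ?thesis
      using add[OF mult[OF x(1) W_closed[OF y(2)]] mult[OF y(1) W_closed[OF x(2)]]] mult_W[OF x(2) y(2)] by blast
  qed
  have zero: "\<zero>\<^bsub>Loc\<^esub> \<in> ?E"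
    unfolding Loc_zero using additive_subgroup.zero_closed[OF ideal.axioms(1)[OF K]] one_W by blast
  show ?thesis
  proof (rule idealI)
    show "ring Loc" by (rule L.ring_axioms)
    show "subgroup ?E (add_monoid Loc)"
    proof (rule L.add.subgroupI)
      show "?E \<subseteq> carrier Loc" by (rule sub)
      show "?E \<noteq> {}" using zero by blast
      fix x assume x: "x \<in> ?E"
      then have xc: "x \<in> carrier Loc" using sub by blast
      have "(\<ominus>\<^bsub>Loc\<^esub> \<one>\<^bsub>Loc\<^esub>) \<otimes>\<^bsub>Loc\<^esub> x \<in> ?E" by (rule lmult[OF _ x]) simp
      moreover have "(\<ominus>\<^bsub>Loc\<^esub> \<one>\<^bsub>Loc\<^esub>) \<otimes>\<^bsub>Loc\<^esub> x = \<ominus>\<^bsub>Loc\<^esub> x" using xc by (simp add: L.l_minus)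
      ultimately show "\<ominus>\<^bsub>Loc\<^esub> x \<in> ?E" by (simp only:)
    next
      fix x y assume "x \<in> ?E" "y \<in> ?E"
      then show "x \<oplus>\<^bsub>Loc\<^esub> y \<in> ?E" by (rule addc)
    qed
    fix a x assume a: "a \<in> ?E" and x: "x \<in> carrier Loc"
    show "x \<otimes>\<^bsub>Loc\<^esub> a \<in> ?E" by (rule lmult[OF x a])
    then show "a \<otimes>\<^bsub>Loc\<^esub> x \<in> ?E" using L.m_comm[OF x subsetD[OF sub a]] by (simp only:)
  qed
qed

end

section \<open>Regular local rings expressed in the original ring, and fraction fields\<close>

lemma krull_dim_attained:
  assumes "krull_dim R = enat n" "primeideal P R"
  shows "\<exists>c. prime_chain R c n"
proof -
  let ?A = "{enat n | n. \<exists>c. prime_chain R c n}"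
  \<comment> \<open>One prime keeps the set nonempty, as the empty supremum is also 0. A nonempty
    set with finite supremum in \<open>enat\<close> is finite, so a longest chain exists.\<close>
  have "prime_chain R (\<lambda>_. P) 0" using assms(2) unfolding prime_chain_def by simp
  then have ne: "?A \<noteq> {}" by blast
  have "finite ?A"
    using assms(1) ne unfolding krull_dim_def Sup_enat_def by (auto split: if_splits)
  then have "Sup ?A = Max ?A" using ne unfolding Sup_enat_def by (simp only: if_False if_True)
  then have "enat n \<in> ?A" using Max_in[OF \<open>finite ?A\<close> ne] assms(1) unfolding krull_dim_def by (simp only:)
  then show ?thesis by blast
qed

text \<open>Generators of the maximal ideal are replaced by their numerators, and a longest chain of
  primes is contracted; equalities of fractions supply the denominators t.\<close>

lemma regular_local_localizationD:
  fixes R (structure)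
  assumes R: "cring R" and P: "primeideal P R" and reg: "regular_local_ring (localization_at R P)"
  shows "\<exists>Y c. finite Y \<and> Y \<subseteq> P \<and>
    (\<forall>x\<in>P. \<exists>t\<in>carrier R - P. t \<otimes> x \<in> Idl Y) \<and> prime_chain R c (card Y) \<and> c (card Y) \<subseteq> P"
proof -
  interpret cring R by (rule R)
  interpret P: primeideal P R by (rule P)
  have one_P: "\<one> \<notin> P" using P.I_notcarr P.one_imp_carrier by blast
  define W where "W = carrier R - P"
  interpret localization_cring R W
    by unfold_locales (use one_P P.I_prime in \<open>auto simp: W_def\<close>)
  have reg: "regular_local_ring Loc" using reg unfolding localization_at_def W_def .
  interpret L: cring Loc by (rule cring_Loc)
  interpret h: ring_hom_ring R Loc "\<lambda>a. frac a \<one>"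
    by (rule ring_hom_ringI2[OF ring_axioms L.ring_axioms frac_ring_hom])
  obtain A where A: "A \<subseteq> carrier Loc" "finite A" "enat (card A) = krull_dim Loc" "Idl\<^bsub>Loc\<^esub> A = max_ideal Loc"
    using conjunct2[OF conjunct2[OF reg[unfolded regular_local_ring_def]]] by (elim exE conjE)
  have ex1: "\<exists>!M. maximalideal M Loc"
    using conjunct1[OF reg[unfolded regular_local_ring_def]] unfolding local_cring_def by (rule conjunct2)
  define M where "M = max_ideal Loc"
  have maxM: "maximalideal M Loc" unfolding M_def max_ideal_def using ex1 by (rule theI')
  have primeM: "primeideal M Loc" by (rule L.maximalideal_prime[OF maxM])
  \<comment> \<open>Elements outside \<open>P\<close> become units, so primes of the localization
    contract into \<open>P\<close>.\<close>
  have unit: "a \<in> P" if K: "primeideal K Loc" "a \<in> carrier R" "frac a \<one> \<in> K" for K a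
  proof (rule ccontr)
    assume "a \<notin> P"
    then have aW: "a \<in> W" using that W_def by blast
    have iK: "ideal K Loc" using K(1) by (rule primeideal.axioms)
    have "frac a a \<in> K" using ideal_frac_iff[OF iK K(2) aW] K(3) by simp
    moreover have "frac a a = \<one>\<^bsub>Loc\<^esub>" unfolding Loc_one using K(2) aW one_W by (intro frac_eqI) auto
    ultimately have "K = carrier Loc" using ideal.one_imp_carrier[OF iK] by simp
    then show False using primeideal.I_notcarr[OF K(1)] by simp
  qed
  let ?E = "\<lambda>K. {frac a s | a s. a \<in> K \<and> s \<in> W}"
  have iP: "ideal P R" by (rule P.is_ideal)
  have "M \<subseteq> ?E P"
  proof
    fix x assume x: "x \<in> M"
    then have "x \<in> carrier Loc" using ideal.Icarr[OF primeideal.axioms(1)[OF primeM]] by blast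
    then obtain a s where a: "a \<in> carrier R" "s \<in> W" "x = frac a s" by (rule frac_cases)
    then have "frac a \<one> \<in> M" using ideal_frac_iff[OF primeideal.axioms(1)[OF primeM]] x by simp
    then have "a \<in> P" by (rule unit[OF primeM a(1)])
    then show "x \<in> ?E P" using a by blast
  qed
  moreover have "?E P \<noteq> carrier Loc"
  proof
    assume "?E P = carrier Loc"
    then have "frac \<one> \<one> \<in> ?E P" using frac_closed[OF one_closed one_W] by simp
    then obtain a s where a: "a \<in> P" "s \<in> W" "frac \<one> \<one> = frac a s" by blast
    have ac: "a \<in> carrier R" using a P.Icarr by blast
    then obtain u where u: "u \<in> W" "u \<otimes> (s \<otimes> \<one>) = u \<otimes> (\<one> \<otimes> a)"
      using a frac_eq_iff[OF one_closed ac one_W a(2)] by auto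
    then have "u \<otimes> s \<in> P" using a ac W_closed P.I_l_closed by simp
    moreover have "u \<otimes> s \<in> W" using u a mult_W by blast
    ultimately show False unfolding W_def by blast
  qed
  moreover have "?E P \<subseteq> carrier Loc" using ideal.Icarr[OF ideal_extension[OF iP]] by blast
  ultimately have MP: "M = ?E P" using maximalideal.I_maximal[OF maxM ideal_extension[OF iP]] by blast
  have "A \<subseteq> M" unfolding M_def A(4)[symmetric] by (rule L.genideal_self[OF A(1)])
  then have "\<forall>x\<in>A. \<exists>a. a \<in> P \<and> (\<exists>s\<in>W. x = frac a s)" unfolding MP by blast
  \<comment> \<open>Different generators may receive the same numerator, so \<open>Y\<close> may be
    smaller than \<open>A\<close>; the chain is shortened accordingly at the end.\<close>
  then obtain num where num: "\<And>x. x \<in> A \<Longrightarrow> num x \<in> P \<and> (\<exists>s\<in>W. x = frac (num x) s)" by metis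
  define Y where "Y = num ` A"
  have Y: "finite Y" "Y \<subseteq> P" "card Y \<le> card A" unfolding Y_def using A(2) num card_image_le by auto
  have Yc: "Y \<subseteq> carrier R" using Y P.Icarr by blast
  have iY: "ideal (Idl Y) R" by (rule genideal_ideal[OF Yc])
  have "A \<subseteq> ?E (Idl Y)"
  proof
    fix x assume x: "x \<in> A"
    then have "num x \<in> Idl Y" using genideal_self[OF Yc] unfolding Y_def by blast
    then show "x \<in> ?E (Idl Y)" using num[OF x] by blast
  qed
  then have ME: "M \<subseteq> ?E (Idl Y)" unfolding M_def A(4)[symmetric]
    by (rule L.genideal_minimal[OF ideal_extension[OF iY]])
  have gen: "\<exists>t\<in>carrier R - P. t \<otimes> x \<in> Idl Y" if x: "x \<in> P" for x
  proof -
    have xc: "x \<in> carrier R" using x P.Icarr by blast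
    have "frac x \<one> \<in> M" unfolding MP using x one_W by blast
    then obtain b s where b: "b \<in> Idl Y" "s \<in> W" "frac x \<one> = frac b s" using ME by blast
    have bc: "b \<in> carrier R" using b ideal.Icarr[OF iY] by blast
    obtain u where u: "u \<in> W" "u \<otimes> (s \<otimes> x) = u \<otimes> (\<one> \<otimes> b)"
      using b frac_eq_iff[OF xc bc one_W b(2)] by auto
    have "(u \<otimes> s) \<otimes> x = u \<otimes> b" using u b xc bc W_closed by (simp add: m_assoc)
    then have "(u \<otimes> s) \<otimes> x \<in> Idl Y" using ideal.I_l_closed[OF iY b(1) W_closed[OF u(1)]] by simp
    moreover have "u \<otimes> s \<in> carrier R - P" using mult_W[OF u(1) b(2)] unfolding W_def .
    ultimately show ?thesis by blast
  qed
  obtain c where c: "prime_chain Loc c (card A)" using krull_dim_attained[OF A(3)[symmetric] primeM] by blast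
  define c' where "c' i = {r \<in> carrier R. frac r \<one> \<in> c i}" for i
  have "prime_chain R c' (card A)" unfolding prime_chain_def
  proof (intro conjI allI impI)
    fix i assume "i \<le> card A"
    then have "primeideal (c i) Loc" using c unfolding prime_chain_def by blast
    then show "primeideal (c' i) R" unfolding c'_def by (rule h.primeideal_vimage[OF R])
  next
    fix i assume i: "i < card A"
    then have ci: "primeideal (c i) Loc" "primeideal (c (Suc i)) Loc" "c i \<subset> c (Suc i)"
      using c unfolding prime_chain_def by auto
    obtain x where x: "x \<in> c (Suc i)" "x \<notin> c i" using ci(3) by blast
    have "x \<in> carrier Loc" using x(1) ideal.Icarr[OF primeideal.axioms(1)[OF ci(2)]] by blast
    then obtain a s where a: "a \<in> carrier R" "s \<in> W" "x = frac a s" by (rule frac_cases)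
    have "a \<in> c' (Suc i)" "a \<notin> c' i"
      using a x ideal_frac_iff[OF primeideal.axioms(1)[OF ci(1)] a(1,2)]
        ideal_frac_iff[OF primeideal.axioms(1)[OF ci(2)] a(1,2)] unfolding c'_def by auto
    moreover have "c' i \<subseteq> c' (Suc i)" unfolding c'_def using ci(3) by blast
    ultimately show "c' i \<subset> c' (Suc i)" by blast
  qed
  moreover have "c' (card A) \<subseteq> P"
    using unit c unfolding c'_def prime_chain_def by blast
  ultimately have "prime_chain R c' (card Y)" "c' (card Y) \<subseteq> P"
    using Y(3) prime_chain_mono[of R c' "card A" "card Y"] prime_chain_subset[of R c' "card A" "card Y"] by auto
  then show ?thesis using Y gen by blast
qed

text \<open>Dimension 0 with the empty set of generators.\<close>

lemma regular_local_ring_field: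
  fixes F (structure)
  assumes "field F"
  shows "regular_local_ring F"
proof -
  interpret field F by (rule assms)
  have prime: "primeideal K F \<longleftrightarrow> K = {\<zero>}" for K
  proof
    assume K: "primeideal K F"
    then have "K = {\<zero>} \<or> K = carrier F" using all_ideals primeideal.axioms(1)[OF K] by blast
    then show "K = {\<zero>}" using primeideal.I_notcarr[OF K] by blast
  qed (simp add: zeroprimeideal)
  have max: "maximalideal K F \<longleftrightarrow> K = {\<zero>}" for K
    using prime maximalideal_prime zeromaximalideal by metis
  have "\<exists>!K. maximalideal K F" unfolding max by simp
  then have loc: "local_cring F" unfolding local_cring_def using is_cring by blast
  have noeth: "noetherian_ring F"
  proof (rule noetherian_ringI)
    fix I assume "ideal I F"
    then have "I = {\<zero>} \<or> I = carrier F" using all_ideals by blast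
    then have "I = Idl {\<zero>} \<or> I = Idl {\<one>}" using genideal_zero genideal_one by simp
    then show "\<exists>A\<subseteq>carrier F. finite A \<and> I = Idl A"
    proof
      assume "I = Idl {\<zero>}"
      then show ?thesis by (intro exI[of _ "{\<zero>}"]) simp
    next
      assume "I = Idl {\<one>}"
      then show ?thesis by (intro exI[of _ "{\<one>}"]) simp
    qed
  qed
  have "n = 0" if "prime_chain F c n" for c n
  proof (rule ccontr)
    assume "n \<noteq> 0"
    then have "primeideal (c 0) F" "primeideal (c 1) F" "c 0 \<subset> c 1" using that unfolding prime_chain_def by auto
    then show False using prime by blast
  qed
  moreover have "prime_chain F (\<lambda>_. {\<zero>}) 0" unfolding prime_chain_def using prime by simp
  ultimately have "{enat n | n. \<exists>c. prime_chain F c n} = {0}" by (auto simp: zero_enat_def)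
  then have "krull_dim F = 0" unfolding krull_dim_def by simp
  moreover have "max_ideal F = {\<zero>}" unfolding max_ideal_def max by simp
  moreover have "Idl {} = {\<zero>}"
    using genideal_minimal[OF zeroideal, of "{}"] additive_subgroup.zero_closed[OF ideal.axioms(1)[OF genideal_ideal[of "{}"]]] by blast
  ultimately show ?thesis unfolding regular_local_ring_def using loc noeth
    by (intro conjI exI[of _ "{}"]) (simp_all add: zero_enat_def)
qed

text \<open>The localization is the fraction field. This makes the regular locus of a domain
  nonempty.\<close>

lemma regular_local_localization_zero:
  fixes D (structure)
  assumes "domain D"
  shows "regular_local_ring (localization_at D {\<zero>})"
proof -
  interpret domain D by (rule assms)
  define W where "W = carrier D - {\<zero>}"
  interpret localization_cring D W
    by unfold_locales (use integral in \<open>auto simp: W_def\<close>)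
  interpret L: cring Loc by (rule cring_Loc)
  have "field Loc"
  proof (rule L.trivialideals_fieldI)
    have "frac \<one> \<one> \<noteq> frac \<zero> \<one>"
      using frac_eq_iff[OF one_closed zero_closed one_W one_W] W_closed by (auto simp: W_def)
    then show "carrier Loc \<noteq> {\<zero>\<^bsub>Loc\<^esub>}" using frac_closed[OF one_closed one_W] Loc_zero by auto
    show "{I. ideal I Loc} = {{\<zero>\<^bsub>Loc\<^esub>}, carrier Loc}"
    proof
      show "{{\<zero>\<^bsub>Loc\<^esub>}, carrier Loc} \<subseteq> {I. ideal I Loc}" using L.zeroideal L.oneideal by blast
      show "{I. ideal I Loc} \<subseteq> {{\<zero>\<^bsub>Loc\<^esub>}, carrier Loc}"
      proof
        fix K assume "K \<in> {I. ideal I Loc}"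
        then have K: "ideal K Loc" by blast
        show "K \<in> {{\<zero>\<^bsub>Loc\<^esub>}, carrier Loc}"
        proof (cases "K \<subseteq> {\<zero>\<^bsub>Loc\<^esub>}")
          case True
          then show ?thesis using additive_subgroup.zero_closed[OF ideal.axioms(1)[OF K]] by blast
        next
          case False
          then obtain x where x: "x \<in> K" "x \<noteq> \<zero>\<^bsub>Loc\<^esub>" by blast
          then have "x \<in> carrier Loc" using ideal.Icarr[OF K] by blast
          then obtain a s where a: "a \<in> carrier D" "s \<in> W" "x = frac a s" by (rule frac_cases)
          have "a \<noteq> \<zero>"
          proof
            assume "a = \<zero>"
            then have "x = \<zero>\<^bsub>Loc\<^esub>" unfolding a(3) Loc_zero using a W_closed one_W by (intro frac_eqI) auto
            then show False using x by blast
          qed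
          then have aW: "a \<in> W" using a W_def by blast
          have "frac a a \<in> K" using ideal_frac_iff[OF K a(1,2)] ideal_frac_iff[OF K a(1) aW] x a(3) by simp
          moreover have "frac a a = \<one>\<^bsub>Loc\<^esub>" unfolding Loc_one using a aW one_W by (intro frac_eqI) auto
          ultimately show ?thesis using ideal.one_imp_carrier[OF K] by simp
        qed
      qed
    qed
  qed
  then show ?thesis unfolding localization_at_def W_def[symmetric] by (rule regular_local_ring_field)
qed

section \<open>Excellence\<close>

context noetherian_cring
begin

text \<open>B is a copy of R / P. Generators and chains for the image of \<open>Q\<close> are pulled
  back along the surjection.\<close>

lemma regular_over_image:
  fixes B :: "('c, 'n) ring_scheme"
  assumes B: "cring B" and h: "\<psi> \<in> ring_hom R B" and surj: "\<psi> ` carrier R = carrier B"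
    and ker: "\<And>a. a \<in> carrier R \<Longrightarrow> \<psi> a = \<zero>\<^bsub>B\<^esub> \<longleftrightarrow> a \<in> P"
    and Q: "primeideal Q R" and PQ: "P \<subseteq> Q"
  shows "primeideal (\<psi> ` Q) B"
    and "regular_local_ring (localization_at B (\<psi> ` Q)) \<Longrightarrow> regular_over P Q"
proof -
  interpret B: cring B by (rule B)
  interpret h: ring_hom_ring R B \<psi> by (rule ring_hom_ringI2[OF ring_axioms B.ring_axioms h])
  note iQ = prime_ideal[OF Q]
  note Qc = ideal_subset[OF iQ]
  \<comment> \<open>An ideal containing the kernel is the full preimage of its image.\<close>
  have pull: "a \<in> K" if K: "ideal K R" "P \<subseteq> K" and a: "a \<in> carrier R" "\<psi> a \<in> \<psi> ` K" for a K
  proof -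
    obtain k where k: "k \<in> K" "\<psi> a = \<psi> k" using a(2) by blast
    have kc: "k \<in> carrier R" using k ideal_carrier[OF K(1)] by blast
    have "\<psi> (a \<ominus> k) = \<psi> a \<ominus>\<^bsub>B\<^esub> \<psi> k" using a kc by (simp add: a_minus_def B.minus_eq)
    also have "\<dots> = \<zero>\<^bsub>B\<^esub>" unfolding k(2) using kc by (simp add: a_minus_def B.r_neg)
    finally have "a \<ominus> k \<in> P" using ker[of "a \<ominus> k"] a kc by simp
    then have "a \<ominus> k \<in> K" using K(2) by blast
    then show ?thesis by (rule ideal_diff_cancel[OF K(1) _ k(1) a(1)])
  qed
  have image_ideal: "ideal (\<psi> ` K) B" if K: "ideal K R" for K
  proof (rule idealI[OF B.ring_axioms])
    have "subgroup K (add_monoid R)"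
      using ideal.axioms(1)[OF K] by (rule additive_subgroup.a_subgroup)
    then show "subgroup (\<psi> ` K) (add_monoid B)" by (rule h.img_is_add_subgroup)
    fix b y assume b: "b \<in> \<psi> ` K" and y: "y \<in> carrier B"
    obtain k where k: "k \<in> K" "b = \<psi> k" using b by blast
    obtain x where x: "x \<in> carrier R" "y = \<psi> x" using y surj by blast
    have kc: "k \<in> carrier R" using k ideal_carrier[OF K] by blast
    have "y \<otimes>\<^bsub>B\<^esub> b = \<psi> (x \<otimes> k)" "b \<otimes>\<^bsub>B\<^esub> y = \<psi> (k \<otimes> x)" using k x kc by simp_all
    then show "y \<otimes>\<^bsub>B\<^esub> b \<in> \<psi> ` K" "b \<otimes>\<^bsub>B\<^esub> y \<in> \<psi> ` K"
      using ideal_mult[OF K k(1) x(1)] ideal_mult'[OF K k(1) x(1)] by simp_all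
  qed
  show pr: "primeideal (\<psi> ` Q) B"
  proof (rule primeidealI[OF image_ideal[OF iQ] B])
    show "carrier B \<noteq> \<psi> ` Q"
    proof
      assume "carrier B = \<psi> ` Q"
      then have "\<psi> \<one> \<in> \<psi> ` Q" using surj one_closed by blast
      then show False using pull[OF iQ PQ one_closed] prime_one[OF Q] by blast
    qed
    fix x y assume xy: "x \<in> carrier B" "y \<in> carrier B" "x \<otimes>\<^bsub>B\<^esub> y \<in> \<psi> ` Q"
    obtain a where a: "a \<in> carrier R" "x = \<psi> a" using xy(1) surj by blast
    obtain b where b: "b \<in> carrier R" "y = \<psi> b" using xy(2) surj by blast
    have "\<psi> (a \<otimes> b) \<in> \<psi> ` Q" using xy(3) a b by simp
    then have "a \<otimes> b \<in> Q" by (rule pull[OF iQ PQ m_closed[OF a(1) b(1)]])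
    then have "a \<in> Q \<or> b \<in> Q" using prime_mult_iff[OF Q a(1) b(1)] by blast
    then show "x \<in> \<psi> ` Q \<or> y \<in> \<psi> ` Q" using a b by blast
  qed
  assume reg: "regular_local_ring (localization_at B (\<psi> ` Q))"
  obtain Y c where Y: "finite Y" "Y \<subseteq> \<psi> ` Q" "\<forall>x\<in>\<psi> ` Q. \<exists>t\<in>carrier B - \<psi> ` Q. t \<otimes>\<^bsub>B\<^esub> x \<in> Idl\<^bsub>B\<^esub> Y"
    and c: "prime_chain B c (card Y)" "c (card Y) \<subseteq> \<psi> ` Q"
    using regular_local_localizationD[OF B pr reg] by (elim exE conjE)
  obtain pre where pre: "\<And>y. y \<in> Y \<Longrightarrow> pre y \<in> Q \<and> y = \<psi> (pre y)" using Y(2) by (metis image_iff subset_iff)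
  define Z where "Z = pre ` Y"
  have Z: "finite Z" "Z \<subseteq> Q" "card Z \<le> card Y" unfolding Z_def using Y(1) pre card_image_le by auto
  have PZ: "P \<union> Z \<subseteq> carrier R" using PQ Z Qc by blast
  note iPZ = genideal_ideal[OF PZ]
  have PsubI: "P \<subseteq> Idl (P \<union> Z)" using genideal_self[OF PZ] by blast
  have "Y \<subseteq> \<psi> ` (Idl (P \<union> Z))"
  proof
    fix y assume y: "y \<in> Y"
    then have "pre y \<in> Idl (P \<union> Z)" using genideal_self[OF PZ] unfolding Z_def by blast
    then show "y \<in> \<psi> ` (Idl (P \<union> Z))" using pre[OF y] by blast
  qed
  then have YI: "Idl\<^bsub>B\<^esub> Y \<subseteq> \<psi> ` (Idl (P \<union> Z))" by (rule B.genideal_minimal[OF image_ideal[OF iPZ]])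
  have gen: "Q \<subseteq> sat Q (Idl (P \<union> Z))"
  proof
    fix q assume q: "q \<in> Q"
    have qc: "q \<in> carrier R" using q Qc by blast
    obtain t' where t': "t' \<in> carrier B" "t' \<notin> \<psi> ` Q" "t' \<otimes>\<^bsub>B\<^esub> \<psi> q \<in> Idl\<^bsub>B\<^esub> Y" using Y(3) q by blast
    obtain t where t: "t \<in> carrier R" "t' = \<psi> t" using t'(1) surj by blast
    have "\<psi> (t \<otimes> q) = t' \<otimes>\<^bsub>B\<^esub> \<psi> q" using t qc by simp
    then have "\<psi> (t \<otimes> q) \<in> \<psi> ` (Idl (P \<union> Z))" using t'(3) YI by auto
    then have "t \<otimes> q \<in> Idl (P \<union> Z)" by (rule pull[OF iPZ PsubI m_closed[OF t(1) qc]])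
    moreover have "t \<notin> Q" using t' t by blast
    ultimately show "q \<in> sat Q (Idl (P \<union> Z))" using t(1) qc by (intro satI[of t])
  qed
  define d where "d i = {r \<in> carrier R. \<psi> r \<in> c i}" for i
  have d: "prime_chain R d (card Y)" unfolding prime_chain_def
  proof (intro conjI allI impI)
    fix i assume "i \<le> card Y"
    then have "primeideal (c i) B" using c unfolding prime_chain_def by blast
    then show "primeideal (d i) R" unfolding d_def by (rule h.primeideal_vimage[OF is_cring])
  next
    fix i assume i: "i < card Y"
    then have ci: "primeideal (c (Suc i)) B" "c i \<subset> c (Suc i)" using c unfolding prime_chain_def by auto
    obtain x where x: "x \<in> c (Suc i)" "x \<notin> c i" using ci(2) by blast
    have "x \<in> carrier B" using x(1) ideal.Icarr[OF primeideal.axioms(1)[OF ci(1)]] by blast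
    then obtain a where a: "a \<in> carrier R" "x = \<psi> a" using surj by blast
    then have "a \<in> d (Suc i)" "a \<notin> d i" unfolding d_def using x by auto
    moreover have "d i \<subseteq> d (Suc i)" unfolding d_def using ci(2) by blast
    ultimately show "d i \<subset> d (Suc i)" by blast
  qed
  have dQ: "d (card Y) \<subseteq> Q"
  proof
    fix a assume "a \<in> d (card Y)"
    then have "a \<in> carrier R" "\<psi> a \<in> \<psi> ` Q" unfolding d_def using c(2) by auto
    then show "a \<in> Q" by (rule pull[OF iQ PQ])
  qed
  have "P \<subseteq> d 0"
  proof
    fix a assume a: "a \<in> P"
    have ac: "a \<in> carrier R" using a PQ Qc by blast
    have "primeideal (c 0) B" using c unfolding prime_chain_def by blast
    then have "\<zero>\<^bsub>B\<^esub> \<in> c 0"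
      using additive_subgroup.zero_closed[OF ideal.axioms(1)[OF primeideal.axioms(1)]] by blast
    then show "a \<in> d 0" unfolding d_def using ker[OF ac] a ac by simp
  qed
  moreover have "prime_chain R d (card Z)" "d (card Z) \<subseteq> Q"
    using prime_chain_mono[OF d Z(3)] prime_chain_subset[OF d Z(3)] dQ by auto
  ultimately show "regular_over P Q" unfolding regular_over_def using Z gen by blast
qed

text \<open>
  The condition J-2 is stated for algebras on a fixed type; \<open>B\<close> is the copy of \<open>R / P\<close> on that type.
\<close>

lemma J2_generically_regular:
  assumes J2: "J2_ring R" and P: "primeideal P R"
  shows "\<exists>g\<in>carrier R - P. \<forall>Q. primeideal Q R \<longrightarrow> P \<subseteq> Q \<longrightarrow> g \<notin> Q \<longrightarrow> regular_over P Q"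
proof -
  interpret P: primeideal P R by (rule P)
  interpret D: domain "R Quot P" by (rule P.quotient_is_domain)
  \<comment> \<open>A coset becomes the set of constant functions with values in it; evaluation at
    the empty multiset recovers the coset.\<close>
  define emb :: "'a set \<Rightarrow> (nat multiset \<Rightarrow> 'a) set" where "emb C = (\<lambda>c _. c) ` C" for C
  have inj: "inj emb"
  proof (rule injI)
    fix C D assume e: "emb C = emb D"
    have "C = (\<lambda>f. f {#}) ` emb C" for C by (simp add: emb_def image_image)
    then show "C = D" using e by metis
  qed
  then have injc: "inj_on emb (carrier (R Quot P))" using inj_on_subset by blast
  define B where "B = image_ring emb (R Quot P)"
  have domB: "domain B" unfolding B_def by (rule D.inj_imp_image_ring_is_domain[OF injc])
  interpret B: domain B by (rule domB)
  define \<psi> where "\<psi> = emb \<circ> (+>) P"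
  have "emb \<in> ring_hom (R Quot P) B"
    using inj_imp_image_ring_iso[OF injc] unfolding B_def ring_iso_def by blast
  then have h: "\<psi> \<in> ring_hom R B" unfolding \<psi>_def by (rule ring_hom_trans[OF P.rcos_ring_hom])
  have carQ: "carrier (R Quot P) = (+>) P ` carrier R" by (auto simp: FactRing_def A_RCOSETS_def')
  have surj: "\<psi> ` carrier R = carrier B"
    unfolding B_def image_ring_carrier carQ \<psi>_def by (simp add: image_comp)
  have ker: "\<psi> a = \<zero>\<^bsub>B\<^esub> \<longleftrightarrow> a \<in> P" if a: "a \<in> carrier R" for a
  proof -
    have "\<zero>\<^bsub>B\<^esub> = emb P" unfolding B_def image_ring_zero by (simp add: FactRing_def)
    then have "\<psi> a = \<zero>\<^bsub>B\<^esub> \<longleftrightarrow> P +> a = P" unfolding \<psi>_def using inj by (simp add: inj_eq)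
    then show ?thesis using P.rcos_const_imp_mem[OF a] a_rcos_zero[OF P.is_ideal] by blast
  qed
  \<comment> \<open>The map is surjective, so no further generators are needed.\<close>
  have "finite_type_hom R B \<psi>" unfolding finite_type_hom_def
  proof (intro conjI exI[of _ "{}"])
    have "\<psi> ` carrier R \<union> {} = carrier B" using surj by simp
    then show "generate_ring B (\<psi> ` carrier R \<union> {}) = carrier B"
      using B.generate_ring_in_carrier[of "carrier B"] generate_ring.incl[of _ "carrier B" B] by auto
  qed (use B.is_cring h in auto)
  then have "zariski_open B (regular_locus B)" using J2 unfolding J2_ring_def by blast
  then obtain E where E: "E \<subseteq> carrier B" "regular_locus B = {T. primeideal T B \<and> \<not> E \<subseteq> T}"
    unfolding zariski_open_def by blast
  have "{\<zero>\<^bsub>B\<^esub>} \<in> regular_locus B"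
    unfolding regular_locus_def using B.zeroprimeideal regular_local_localization_zero[OF domB] by blast
  \<comment> \<open>The zero ideal belongs to the regular locus, so \<open>E\<close> has a nonzero
    element. Any prime of B that misses it is in the regular locus, and g is a lift of it.\<close>
  then obtain b where b: "b \<in> E" "b \<noteq> \<zero>\<^bsub>B\<^esub>" unfolding E by blast
  then have "b \<in> \<psi> ` carrier R" using E surj by blast
  then obtain g where g: "g \<in> carrier R" "b = \<psi> g" by blast
  have "g \<notin> P" using ker[OF g(1)] b g by blast
  moreover have "regular_over P Q" if Q: "primeideal Q R" "P \<subseteq> Q" "g \<notin> Q" for Q
  proof -
    note im = regular_over_image[OF B.is_cring h surj ker Q(1,2)]
    have "\<psi> g \<notin> \<psi> ` Q"
    proof
      assume "\<psi> g \<in> \<psi> ` Q"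
      then obtain q where q: "q \<in> Q" "\<psi> g = \<psi> q" by blast
      have qc: "q \<in> carrier R" using q ideal_carrier[OF prime_ideal[OF Q(1)]] by blast
      have "emb (P +> g) = emb (P +> q)" using q(2) unfolding \<psi>_def by simp
      then have "P +> g = P +> q" using inj by (simp add: inj_eq)
      then have "g \<ominus> q \<in> P" using quotient_eq_iff_same_a_r_cos[OF P.is_ideal g(1) qc] by blast
      then have "g \<ominus> q \<in> Q" using Q(2) by blast
      then show False using ideal_diff_cancel[OF prime_ideal[OF Q(1)] _ q(1) g(1)] Q(3) by blast
    qed
    then have "\<not> E \<subseteq> \<psi> ` Q" using b(1) g(2) by blast
    then have "\<psi> ` Q \<in> regular_locus B" unfolding E using im(1) by blast
    then show ?thesis using im(2) unfolding regular_locus_def by blast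
  qed
  ultimately show ?thesis using g(1) by blast
qed

end

text \<open>A positive value of \<open>ring_char\<close> is not its default 0, so it is attained as
  the least vanishing multiple of 1.\<close>

lemma ring_char_zero:
  assumes "ring_char R = p" "p > 0"
  shows "[p] \<cdot>\<^bsub>R\<^esub> \<one>\<^bsub>R\<^esub> = \<zero>\<^bsub>R\<^esub>"
proof -
  have ex: "\<exists>n::nat. 0 < n \<and> [n] \<cdot>\<^bsub>R\<^esub> \<one>\<^bsub>R\<^esub> = \<zero>\<^bsub>R\<^esub>"
    using assms unfolding ring_char_def by (auto split: if_splits)
  then have "ring_char R = (LEAST n::nat. 0 < n \<and> [n] \<cdot>\<^bsub>R\<^esub> \<one>\<^bsub>R\<^esub> = \<zero>\<^bsub>R\<^esub>)"
    unfolding ring_char_def by (rule if_P)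
  then show ?thesis using LeastI_ex[OF ex] assms(1) by simp
qed

text \<open>The factor \<open>carrier S\<close> settles the empty family, whose bare intersection
  would be the whole type: both sides are then the whole ring.\<close>

theorem theoremC:
  fixes S :: "('a, 'm) ring_scheme"
    and p :: nat
    and I :: "'i set"
    and J :: "'i \<Rightarrow> 'a set"
  assumes "excellent_ring S"
    and "regular_ring S"
    and "Factorial_Ring.prime p"
    and "ring_char S = p"
    and "\<And>i. i \<in> I \<Longrightarrow> radical_ideal (J i) S"
  shows "carrier S \<inter> (\<Inter>i\<in>I. frobenius_power S p (J i))
       = frobenius_power S p (carrier S \<inter> (\<Inter>i\<in>I. J i))"
proof -
  have S: "cring S" "noetherian_ring S"
    and reg: "\<And>P. primeideal P S \<Longrightarrow> regular_local_ring (localization_at S P)"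
    using assms(2) unfolding regular_ring_def by simp_all
  have J2: "J2_ring S" using assms(1) unfolding excellent_ring_def by simp
  have char: "[p] \<cdot>\<^bsub>S\<^esub> \<one>\<^bsub>S\<^esub> = \<zero>\<^bsub>S\<^esub>" by (rule ring_char_zero[OF assms(4) prime_gt_0_nat[OF assms(3)]])
  interpret N: noetherian_cring S using S by (rule noetherian_cring.intro)
  \<comment> \<open>The local hypothesis leaves the language of localizations here: fractions become
    denominators outside Q, absorbed by \<open>N.sat\<close>.\<close>
  have system: "\<exists>Y. N.regular_system Q Y" if Q: "primeideal Q S" for Q
  proof -
    obtain Y c where Y: "finite Y" "Y \<subseteq> Q" "\<forall>x\<in>Q. \<exists>t\<in>carrier S - Q. t \<otimes>\<^bsub>S\<^esub> x \<in> Idl\<^bsub>S\<^esub> Y"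
      "prime_chain S c (card Y)" "c (card Y) \<subseteq> Q"
      using regular_local_localizationD[OF S(1) Q reg[OF Q]] by (elim exE conjE)
    have "Q \<subseteq> N.sat Q (Idl\<^bsub>S\<^esub> Y)"
      unfolding N.sat_def using Y(3) N.ideal_carrier[OF N.prime_ideal[OF Q]] by blast
    then show ?thesis unfolding N.regular_system_def using Q Y by blast
  qed
  interpret regular_char_p S p
    by unfold_locales (use assms(3) char system in auto)
  have ideal: "ideal (J i) S" and rad: "radical S (J i) = J i" if "i \<in> I" for i
    using assms(5)[OF that] unfolding radical_ideal_def by auto
  show ?thesis
  proof (intro equalityI subsetI)
    fix x assume x: "x \<in> carrier S \<inter> (\<Inter>i\<in>I. frobenius_power S p (J i))"
    show "x \<in> frobenius_power S p (carrier S \<inter> (\<Inter>i\<in>I. J i))"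
    proof (rule frob_Inter)
      fix i y and n :: nat assume "i \<in> I" "y \<in> carrier S" "y [^]\<^bsub>S\<^esub> n \<in> J i"
      then show "y \<in> J i" using rad unfolding radical_def by blast
    qed (use x ideal N.J2_generically_regular[OF J2] in auto)
  next
    fix x assume x: "x \<in> frobenius_power S p (carrier S \<inter> (\<Inter>i\<in>I. J i))"
    have "x \<in> frobenius_power S p (J i)" if i: "i \<in> I" for i
      using x frob_mono[OF _ N.ideal_subset[OF ideal[OF i]], of "carrier S \<inter> (\<Inter>i\<in>I. J i)"] i by blast
    moreover have "x \<in> carrier S" using x N.ideal_carrier[OF ideal_frob, of "carrier S \<inter> (\<Inter>i\<in>I. J i)"] by blast
    ultimately show "x \<in> carrier S \<inter> (\<Inter>i\<in>I. frobenius_power S p (J i))" by blast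
  qed
qed

end
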